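(* Let $\mathcal D=U(-1,1)$ and let $(N,u)\sim H(n,\mathcal D)$ be a random additively separable hedonic game with $n$ agents. Then the probability that Algorithm 1 (described in the context), run on $(N,u)$, outputs an individually rational partition tends to $1$ as $n\to\infty$.
   Context: Additively separable hedonic game: a finite agent set $N$ and utilities $u_a(b)\in\mathbb R$ for ordered pairs $a\neq b$. For a coalition $C\ni a$, $u_a(C)=\sum_{b\in C\setminus\{a\}}u_a(b)$; for $a\notin C$ we also write $u_a(C)=\sum_{b\in C}u_a(b)$. Random model $H(n,\mathcal D)$: $|N|=n$ and all $u_a(b)$ are i.i.d. samples from $\mathcal D$. A partition $\pi$ is individually rational if $u_a(\pi(a))\ge 0$ for every agent $a$, where $\pi(a)$ is $a$'s coalition. Algorithm 1 (input $(N,u)$, $n=|N|$, $s=\lceil \frac{\log_{16} n}{2}\rceil$); all "select" steps may be arbitrary. Stage 1: Partition $N$ into $N^1,\dots,N^{20}$ with $|N^i|\in\{\lfloor n/20\rfloor,\lceil n/20\rceil\}$. For each $i$ run the greedy clique procedure on the subgame induced by $N^i$: set $\pi_i=\emptyset$, $R=N^i$; while $R\neq\emptyset$: select $v\in R$, $C=\{v\}$, $L=R\setminus\{v\}$; while $L\ne\emptyset$ and $|C|<s$: select $w\in L$; if $u_w(z)\ge\frac12$ and $u_z(w)\ge \frac12$ for all $z\in C$ (checked pair by pair, stopping at the first failed check), add $w$ to $C$; remove $w$ from $L$. If $|C|<s$, stop and output $(\pi_i,R^i_1)$ with $R^i_1=R$; otherwise set $R\leftarrow R\setminus C$, $\pi_i\leftarrow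 \pi_i\cup\{C\}$. Let $R_1=\bigcup_i R_1^i$. Stage 2: For $k\in[20]$, a coalition $C\in\pi_k$ is compatible with a set $M$ of agents if for all $a\in M$, $b\in C$: $u_a(C)\ge -\frac{1}{80}s$ and $u_b(M)\ge -\frac{k-1}{80}s$. Set $\pi=\emptyset$. While $\pi_1\ne\emptyset$: for $k=1,\dots,20$, let $C_k$ be the first (in some order) $C\in\pi_k$ compatible with $C_1\cup\dots\cup C_{k-1}$ (or $C_k=\emptyset$ if none); the utilities between the two sides are read in each such check. If some $C_k=\emptyset$, stop; else remove each $C_k$ from $\pi_k$ and add $C_1\cup\dots\cup C_{20}$ to $\pi$. Let $R_2$ be the set of agents remaining in $\pi_1,\dots,\pi_{20}$. Stage 3: For each $x\in R=R_1\cup R_2$ in turn, select a coalition $C\in\pi$ that has not yet received an extra agent, such that $u_x(C)>0$ and no Stage-2 compatibility check involved $x$ on one side and an agent of $C$ on the other side; replace $C$ by $C\cup\{x\}$. If no such $C$ exists, the algorithm fails (counted as not producing the desired partition). Output the resulting partition of $N$. *)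

theory Defs
  imports "HOL-Probability.Probability" "HOL-Library.Disjoint_Sets"
begin

text \<open>Agents are 0,...,n-1. A utility profile u maps a b to u_a(b).\<close>
type_synonym util = "nat \<Rightarrow> nat \<Rightarrow> real"

text \<open>u_a(C): sum of u_a(b) over b in C other than a (covers both a in C and a not in C).\<close>
definition uset :: "util \<Rightarrow> nat \<Rightarrow> nat set \<Rightarrow> real" where
  "uset u a C = (\<Sum>b\<in>C - {a}. u a b)"

definition spar :: "nat \<Rightarrow> nat" where
  "spar n = nat \<lceil>log 16 (real n) / 2\<rceil>"

text \<open>Selection rules: every arbitrary "select" step of Algorithm 1 is resolved by a
  deterministic rule that may depend on n and on the current state of the algorithm.\<close>
record sel_rules =
  part :: "nat \<Rightarrow> nat \<Rightarrow> nat set"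
  selv :: "nat \<Rightarrow> nat \<Rightarrow> nat set set \<Rightarrow> nat set \<Rightarrow> nat"
  selw :: "nat \<Rightarrow> nat \<Rightarrow> nat set set \<Rightarrow> nat set \<Rightarrow> nat set \<Rightarrow> nat set \<Rightarrow> nat"
  ord2 :: "nat \<Rightarrow> nat \<Rightarrow> nat set \<Rightarrow> nat set set \<Rightarrow> nat set list"
  selx :: "nat \<Rightarrow> nat set set \<Rightarrow> nat set set \<Rightarrow> nat set \<Rightarrow> nat"
  selc :: "nat \<Rightarrow> nat \<Rightarrow> nat set set \<Rightarrow> nat set set \<Rightarrow> nat set \<Rightarrow> nat set set \<Rightarrow> nat set"

definition valid_rules :: "sel_rules \<Rightarrow> bool" where
  "valid_rules r \<longleftrightarrow>
     (\<forall>n. (\<Union>i\<in>{1..20}. part r n i) = {0..<n}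
        \<and> (\<forall>i\<in>{1..20}. \<forall>j\<in>{1..20}. i \<noteq> j \<longrightarrow> part r n i \<inter> part r n j = {})
        \<and> (\<forall>i\<in>{1..20}. card (part r n i) \<in> {n div 20, (n + 19) div 20}))
   \<and> (\<forall>n i p R. finite R \<and> R \<noteq> {} \<longrightarrow> selv r n i p R \<in> R)
   \<and> (\<forall>n i p R C L. finite L \<and> L \<noteq> {} \<longrightarrow> selw r n i p R C L \<in> L)
   \<and> (\<forall>n k M cs. finite cs \<longrightarrow> distinct (ord2 r n k M cs) \<and> set (ord2 r n k M cs) = cs)
   \<and> (\<forall>n F D X. finite X \<and> X \<noteq> {} \<longrightarrow> selx r n F D X \<in> X)
   \<and> (\<forall>n x F D X cs. finite cs \<and> cs \<noteq> {} \<longrightarrow> selc r n x F D X cs \<in> cs)"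

inductive grow :: "sel_rules \<Rightarrow> nat \<Rightarrow> util \<Rightarrow> nat \<Rightarrow> nat set set \<Rightarrow> nat set
    \<Rightarrow> nat set \<Rightarrow> nat set \<Rightarrow> nat set \<Rightarrow> bool"
  for r n u i p R where
  grow_stop: "L = {} \<or> card C \<ge> spar n \<Longrightarrow> grow r n u i p R C L C"
| grow_step: "L \<noteq> {} \<Longrightarrow> card C < spar n \<Longrightarrow> w = selw r n i p R C L \<Longrightarrow>
     C' = (if (\<forall>z\<in>C. u w z \<ge> 1/2 \<and> u z w \<ge> 1/2) then insert w C else C) \<Longrightarrow>
     grow r n u i p R C' (L - {w}) Cf \<Longrightarrow> grow r n u i p R C L Cf"

text \<open>Outer loop: greedy r n u i p R pf Rf -- from current (pi_i, R) the procedure outputs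
  (pi_i, R^i_1) = (pf, Rf).\<close>
inductive greedy :: "sel_rules \<Rightarrow> nat \<Rightarrow> util \<Rightarrow> nat \<Rightarrow> nat set set \<Rightarrow> nat set
    \<Rightarrow> nat set set \<Rightarrow> nat set \<Rightarrow> bool"
  for r n u i where
  greedy_empty: "greedy r n u i p {} p {}"
| greedy_fail: "R \<noteq> {} \<Longrightarrow> v = selv r n i p R \<Longrightarrow> grow r n u i p R {v} (R - {v}) C \<Longrightarrow>
     card C < spar n \<Longrightarrow> greedy r n u i p R p R"
| greedy_step: "R \<noteq> {} \<Longrightarrow> v = selv r n i p R \<Longrightarrow> grow r n u i p R {v} (R - {v}) C \<Longrightarrow>
     card C \<ge> spar n \<Longrightarrow> greedy r n u i (insert C p) (R - C) pf Rf \<Longrightarrow> greedy r n u i p R pf Rf"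

definition compatible :: "util \<Rightarrow> nat \<Rightarrow> nat \<Rightarrow> nat set \<Rightarrow> nat set \<Rightarrow> bool" where
  "compatible u n k M C \<longleftrightarrow>
     (\<forall>a\<in>M. \<forall>b\<in>C. uset u a C \<ge> - real (spar n) / 80
                  \<and> uset u b M \<ge> - ((real k - 1) / 80) * real (spar n))"

text \<open>Scan the coalitions of pi_k in the given order; return the first compatible one and
  the set of pairs (a,b), a in M, b in a scanned coalition, whose utilities were read.\<close>
fun scan :: "util \<Rightarrow> nat \<Rightarrow> nat \<Rightarrow> nat set \<Rightarrow> nat set list \<Rightarrow> nat set option \<times> (nat \<times> nat) set" where
  "scan u n k M [] = (None, {})"
| "scan u n k M (C # Cs) =
     (if compatible u n k M C then (Some C, M \<times> C)
      else (case scan u n k M Cs of (res, c) \<Rightarrow> (res, (M \<times> C) \<union> c)))"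

text \<open>One round (k = 1..20); called with j = 20 and M = {}; k = 20 - j at step Suc j.\<close>
primrec round2 :: "sel_rules \<Rightarrow> nat \<Rightarrow> util \<Rightarrow> (nat \<Rightarrow> nat set set) \<Rightarrow> nat \<Rightarrow> nat set
    \<Rightarrow> nat set list option \<times> (nat \<times> nat) set" where
  "round2 r n u pis 0 M = (Some [], {})"
| "round2 r n u pis (Suc j) M =
     (let k = 20 - j in
      case scan u n k M (ord2 r n k M (pis k)) of
        (None, c) \<Rightarrow> (None, c)
      | (Some C, c) \<Rightarrow>
          (case round2 r n u pis j (M \<union> C) of (res, c') \<Rightarrow> (map_option (Cons C) res, c \<union> c')))"

text \<open>stage2 r n u pis Pc ch pisf Pf chf: from state (pi_1..pi_20, Pc, checked pairs)
  the Stage 2 loop terminates in the final state.\<close>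
inductive stage2 :: "sel_rules \<Rightarrow> nat \<Rightarrow> util \<Rightarrow> (nat \<Rightarrow> nat set set) \<Rightarrow> nat set set
    \<Rightarrow> (nat \<times> nat) set \<Rightarrow> (nat \<Rightarrow> nat set set) \<Rightarrow> nat set set \<Rightarrow> (nat \<times> nat) set \<Rightarrow> bool"
  for r n u where
  s2_done: "pis 1 = {} \<Longrightarrow> stage2 r n u pis Pc ch pis Pc ch"
| s2_stop: "pis 1 \<noteq> {} \<Longrightarrow> round2 r n u pis 20 {} = (None, c) \<Longrightarrow>
     stage2 r n u pis Pc ch pis Pc (ch \<union> c)"
| s2_step: "pis 1 \<noteq> {} \<Longrightarrow> round2 r n u pis 20 {} = (Some Cs, c) \<Longrightarrow>
     stage2 r n u (\<lambda>k. if 1 \<le> k \<and> k \<le> 20 then pis k - {Cs ! (k - 1)} else pis k)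
       (insert (\<Union>(set Cs)) Pc) (ch \<union> c) pisf Pf chf \<Longrightarrow>
     stage2 r n u pis Pc ch pisf Pf chf"

definition no_check :: "(nat \<times> nat) set \<Rightarrow> nat \<Rightarrow> nat set \<Rightarrow> bool" where
  "no_check ch x C \<longleftrightarrow> (\<forall>y\<in>C. (x, y) \<notin> ch \<and> (y, x) \<notin> ch)"

text \<open>stage3 r n u ch F D X res: F = coalitions not yet extended, D = extended coalitions,
  X = agents still to place; res = None means failure.\<close>
inductive stage3 :: "sel_rules \<Rightarrow> nat \<Rightarrow> util \<Rightarrow> (nat \<times> nat) set \<Rightarrow> nat set set \<Rightarrow> nat set set
    \<Rightarrow> nat set \<Rightarrow> nat set set option \<Rightarrow> bool"
  for r n u ch where
  s3_done: "stage3 r n u ch F D {} (Some (F \<union> D))"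
| s3_fail: "X \<noteq> {} \<Longrightarrow> x = selx r n F D X \<Longrightarrow>
     {C \<in> F. uset u x C > 0 \<and> no_check ch x C} = {} \<Longrightarrow> stage3 r n u ch F D X None"
| s3_step: "X \<noteq> {} \<Longrightarrow> x = selx r n F D X \<Longrightarrow>
     cs = {C \<in> F. uset u x C > 0 \<and> no_check ch x C} \<Longrightarrow> cs \<noteq> {} \<Longrightarrow>
     C = selc r n x F D X cs \<Longrightarrow>
     stage3 r n u ch (F - {C}) (insert (insert x C) D) (X - {x}) res \<Longrightarrow>
     stage3 r n u ch F D X res"

definition alg_output :: "sel_rules \<Rightarrow> nat \<Rightarrow> util \<Rightarrow> nat set set option \<Rightarrow> bool" where
  "alg_output r n u res \<longleftrightarrow>
     (\<exists>pis R1 pis2 Pc ch.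
        (\<forall>i\<in>{1..20}. greedy r n u i {} (part r n i) (pis i) (R1 i))
      \<and> stage2 r n u pis {} {} pis2 Pc ch
      \<and> stage3 r n u ch Pc {} ((\<Union>i\<in>{1..20}. R1 i) \<union> (\<Union>k\<in>{1..20}. \<Union>(pis2 k))) res)"

definition individually_rational :: "util \<Rightarrow> nat set set \<Rightarrow> bool" where
  "individually_rational u P \<longleftrightarrow> (\<forall>C\<in>P. \<forall>a\<in>C. uset u a C \<ge> 0)"

definition alg_success :: "sel_rules \<Rightarrow> nat \<Rightarrow> util \<Rightarrow> bool" where
  "alg_success r n u \<longleftrightarrow>
     (\<exists>P. alg_output r n u (Some P) \<and> partition_on {0..<n} P \<and> individually_rational u P)"

definition offdiag :: "nat \<Rightarrow> (nat \<times> nat) set" where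
  "offdiag n = {(a, b). a < n \<and> b < n \<and> a \<noteq> b}"

definition game_measure :: "nat \<Rightarrow> (nat \<times> nat \<Rightarrow> real) measure" where
  "game_measure n = PiM (offdiag n) (\<lambda>_. uniform_measure lborel {-1<..<(1::real)})"

end

theory Submission
  imports Defs "HOL-Real_Asymp.Real_Asymp"
begin

text \<open>
  Deferred decisions: each stage reads utilities that earlier stages have not touched. An event is
  tracked together with a set of coordinates that determines it, and events with disjoint
  coordinate sets are independent. If for every possible outcome \<open>w\<close> of a stage the event
  ``the outcome is \<open>w\<close>'' is determined by the coordinates read so far, and a failure after \<open>w\<close> depends
  only on other coordinates and has probability at most \<open>e\<close>, then failure has probability at most \<open>e\<close>.

  Stage 1: the clique grown from \<open>R\<close> is determined by pairs touching it, so the remaining set is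
  untouched; a union bound over all candidate sets of size less than \<open>s\<close> shows that with high
  probability fewer than \<open>n\<^sup>3\<^sup>/\<^sup>5\<close> agents of each part are left. Stage 2: by Hoeffding two cliques conflict
  with probability \<open>o(1)\<close>, so a round gets stuck on \<open>\<surd>n\<close> or more cliques per part only with
  negligible probability, and no clique conflicts with more than \<open>n/(100 s)\<close> others. Hence only
  \<open>O(n\<^sup>3\<^sup>/\<^sup>5)\<close> agents are left over, and each has been checked against only a small share of the coalitions.
  Stage 3: the utilities of \<open>x\<close> for its own part contribute at least \<open>-s\<close> to a coalition, and the
  \<open>19 s\<close> unread ones exceed \<open>s\<close> with probability at least of order \<open>n\<^sup>-\<^sup>1\<^sup>/\<^sup>4\<close> (reflect a block of
  \<open>2 s + 2\<close> positive ones about \<open>1/2\<close> and all others about \<open>0\<close>). So every leftover agent accepts more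
  coalitions than there are leftover agents.
\<close>

section \<open>Events determined by a set of coordinates\<close>

text \<open>Individual rationality is a budget: a clique gives each member at least
  \<open>(s - 1) / 2\<close>, each of the other 19 cliques of its coalition costs at most
  \<open>s / 80\<close>, less than \<open>s / 4\<close> in all, and for \<open>s \<ge> 6\<close> at
  least 1 remains, which pays for one extra agent. The obstacle is that all selections are arbitrary
  and reading is adaptive. Stage 1 reads only pairs inside a part and Stage 2 only pairs across
  parts. Selections are neutralised by bounding quantities that they cannot influence: conflicts
  among all cliques, read or not, and the number of coalitions acceptable to each leftover agent.
  The exponents come from \<open>spar\<close>. As 16^(s-1) is at most sqrt n, a fixed set of fewer
  than s agents is extendable by none of m others with probability about exp(-m / sqrt n), and there
  are only exp(O(log^2 n)) such sets, so m = n^(3/5) is enough. As 4^s is of order n^(1/4), a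
  leftover agent accepts at least about n^(3/4) / log n coalitions, far more than n^(3/5). The
  exponent 3/5 is one choice strictly between 1/2 and 3/4.\<close>

lemma finite_offdiag: "finite (offdiag n)"
  by (rule finite_subset[of _ "{..<n} \<times> {..<n}"]) (auto simp: offdiag_def)

abbreviation unif :: "real measure" where
  "unif \<equiv> uniform_measure lborel {-1<..<1}"

lemma prob_space_unif: "prob_space unif"
  by (rule prob_space_uniform_measure) auto

lemma space_unif [simp]: "space unif = UNIV" and sets_unif [simp, measurable_cong]: "sets unif = sets borel"
  by auto

locale random_game =
  fixes n :: nat
begin

abbreviation G :: "(nat \<times> nat \<Rightarrow> real) measure" where
  "G \<equiv> game_measure n"

sublocale coord: finite_product_prob_space "\<lambda>_. unif" "offdiag n"
proof -
  interpret prob_space unif by (rule prob_space_unif)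
  show "finite_product_prob_space (\<lambda>_. unif) (offdiag n)"
    by unfold_locales (rule finite_offdiag)
qed

sublocale prob_space G
  unfolding game_measure_def by (rule coord.prob_space_axioms)

lemma space_G: "space G = extensional (offdiag n)"
  by (auto simp: game_measure_def space_PiM PiE_def)

text \<open>Points of the product space are \<open>undefined\<close> off \<open>offdiag n\<close>,
  so diagonal coordinates carry no information and index sets need not be cut down to
  \<open>offdiag n\<close>.\<close>

lemma space_G_eqI:
  "f \<in> space G \<Longrightarrow> g \<in> space G \<Longrightarrow> j \<notin> offdiag n \<Longrightarrow> f j = g j"
  by (metis space_G extensional_arb)

lemma measurable_coord [measurable]: "(\<lambda>f. f j) \<in> borel_measurable G"
proof (cases "j \<in> offdiag n")
  case True
  then have "(\<lambda>f. f j) \<in> measurable G unif"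
    unfolding game_measure_def by (rule measurable_component_singleton)
  then show ?thesis by (simp add: measurable_def)
next
  case False
  then have "(\<lambda>f. f j) \<in> borel_measurable G \<longleftrightarrow> (\<lambda>f. undefined::real) \<in> borel_measurable G"
    by (intro measurable_cong) (metis space_G extensional_arb)
  then show ?thesis by simp
qed

text \<open>Stands for membership in the sigma-algebra generated by the coordinates in
  \<open>J\<close>. Measurability plus invariance is preferred as an encoding because both
  conditions pass through finite Boolean combinations pointwise; \<open>ev_factor\<close> recovers
  the generated sigma-algebra.\<close>

definition ev :: "(nat \<times> nat) set \<Rightarrow> ((nat \<times> nat \<Rightarrow> real) \<Rightarrow> bool) \<Rightarrow> bool" where
  "ev J Q \<longleftrightarrow> {f \<in> space G. Q f} \<in> events \<and>
     (\<forall>f\<in>space G. \<forall>g\<in>space G. (\<forall>j\<in>J. f j = g j) \<longrightarrow> Q f = Q g)"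

lemma ev_sets: "ev J Q \<Longrightarrow> {f \<in> space G. Q f} \<in> events"
  by (simp add: ev_def)

lemma ev_mono: "ev J Q \<Longrightarrow> J \<subseteq> K \<Longrightarrow> ev K Q"
  unfolding ev_def by blast

lemma ev_cong: "ev J Q \<Longrightarrow> (\<And>f. P f \<longleftrightarrow> Q f) \<Longrightarrow> ev J P"
  using ext[of P Q] by blast

lemma ev_const [simp, intro]: "ev J (\<lambda>f. c)"
  by (cases c) (auto simp: ev_def)

lemma ev_not: "ev J Q \<Longrightarrow> ev J (\<lambda>f. \<not> Q f)"
  unfolding ev_def by (blast intro: sets.sets_Collect_neg)

lemma ev_conj: "ev J P \<Longrightarrow> ev J Q \<Longrightarrow> ev J (\<lambda>f. P f \<and> Q f)"
  unfolding ev_def by (blast intro: sets.sets_Collect_conj)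

lemma ev_disj: "ev J P \<Longrightarrow> ev J Q \<Longrightarrow> ev J (\<lambda>f. P f \<or> Q f)"
  unfolding ev_def by (blast intro: sets.sets_Collect_disj)

lemma ev_ball:
  assumes "finite T" "\<And>t. t \<in> T \<Longrightarrow> ev J (Q t)"
  shows "ev J (\<lambda>f. \<forall>t\<in>T. Q t f)"
  using assms by (induction T) (auto intro: ev_conj)

lemma ev_bex:
  assumes "finite T" "\<And>t. t \<in> T \<Longrightarrow> ev J (Q t)"
  shows "ev J (\<lambda>f. \<exists>t\<in>T. Q t f)"
  using assms by (induction T) (auto intro: ev_disj)

lemma ev_conj_const: "(c \<Longrightarrow> ev J Q) \<Longrightarrow> ev J (\<lambda>f. c \<and> Q f)"
  by (cases c) auto

lemma ev_iff_const: "ev J Q \<Longrightarrow> ev J (\<lambda>f. c \<longleftrightarrow> Q f)"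
  by (cases c) (auto intro: ev_not)

text \<open>Only finitely many truth sets \<open>S\<close> are possible, and that a given
  \<open>S\<close> is the truth set is a finite conjunction, so a condition on the count is a finite
  disjunction of events.\<close>

lemma ev_card:
  assumes "finite T" "\<And>t. t \<in> T \<Longrightarrow> ev J (Q t)"
  shows "ev J (\<lambda>f. R (card {t\<in>T. Q t f}))"
proof -
  have "ev J (\<lambda>f. \<exists>S\<in>Pow T. R (card S) \<and> (\<forall>t\<in>T. t \<in> S \<longleftrightarrow> Q t f))"
    using assms by (intro ev_bex ev_conj_const ev_ball ev_iff_const) auto
  moreover have "(\<exists>S\<in>Pow T. R (card S) \<and> (\<forall>t\<in>T. t \<in> S \<longleftrightarrow> Q t f)) \<longleftrightarrow> R (card {t\<in>T. Q t f})" for f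
  proof
    assume "\<exists>S\<in>Pow T. R (card S) \<and> (\<forall>t\<in>T. t \<in> S \<longleftrightarrow> Q t f)"
    then obtain S where S: "S \<subseteq> T" "R (card S)" "\<forall>t\<in>T. t \<in> S \<longleftrightarrow> Q t f" by auto
    then have "S = {t\<in>T. Q t f}" by blast
    with S show "R (card {t\<in>T. Q t f})" by simp
  qed auto
  ultimately show ?thesis by simp
qed

lemma ev_real:
  assumes "h \<in> borel_measurable G" "A \<in> sets borel"
    and "\<And>f g. (\<forall>j\<in>J. f j = g j) \<Longrightarrow> h f = (h g :: real)"
  shows "ev J (\<lambda>f. h f \<in> A)"
  unfolding ev_def
proof (intro conjI ballI impI)
  have "h -` A \<inter> space G \<in> events"
    using assms(1,2) by (rule measurable_sets)
  also have "h -` A \<inter> space G = {f \<in> space G. h f \<in> A}" by auto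
  finally show "{f \<in> space G. h f \<in> A} \<in> events" .
next
  fix f g :: "nat \<times> nat \<Rightarrow> real" assume "\<forall>j\<in>J. f j = g j"
  then have "h f = h g" by (rule assms(3))
  then show "h f \<in> A \<longleftrightarrow> h g \<in> A" by simp
qed

lemma ev_coord: "A \<in> sets borel \<Longrightarrow> j \<in> J \<Longrightarrow> ev J (\<lambda>f. f j \<in> A)"
  by (rule ev_real) auto

lemma ev_sum: "A \<in> sets borel \<Longrightarrow> T \<subseteq> J \<Longrightarrow> ev J (\<lambda>f. (\<Sum>j\<in>T. f j) \<in> A)"
  by (rule ev_real) (auto intro!: sum.cong)

lemma ev_uset: "A \<in> sets borel \<Longrightarrow> {a} \<times> (C - {a}) \<subseteq> J \<Longrightarrow> ev J (\<lambda>f. uset (curry f) a C \<in> A)"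
  unfolding uset_def by (rule ev_real) (auto intro!: sum.cong)

lemma ev_uset_ge: "{a} \<times> (C - {a}) \<subseteq> J \<Longrightarrow> ev J (\<lambda>f. c \<le> uset (curry f) a C)"
  using ev_uset[of "{c..}"] by simp

lemma ev_uset_gt: "{a} \<times> (C - {a}) \<subseteq> J \<Longrightarrow> ev J (\<lambda>f. c < uset (curry f) a C)"
  using ev_uset[of "{c<..}"] by simp

text \<open>The joint law of the coordinates is \<open>G\<close> itself, hence the product of its
  marginals. The final passage from \<open>unif\<close> to \<open>borel\<close> changes only the
  target measure, not its measurable sets.\<close>

lemma indep_coords: "indep_vars (\<lambda>_. borel) (\<lambda>j f. f j) (offdiag n)"
proof -
  have "indep_vars (\<lambda>_. unif) (\<lambda>j f. f j) (offdiag n)"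
  proof (cases "offdiag n = {}")
    case True
    then show ?thesis by (simp add: indep_vars_def indep_sets_def)
  next
    case False
    show ?thesis
    proof (subst indep_vars_iff_distr_eq_PiM'[OF False])
      show "(\<lambda>f. f j) \<in> measurable G unif" if "j \<in> offdiag n" for j
        unfolding game_measure_def using that by (rule measurable_component_singleton)
      have "distr G (PiM (offdiag n) (\<lambda>_. unif)) (\<lambda>f. \<lambda>j\<in>offdiag n. f j) = distr G G (\<lambda>f. f)"
        by (intro distr_cong) (auto simp: game_measure_def space_PiM PiE_def extensional_restrict)
      also have "\<dots> = PiM (offdiag n) (\<lambda>_. unif)"
        by (simp add: game_measure_def distr_id2)
      also have "\<dots> = PiM (offdiag n) (\<lambda>j. distr G unif (\<lambda>f. f j))"
      proof (intro PiM_cong)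
        fix j assume j: "j \<in> offdiag n"
        show "unif = distr G unif (\<lambda>f. f j)"
          unfolding game_measure_def by (rule coord.PiM_component[symmetric, OF j])
      qed simp
      finally show "distr G (PiM (offdiag n) (\<lambda>_. unif)) (\<lambda>f. \<lambda>j\<in>offdiag n. f j)
          = PiM (offdiag n) (\<lambda>j. distr G unif (\<lambda>f. f j))" .
    qed
  qed
  then show ?thesis
    unfolding indep_vars_def by (simp add: measurable_def)
qed

lemma prob_coord:
  assumes j: "j \<in> offdiag n" and A: "A \<in> sets borel"
  shows "\<P>(f in G. f j \<in> A) = measure unif A"
proof -
  have "measure unif A = measure (distr G unif (\<lambda>f. f j)) A"
    unfolding game_measure_def by (subst coord.PiM_component[OF j]) simp
  also have "\<dots> = prob ((\<lambda>f. f j) -` A \<inter> space G)"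
    using A j by (intro measure_distr) (auto simp: game_measure_def)
  also have "(\<lambda>f. f j) -` A \<inter> space G = {f \<in> space G. f j \<in> A}" by auto
  finally show ?thesis by simp
qed

text \<open>A Doob-Dynkin argument: filling the coordinates outside \<open>J\<close> with 0 is a
  measurable map \<open>h\<close>, and \<open>Q\<close> cannot tell \<open>f\<close> from its
  filled-in version, so the preimage of the event under \<open>h\<close> serves as
  \<open>A\<close>.\<close>

lemma ev_factor:
  assumes "ev J Q"
  obtains A where "A \<in> sets (PiM (J \<inter> offdiag n) (\<lambda>_. borel))"
    "{f \<in> space G. Q f} = (\<lambda>f. restrict f (J \<inter> offdiag n)) -` A \<inter> space G"
proof -
  let ?J = "J \<inter> offdiag n"
  define h where "h g = (\<lambda>j\<in>offdiag n. if j \<in> J then g j else 0::real)" for g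
  have h: "h \<in> measurable (PiM ?J (\<lambda>_. borel)) G"
    unfolding h_def game_measure_def
  proof (rule measurable_restrict)
    fix i assume "i \<in> offdiag n"
    then have "(\<lambda>x. if i \<in> J then x i else 0) \<in> measurable (PiM ?J (\<lambda>_. borel)) (borel :: real measure)"
      by (cases "i \<in> J") auto
    then show "(\<lambda>x. if i \<in> J then x i else 0) \<in> measurable (PiM ?J (\<lambda>_. borel)) unif"
      by (simp add: measurable_def)
  qed
  define A where "A = h -` {f \<in> space G. Q f} \<inter> space (PiM ?J (\<lambda>_. borel))"
  have "A \<in> sets (PiM ?J (\<lambda>_. borel))"
    unfolding A_def using h ev_sets[OF assms] by (rule measurable_sets)
  moreover have "Q f \<longleftrightarrow> restrict f ?J \<in> A" if f: "f \<in> space G" for f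
  proof -
    have "h (restrict f ?J) \<in> space G"
      by (auto simp: h_def space_G)
    moreover have "\<forall>j\<in>J. f j = h (restrict f ?J) j"
    proof
      fix j assume "j \<in> J"
      then show "f j = h (restrict f ?J) j"
        using space_G_eqI[OF f \<open>h (restrict f ?J) \<in> space G\<close>]
        by (cases "j \<in> offdiag n") (auto simp: h_def)
    qed
    ultimately have "Q f \<longleftrightarrow> Q (h (restrict f ?J))"
      using assms f unfolding ev_def by blast
    then show ?thesis
      using \<open>h (restrict f ?J) \<in> space G\<close> by (auto simp: A_def space_PiM)
  qed
  then have "{f \<in> space G. Q f} = (\<lambda>f. restrict f ?J) -` A \<inter> space G"
    by auto
  ultimately show thesis by (rule that)
qed

text \<open>Restrictions of an independent family to disjoint index sets are independent, and
  \<open>ev_factor\<close> expresses both events through these restrictions.\<close>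

lemma prob_indep:
  assumes "ev J P" "ev K Q" "J \<inter> K = {}"
  shows "\<P>(f in G. P f \<and> Q f) = \<P>(f in G. P f) * \<P>(f in G. Q f)"
proof -
  let ?J = "J \<inter> offdiag n" and ?K = "K \<inter> offdiag n"
  obtain A where A: "A \<in> sets (PiM ?J (\<lambda>_. borel))"
    "{f \<in> space G. P f} = (\<lambda>f. restrict f ?J) -` A \<inter> space G"
    using ev_factor[OF assms(1)] .
  obtain B where B: "B \<in> sets (PiM ?K (\<lambda>_. borel))"
    "{f \<in> space G. Q f} = (\<lambda>f. restrict f ?K) -` B \<inter> space G"
    using ev_factor[OF assms(2)] .
  have "indep_var (PiM ?J (\<lambda>_. borel)) (\<lambda>f. restrict (\<lambda>j. f j) ?J)
                  (PiM ?K (\<lambda>_. borel)) (\<lambda>f. restrict (\<lambda>j. f j) ?K)"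
    using assms(3) by (intro indep_var_restrict[OF indep_coords]) auto
  from indep_varD[OF this A(1) B(1)]
  have "prob ((\<lambda>f. (restrict f ?J, restrict f ?K)) -` (A \<times> B) \<inter> space G)
    = \<P>(f in G. P f) * \<P>(f in G. Q f)"
    by (simp add: A(2) B(2))
  also have "(\<lambda>f. (restrict f ?J, restrict f ?K)) -` (A \<times> B) \<inter> space G
    = {f \<in> space G. P f} \<inter> {f \<in> space G. Q f}"
    unfolding A(2) B(2) by auto
  also have "\<dots> = {f \<in> space G. P f \<and> Q f}" by auto
  finally show ?thesis .
qed

lemma prob_ball_indep:
  assumes "finite T" "\<And>t. t \<in> T \<Longrightarrow> ev (J t) (Q t)" "disjoint_family_on J T"
  shows "\<P>(f in G. \<forall>t\<in>T. Q t f) = (\<Prod>t\<in>T. \<P>(f in G. Q t f))"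
  using assms
proof (induction T)
  case empty
  then show ?case by (simp add: prob_space)
next
  case (insert x T)
  have "ev (\<Union>t\<in>T. J t) (\<lambda>f. \<forall>t\<in>T. Q t f)"
    using insert by (intro ev_ball) (auto intro: ev_mono)
  moreover have "J x \<inter> (\<Union>t\<in>T. J t) = {}"
    using insert by (auto simp: disjoint_family_on_def)
  ultimately have "\<P>(f in G. Q x f \<and> (\<forall>t\<in>T. Q t f))
    = \<P>(f in G. Q x f) * \<P>(f in G. \<forall>t\<in>T. Q t f)"
    using insert by (intro prob_indep) auto
  then show ?case
    using insert by (auto simp: disjoint_family_on_def)
qed

lemma prob_mono_ev:
  assumes "ev K Q" "\<And>f. f \<in> space G \<Longrightarrow> P f \<Longrightarrow> Q f"
  shows "\<P>(f in G. P f) \<le> \<P>(f in G. Q f)"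
  using assms by (intro finite_measure_mono) (auto dest: ev_sets)

lemma prob_bex_le:
  assumes "finite T" "\<And>t. t \<in> T \<Longrightarrow> ev J (Q t)"
  shows "\<P>(f in G. \<exists>t\<in>T. Q t f) \<le> (\<Sum>t\<in>T. \<P>(f in G. Q t f))"
proof -
  have "{f \<in> space G. \<exists>t\<in>T. Q t f} = (\<Union>t\<in>T. {f \<in> space G. Q t f})" by auto
  then show ?thesis
    using assms by (auto intro!: finite_measure_subadditive_finite ev_sets)
qed

lemma prob_bex_le_card:
  fixes e :: real
  assumes "finite T" "\<And>t. t \<in> T \<Longrightarrow> ev J (Q t)" "\<And>t. t \<in> T \<Longrightarrow> \<P>(f in G. Q t f) \<le> e"
  shows "\<P>(f in G. \<exists>t\<in>T. Q t f) \<le> card T * e"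
  using prob_bex_le[OF assms(1,2)] sum_bounded_above[of T "\<lambda>t. \<P>(f in G. Q t f)" e] assms(3)
  by force

lemma prob_disj_le:
  assumes "ev J P" "ev K Q"
  shows "\<P>(f in G. P f \<or> Q f) \<le> \<P>(f in G. P f) + \<P>(f in G. Q f)"
proof -
  have "{f \<in> space G. P f \<or> Q f} = {f \<in> space G. P f} \<union> {f \<in> space G. Q f}" by auto
  then show ?thesis
    using assms by (auto intro!: measure_Un_le ev_sets)
qed

text \<open>Union bound over the \<open>h\<close>-element subsets of \<open>T\<close>; by
  independence all events of such a subset occur with probability at most
  \<open>p ^ h\<close>.\<close>

lemma prob_card_ge_le:
  fixes p :: real
  assumes "finite T" "\<And>t. t \<in> T \<Longrightarrow> ev (J t) (Q t)" "disjoint_family_on J T"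
    and p: "\<And>t. t \<in> T \<Longrightarrow> \<P>(f in G. Q t f) \<le> p"
  shows "\<P>(f in G. h \<le> card {t\<in>T. Q t f}) \<le> (card T choose h) * p ^ h"
proof -
  let ?S = "{S. S \<subseteq> T \<and> card S = h}"
  have fin: "finite ?S" using assms(1) by auto
  have finS: "finite S" if "S \<in> ?S" for S
    using that assms(1) by (auto intro: finite_subset)
  have ev: "ev (\<Union>t\<in>T. J t) (\<lambda>f. \<forall>t\<in>S. Q t f)" if "S \<in> ?S" for S
    using that finS[OF that] assms(2) by (intro ev_ball) (auto intro: ev_mono)
  have "\<P>(f in G. h \<le> card {t\<in>T. Q t f}) \<le> \<P>(f in G. \<exists>S\<in>?S. \<forall>t\<in>S. Q t f)"
  proof (rule prob_mono_ev)
    show "ev (\<Union>t\<in>T. J t) (\<lambda>f. \<exists>S\<in>?S. \<forall>t\<in>S. Q t f)"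
      using fin ev by (rule ev_bex)
    fix f assume "h \<le> card {t\<in>T. Q t f}"
    then obtain S where "S \<subseteq> {t\<in>T. Q t f}" "card S = h"
      using obtain_subset_with_card_n by metis
    then show "\<exists>S\<in>?S. \<forall>t\<in>S. Q t f" by auto
  qed
  also have "\<dots> \<le> card ?S * p ^ h"
  proof (rule prob_bex_le_card)
    show "finite ?S" by (rule fin)
    show "ev (\<Union>t\<in>T. J t) (\<lambda>f. \<forall>t\<in>S. Q t f)" if "S \<in> ?S" for S
      using that by (rule ev)
    fix S assume S: "S \<in> ?S"
    then have "\<P>(f in G. \<forall>t\<in>S. Q t f) = (\<Prod>t\<in>S. \<P>(f in G. Q t f))"
      using finS[OF S] assms(2,3)
      by (intro prob_ball_indep[of _ J]) (auto simp: disjoint_family_on_def)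
    also have "\<dots> \<le> (\<Prod>t\<in>S. p)"
      using S by (intro prod_mono) (auto intro!: p)
    finally show "\<P>(f in G. \<forall>t\<in>S. Q t f) \<le> p ^ h"
      using S by auto
  qed
  also have "card ?S = card T choose h"
    using assms(1) by (rule n_subsets)
  finally show ?thesis by simp
qed

text \<open>The principle of deferred decisions in the form used by every stage. The outcomes
  \<open>w\<close> exclude each other by \<open>unique\<close>, so their probabilities add up to at
  most 1, and independence gives each the factor \<open>e\<close>. Both \<open>J w\<close> and
  \<open>K w\<close> may vary with \<open>w\<close>, which is what adaptive reading
  requires.\<close>

lemma prob_revealed_le:
  assumes "finite W" "\<And>w. w \<in> W \<Longrightarrow> ev (J w) (X w)" "\<And>w. w \<in> W \<Longrightarrow> ev (K w) (B w)"
    and "\<And>w. w \<in> W \<Longrightarrow> J w \<inter> K w = {}" "\<And>w. w \<in> W \<Longrightarrow> \<P>(f in G. B w f) \<le> e"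
    and unique: "\<And>f w w'. w \<in> W \<Longrightarrow> w' \<in> W \<Longrightarrow> X w f \<Longrightarrow> X w' f \<Longrightarrow> w = w'"
    and "0 \<le> e"
  shows "\<P>(f in G. \<exists>w\<in>W. X w f \<and> B w f) \<le> e"
proof -
  have ev: "ev UNIV (X w)" "ev UNIV (B w)" if "w \<in> W" for w
    using assms(2,3)[OF that] by (auto intro: ev_mono)
  have "\<P>(f in G. \<exists>w\<in>W. X w f \<and> B w f) \<le> (\<Sum>w\<in>W. \<P>(f in G. X w f \<and> B w f))"
    using assms(1) by (rule prob_bex_le) (auto intro: ev_conj ev)
  also have "\<dots> = (\<Sum>w\<in>W. \<P>(f in G. X w f) * \<P>(f in G. B w f))"
    using assms(2-4) by (intro sum.cong prob_indep) auto
  also have "\<dots> \<le> (\<Sum>w\<in>W. \<P>(f in G. X w f) * e)"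
    using assms(5) by (intro sum_mono mult_left_mono) auto
  also have "\<dots> = (\<Sum>w\<in>W. \<P>(f in G. X w f)) * e"
    by (simp add: sum_distrib_right)
  also have "(\<Sum>w\<in>W. \<P>(f in G. X w f)) = prob (\<Union>w\<in>W. {f \<in> space G. X w f})"
    using assms(1) unique ev
    by (intro finite_measure_finite_Union[symmetric])
       (auto simp: disjoint_family_on_def intro!: ev_sets)
  also have "\<dots> * e \<le> 1 * e"
    using \<open>0 \<le> e\<close> by (intro mult_right_mono prob_le_1)
  finally show ?thesis by simp
qed

end

section \<open>Sums of independent uniform utilities\<close>

lemma measure_unif_Ioo:
  assumes "-1 \<le> a" "a \<le> b" "b \<le> 1"
  shows "measure unif {a<..<b} = (b - a) / 2"
proof -
  have "{-1<..<1} \<inter> {a<..<b} = {a<..<b}" using assms by auto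
  then show ?thesis using assms by (subst measure_uniform_measure) auto
qed

lemma measure_unif_ge_half: "measure unif {1/2..} = 1 / 4"
proof -
  have "{-1<..<1} \<inter> {1/2..} = {1/2..<1::real}" by auto
  then show ?thesis by (subst measure_uniform_measure) auto
qed

text \<open>The map is negation followed by translation by \<open>c\<close>, and Lebesgue measure is
  invariant under both.\<close>

lemma emeasure_lborel_reflect:
  assumes "A \<in> sets borel"
  shows "emeasure lborel ((\<lambda>x. c - x) -` A) = emeasure lborel (A :: real set)"
proof -
  have "lborel = distr (distr lborel borel uminus) borel ((+) c)"
    by (simp add: lborel_distr_uminus lborel_distr_plus)
  also have "\<dots> = distr lborel borel (\<lambda>x. c - x)"
    by (subst distr_distr) (auto simp: comp_def)
  finally have "emeasure lborel A = emeasure (distr lborel borel (\<lambda>x. c - x)) A" by simp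
  also have "\<dots> = emeasure lborel ((\<lambda>x. c - x) -` A)"
    using assms by (subst emeasure_distr) auto
  finally show ?thesis by simp
qed

text \<open>The reflection of an open interval at its midpoint, extended by the identity. It is
  applied to \<open>(0, 1)\<close> and to \<open>(-1, 1)\<close>.\<close>

definition reflect :: "real \<Rightarrow> real \<Rightarrow> real \<Rightarrow> real" where
  "reflect a b x = (if a < x \<and> x < b then a + b - x else x)"

lemma measurable_reflect [measurable]: "reflect a b \<in> borel_measurable borel"
  unfolding reflect_def by measurable

text \<open>The interval lies in the support, where the density is constant; so the part of
  \<open>A\<close> inside it is moved without changing its mass, and the part outside is
  fixed.\<close>

lemma distr_unif_reflect:
  assumes "-1 \<le> a" "b \<le> 1"
  shows "distr unif borel (reflect a b) = unif"
proof (rule measure_eqI)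
  fix A assume "A \<in> sets (distr unif borel (reflect a b))"
  then have A: "A \<in> sets borel" by simp
  let ?I = "{a<..<b}" and ?U = "{-1<..<1::real}"
  have r: "reflect a b -` A \<in> sets borel"
    using measurable_sets[OF measurable_reflect A] by simp
  have "?U \<inter> reflect a b -` A = ((\<lambda>x. (a + b) - x) -` (A \<inter> ?I)) \<union> (?U \<inter> A - ?I)"
    using assms by (auto simp: reflect_def split: if_splits)
  moreover have "(\<lambda>x. (a + b) - x) -` (A \<inter> ?I) \<in> sets borel"
    using measurable_sets[of "\<lambda>x. (a + b) - x" borel borel "A \<inter> ?I"] A by simp
  moreover have "((\<lambda>x. (a + b) - x) -` (A \<inter> ?I)) \<inter> (?U \<inter> A - ?I) = {}" by auto
  ultimately have "emeasure lborel (?U \<inter> reflect a b -` A)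
    = emeasure lborel ((\<lambda>x. (a + b) - x) -` (A \<inter> ?I)) + emeasure lborel (?U \<inter> A - ?I)"
    using A by (simp add: plus_emeasure)
  also have "\<dots> = emeasure lborel (A \<inter> ?I) + emeasure lborel (?U \<inter> A - ?I)"
    using A by (subst emeasure_lborel_reflect) auto
  also have "\<dots> = emeasure lborel ((A \<inter> ?I) \<union> (?U \<inter> A - ?I))"
    using A by (intro plus_emeasure) auto
  also have "(A \<inter> ?I) \<union> (?U \<inter> A - ?I) = ?U \<inter> A" using assms by auto
  finally have "emeasure unif (reflect a b -` A) = emeasure unif A"
    using A r by simp
  then show "emeasure (distr unif borel (reflect a b)) A = emeasure unif A"
    using A by (subst emeasure_distr) auto
qed simp

context random_game
begin

lemma prob_ge_half: "j \<in> offdiag n \<Longrightarrow> \<P>(f in G. 1/2 \<le> f j) = 1/4"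
  using prob_coord[of j "{1/2..}"] measure_unif_ge_half by simp

lemma prob_Ioo:
  "j \<in> offdiag n \<Longrightarrow> -1 \<le> a \<Longrightarrow> a \<le> b \<Longrightarrow> b \<le> 1 \<Longrightarrow> \<P>(f in G. f j \<in> {a<..<b}) = (b - a) / 2"
  using prob_coord[of j "{a<..<b}"] measure_unif_Ioo by simp

text \<open>The closed interval is the form in which Hoeffding's inequality and the worst case -1 of
  Stage 3 use it. Points of \<open>space G\<close> have arbitrary real coordinates, so the bound can
  only hold almost everywhere.\<close>

lemma AE_coord: "AE f in G. \<forall>j\<in>offdiag n. f j \<in> {-1..1}"
proof -
  have "AE f in G. f j \<in> {-1..1}" if "j \<in> offdiag n" for j
  proof -
    have "AE f in G. f j \<in> {-1<..<1}"
      using prob_Ioo[OF that, of "-1" 1] by (subst prob_Collect_eq_1[symmetric]) auto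
    then show ?thesis by (rule AE_mp) auto
  qed
  then show ?thesis by (simp add: AE_finite_all finite_offdiag)
qed

text \<open>It suffices to compare the two measures on rectangles, where the image measure factors
  into one-dimensional image measures.\<close>

lemma distr_G_coordwise:
  assumes T: "\<And>j. T j \<in> borel_measurable borel" "\<And>j. distr unif borel (T j) = unif"
  shows "distr G G (\<lambda>f. \<lambda>j\<in>offdiag n. T j (f j)) = G"
proof -
  have m: "(\<lambda>f. \<lambda>j\<in>offdiag n. T j (f j)) \<in> measurable G G"
  proof -
    have "(\<lambda>f. T j (f j)) \<in> measurable G unif" for j
    proof -
      have "(\<lambda>f. T j (f j)) \<in> borel_measurable G"
        using T(1) by measurable
      then show ?thesis by (simp add: measurable_def)
    qed
    then show ?thesis
      by (subst (2) game_measure_def) (rule measurable_restrict)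
  qed
  have "distr G G (\<lambda>f. \<lambda>j\<in>offdiag n. T j (f j)) = PiM (offdiag n) (\<lambda>_. unif)"
  proof (rule coord.PiM_eqI)
    fix A assume A: "\<And>j. j \<in> offdiag n \<Longrightarrow> A j \<in> sets unif"
    have Tm: "T j -` A j \<in> sets borel" if "j \<in> offdiag n" for j
      using measurable_sets[OF T(1), of "A j" j] A[OF that] by simp
    have "emeasure (distr G G (\<lambda>f. \<lambda>j\<in>offdiag n. T j (f j))) (Pi\<^sub>E (offdiag n) A)
      = emeasure G ((\<lambda>f. \<lambda>j\<in>offdiag n. T j (f j)) -` Pi\<^sub>E (offdiag n) A \<inter> space G)"
    proof (rule emeasure_distr[OF m])
      show "Pi\<^sub>E (offdiag n) A \<in> events"
        unfolding game_measure_def by (rule sets_PiM_I_finite[OF finite_offdiag A])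
    qed
    also have "(\<lambda>f. \<lambda>j\<in>offdiag n. T j (f j)) -` Pi\<^sub>E (offdiag n) A \<inter> space G
      = Pi\<^sub>E (offdiag n) (\<lambda>j. T j -` A j)"
      by (auto simp: space_G PiE_def Pi_iff)
    also have "emeasure G \<dots> = (\<Prod>j\<in>offdiag n. emeasure unif (T j -` A j))"
      unfolding game_measure_def using Tm
      by (intro coord.emeasure_PiM finite_offdiag) auto
    also have "\<dots> = (\<Prod>j\<in>offdiag n. emeasure (distr unif borel (T j)) (A j))"
    proof (intro prod.cong refl)
      fix j assume "j \<in> offdiag n"
      then have "A j \<in> sets borel" using A by simp
      moreover have "T j \<in> measurable unif borel" using T(1) by (simp add: measurable_def)
      ultimately show "emeasure unif (T j -` A j) = emeasure (distr unif borel (T j)) (A j)"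
        by (simp only: emeasure_distr space_unif Int_UNIV_right)
    qed
    also have "\<dots> = (\<Prod>j\<in>offdiag n. emeasure unif (A j))"
      by (simp add: T(2))
    finally show "emeasure (distr G G (\<lambda>f. \<lambda>j\<in>offdiag n. T j (f j))) (Pi\<^sub>E (offdiag n) A)
      = (\<Prod>j\<in>offdiag n. emeasure unif (A j))" .
  qed (auto simp: finite_offdiag game_measure_def)
  then show ?thesis by (simp add: game_measure_def)
qed

text \<open>If all coordinates in \<open>J\<close> are positive (the event \<open>E\<close>, of
  probability \<open>(1/2) ^ card J\<close>), then \<open>f j + h f j\<close> is 1 on
  \<open>J\<close> and 0 on \<open>K\<close>, so the sum for \<open>f\<close> or the sum for
  \<open>h f\<close> reaches \<open>card J / 2\<close>. Both sums have the same law, which costs the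
  final factor 2. No estimate of the spread over \<open>K\<close> is needed.\<close>

lemma prob_sum_ge:
  assumes J: "J \<subseteq> offdiag n" "K \<subseteq> offdiag n" "J \<inter> K = {}"
  shows "(1/2) ^ card J / 2 \<le> \<P>(f in G. card J / 2 \<le> (\<Sum>j\<in>J \<union> K. f j))"
proof -
  have fin: "finite J" "finite K" using J finite_offdiag finite_subset by blast+
  define S where "S j = (if j \<in> J then {0<..<1} else {-1<..<1::real})" for j
  define T where "T j = (if j \<in> J then reflect 0 1 else reflect (-1) 1)" for j
  define h where "h f = (\<lambda>j\<in>offdiag n. T j (f j))" for f :: "nat \<times> nat \<Rightarrow> real"
  define E where "E f \<longleftrightarrow> (\<forall>j\<in>J \<union> K. f j \<in> S j)" for f :: "nat \<times> nat \<Rightarrow> real"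
  define A where "A f \<longleftrightarrow> card J / 2 \<le> (\<Sum>j\<in>J \<union> K. f j)" for f :: "nat \<times> nat \<Rightarrow> real"
  have dist: "distr G G h = G"
    unfolding h_def T_def by (rule distr_G_coordwise) (auto intro!: distr_unif_reflect)
  have evA: "ev UNIV A"
    unfolding A_def using ev_sum[of "{card J / 2..}"] by simp
  have evE: "ev UNIV E"
    unfolding E_def using fin by (intro ev_ball ev_coord) (auto simp: S_def)
  have hm: "h \<in> measurable G G"
  proof -
    have "(\<lambda>f. T j (f j)) \<in> measurable G unif" for j
    proof -
      have "(\<lambda>f. T j (f j)) \<in> borel_measurable G"
        unfolding T_def by (cases "j \<in> J") (auto intro: measurable_compose[OF _ measurable_reflect])
      then show ?thesis by (simp add: measurable_def)
    qed
    then show ?thesis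
      unfolding h_def by (subst (2) game_measure_def) (rule measurable_restrict)
  qed
  have Ah: "\<P>(f in G. A (h f)) = \<P>(f in G. A f)"
  proof -
    have "\<P>(f in G. A f) = measure (distr G G h) {f \<in> space G. A f}"
      by (simp add: dist)
    also have "\<dots> = prob (h -` {f \<in> space G. A f} \<inter> space G)"
      using hm ev_sets[OF evA] by (rule measure_distr)
    also have "h -` {f \<in> space G. A f} \<inter> space G = {f \<in> space G. A (h f)}"
      using measurable_space[OF hm] by auto
    finally show ?thesis by simp
  qed
  have evAh: "ev UNIV (\<lambda>f. A (h f))"
    unfolding ev_def
  proof (intro conjI ballI impI)
    have "h -` {f \<in> space G. A f} \<inter> space G \<in> events"
      using hm ev_sets[OF evA] by (rule measurable_sets)
    also have "h -` {f \<in> space G. A f} \<inter> space G = {f \<in> space G. A (h f)}"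
      using measurable_space[OF hm] by auto
    finally show "{f \<in> space G. A (h f)} \<in> events" .
  next
    fix f g :: "nat \<times> nat \<Rightarrow> real" assume "\<forall>j\<in>UNIV. f j = g j"
    then have "f = g" by auto
    then show "A (h f) \<longleftrightarrow> A (h g)" by simp
  qed
  have "(1/2) ^ card J = (\<Prod>j\<in>J. 1/2) * (\<Prod>j\<in>K. 1::real)"
    by simp
  also have "\<dots> = (\<Prod>j\<in>J \<union> K. \<P>(f in G. f j \<in> S j))"
  proof (subst prod.union_disjoint[OF fin J(3)], intro arg_cong2[where f="(*)"] prod.cong refl)
    show "1/2 = \<P>(f in G. f j \<in> S j)" if "j \<in> J" for j
      using that J prob_Ioo[of j 0 1] by (auto simp: S_def)
    show "1 = \<P>(f in G. f j \<in> S j)" if "j \<in> K" for j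
    proof -
      have "j \<notin> J" "j \<in> offdiag n" using that J by auto
      then show ?thesis using prob_Ioo[of j "-1" 1] by (auto simp: S_def)
    qed
  qed
  also have "\<dots> = \<P>(f in G. E f)"
    unfolding E_def using fin
    by (intro prob_ball_indep[symmetric, of _ "\<lambda>j. {j}"])
       (auto intro!: ev_coord simp: S_def disjoint_family_on_def simp del: greaterThanLessThan_iff)
  also have "\<dots> \<le> \<P>(f in G. A f \<or> A (h f))"
  proof (rule prob_mono_ev)
    show "ev UNIV (\<lambda>f. A f \<or> A (h f))" by (intro ev_disj evA evAh)
    fix f assume E: "E f"
    have "(\<Sum>j\<in>J \<union> K. f j) + (\<Sum>j\<in>J \<union> K. h f j) = (\<Sum>j\<in>J \<union> K. f j + h f j)"
      by (simp add: sum.distrib)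
    also have "\<dots> = (\<Sum>j\<in>J \<union> K. if j \<in> J then 1 else 0)"
    proof (rule sum.cong)
      fix j assume j: "j \<in> J \<union> K"
      then have "j \<in> offdiag n" "f j \<in> S j" using J E by (auto simp: E_def)
      then show "f j + h f j = (if j \<in> J then 1 else 0)"
        by (cases "j \<in> J") (auto simp: h_def T_def S_def reflect_def)
    qed simp
    also have "\<dots> = card J"
      using fin by (simp add: sum.If_cases Int_absorb1)
    finally show "A f \<or> A (h f)" by (auto simp: A_def)
  qed
  also have "\<dots> \<le> \<P>(f in G. A f) + \<P>(f in G. A (h f))"
    by (rule prob_disj_le[OF evA evAh])
  finally show ?thesis using Ah unfolding A_def by simp
qed

text \<open>By symmetry the mean is its own negative. The measure-preserving map at hand is
  \<open>reflect (-1) 1\<close>, which agrees with negation only almost everywhere.\<close>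

lemma expectation_coord:
  assumes j: "j \<in> offdiag n"
  shows "expectation (\<lambda>f. f j) = 0"
proof -
  have "expectation (\<lambda>f. f j) = integral\<^sup>L (distr G unif (\<lambda>f. f j)) (\<lambda>x. x)"
  proof (rule integral_distr[symmetric])
    show "(\<lambda>f. f j) \<in> measurable G unif"
      using measurable_coord[of j] by (simp add: measurable_def)
    show "(\<lambda>x. x) \<in> borel_measurable unif"
      by (simp add: measurable_def)
  qed
  also have "distr G unif (\<lambda>f. f j) = unif"
    unfolding game_measure_def by (rule coord.PiM_component[OF j])
  finally have *: "expectation (\<lambda>f. f j) = integral\<^sup>L unif (\<lambda>x. x)" .
  have AE: "AE x in unif. x \<in> {-1<..<1}"
    by (rule AE_uniform_measureI) auto
  have "integral\<^sup>L unif (\<lambda>x. x) = integral\<^sup>L (distr unif borel (reflect (-1) 1)) (\<lambda>x. x)"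
    by (simp add: distr_unif_reflect)
  also have "\<dots> = integral\<^sup>L unif (reflect (-1) 1)"
    using measurable_reflect[of "-1" 1] by (subst integral_distr) (simp_all add: measurable_def)
  also have "\<dots> = integral\<^sup>L unif (\<lambda>x. - x)"
  proof (rule integral_cong_AE)
    show "reflect (-1) 1 \<in> borel_measurable unif"
      using measurable_reflect[of "-1" 1] by (simp add: measurable_def)
    have "(uminus :: real \<Rightarrow> real) \<in> borel_measurable borel" by measurable
    then show "(uminus :: real \<Rightarrow> real) \<in> borel_measurable unif" by (simp only: measurable_def sets_unif space_unif space_borel)
    show "AE x in unif. reflect (-1) 1 x = - x"
      using AE by (rule AE_mp) (auto simp: reflect_def)
  qed
  also have "\<dots> = - integral\<^sup>L unif (\<lambda>x. x)" by simp
  finally show ?thesis using * by simp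
qed

text \<open>Hoeffding's inequality with mean 0 and ranges of length 2: the exponent is
  \<open>-2 * e\<^sup>2 / (4 * card J)\<close>.\<close>

lemma prob_sum_le_neg:
  assumes J: "J \<subseteq> offdiag n" "J \<noteq> {}" and e: "0 \<le> e"
  shows "\<P>(f in G. (\<Sum>j\<in>J. f j) \<le> - e) \<le> exp (- e\<^sup>2 / (2 * card J))"
proof -
  have fin: "finite J" using J finite_offdiag finite_subset by blast
  interpret H: Hoeffding_ineq G J "\<lambda>j f. f j" "\<lambda>_. -1" "\<lambda>_. 1" "\<Sum>j\<in>J. expectation (\<lambda>f. f j)"
  proof unfold_locales
    show "indep_vars (\<lambda>_. borel) (\<lambda>j f. f j) J"
      using indep_coords J(1) by (rule indep_vars_subset)
    fix j assume "j \<in> J"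
    then show "AE f in G. f j \<in> {-1..1}" using AE_coord J by auto
  qed (rule fin)
  have "(\<Sum>j\<in>J. expectation (\<lambda>f. f j)) = 0"
    using J expectation_coord by (intro sum.neutral) auto
  then have "\<P>(f in G. (\<Sum>j\<in>J. f j) \<le> - e) \<le> exp (- 2 * e\<^sup>2 / (\<Sum>j\<in>J. (1 - (-1))\<^sup>2))"
    using H.Hoeffding_ineq_le[OF e] J fin by (simp add: card_gt_0_iff)
  then show ?thesis by (simp add: field_simps)
qed

end

section \<open>Stage 1: greedy cliques\<close>

text \<open>One iteration of the loop as an equation. Termination, uniqueness and
  \<open>ev_grow\<close> are proved by induction on the shrinking set \<open>L\<close>, which calls
  for rewriting single iterations rather than for rule induction.\<close>

lemma grow_iff:
  "grow r n u i p R C L Cf \<longleftrightarrow>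
    (if L = {} \<or> spar n \<le> card C then Cf = C
     else let w = selw r n i p R C L in
       grow r n u i p R (if \<forall>z\<in>C. 1/2 \<le> u w z \<and> 1/2 \<le> u z w then insert w C else C) (L - {w}) Cf)"
  by (subst grow.simps) (auto simp: Let_def)

lemma greedy_iff:
  "greedy r n u i p R pf Rf \<longleftrightarrow>
    (if R = {} then pf = p \<and> Rf = {}
     else \<exists>C. grow r n u i p R {selv r n i p R} (R - {selv r n i p R}) C \<and>
       (if card C < spar n then pf = p \<and> Rf = R else greedy r n u i (insert C p) (R - C) pf Rf))"
  by (subst greedy.simps) (auto simp: not_less)

lemma grow_subset: "grow r n u i p R C L Cf \<Longrightarrow> C \<subseteq> Cf"
  by (induction rule: grow.induct) (auto split: if_splits)

definition clique :: "util \<Rightarrow> nat set \<Rightarrow> bool" where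
  "clique u C \<longleftrightarrow> (\<forall>a\<in>C. \<forall>b\<in>C. a \<noteq> b \<longrightarrow> 1/2 \<le> u a b)"

lemma grow_clique: "grow r n u i p R C L Cf \<Longrightarrow> clique u C \<Longrightarrow> clique u Cf"
proof (induction rule: grow.induct)
  case (grow_step L C w C' Cf)
  have "clique u C'"
    unfolding grow_step.hyps(4) using grow_step.prems by (simp add: clique_def)
  then show ?case by (rule grow_step.IH)
qed

lemma grow_card:
  "grow r n u i p R C L Cf \<Longrightarrow> finite C \<Longrightarrow> card C \<le> spar n \<Longrightarrow> finite Cf \<and> card Cf \<le> spar n"
proof (induction rule: grow.induct)
  case (grow_step L C w C' Cf)
  have "finite C'" "card C' \<le> spar n" using grow_step by (auto simp: card_insert_if)
  then show ?case by (rule grow_step.IH)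
qed auto

text \<open>A clique that stays below size \<open>spar n\<close> has tried every candidate. A
  refused \<open>x\<close> failed against the \<open>C\<close> of that moment, and this
  \<open>C\<close> is contained in \<open>Cf\<close>.\<close>

lemma grow_maximal:
  "grow r n u i p R C L Cf \<Longrightarrow> card Cf < spar n \<Longrightarrow> x \<in> L - Cf \<Longrightarrow>
    \<not> (\<forall>z\<in>Cf. 1/2 \<le> u x z \<and> 1/2 \<le> u z x)"
proof (induction rule: grow.induct)
  case (grow_step L C w C' Cf)
  have sub: "C' \<subseteq> Cf" using grow_step.hyps(5) by (rule grow_subset)
  show ?case
  proof (cases "x = w")
    case True
    then have "\<not> (\<forall>z\<in>C. 1/2 \<le> u w z \<and> 1/2 \<le> u z w)"
      using grow_step sub by auto
    moreover have "C \<subseteq> Cf" using sub grow_step.hyps(4) by (auto split: if_splits)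
    ultimately show ?thesis using True by blast
  next
    case False
    then show ?thesis using grow_step by auto
  qed
qed auto

lemma uset_notin: "a \<notin> C \<Longrightarrow> uset u a C = (\<Sum>b\<in>C. u a b)"
  by (simp add: uset_def)

lemma uset_Un:
  assumes "finite C" "finite D" "C \<inter> D = {}"
  shows "uset u a (C \<union> D) = uset u a C + uset u a D"
proof -
  have "(C \<union> D) - {a} = (C - {a}) \<union> (D - {a})" by auto
  then show ?thesis
    unfolding uset_def using assms by (simp add: sum.union_disjoint disjoint_iff)
qed

lemma uset_clique_ge:
  assumes "clique u C" "a \<in> C" "finite C"
  shows "(real (card C) - 1) / 2 \<le> uset u a C"
proof -
  have "(\<Sum>b\<in>C - {a}. 1/2) \<le> (\<Sum>b\<in>C - {a}. u a b)"
    using assms by (intro sum_mono) (auto simp: clique_def)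
  moreover have "card C \<ge> 1" using assms by (auto simp: Suc_le_eq card_gt_0_iff)
  ultimately show ?thesis
    using assms by (simp add: uset_def of_nat_diff)
qed

locale algorithm = random_game +
  fixes r :: sel_rules
  assumes valid: "valid_rules r" and spar_pos: "0 < spar n"
begin

abbreviation s :: nat where
  "s \<equiv> spar n"

lemma Un_part: "(\<Union>i\<in>{1..20}. part r n i) = {0..<n}"
  and disjoint_part: "i \<in> {1..20} \<Longrightarrow> j \<in> {1..20} \<Longrightarrow> i \<noteq> j \<Longrightarrow> part r n i \<inter> part r n j = {}"
  and card_part: "i \<in> {1..20} \<Longrightarrow> card (part r n i) \<in> {n div 20, (n + 19) div 20}"
  and selv_in: "finite R \<Longrightarrow> R \<noteq> {} \<Longrightarrow> selv r n i p R \<in> R"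
  and selw_in: "finite L \<Longrightarrow> L \<noteq> {} \<Longrightarrow> selw r n i p R C L \<in> L"
  and set_ord2: "finite cs \<Longrightarrow> set (ord2 r n k M cs) = cs"
  and selx_in: "finite X \<Longrightarrow> X \<noteq> {} \<Longrightarrow> selx r n F D X \<in> X"
  and selc_in: "finite cs \<Longrightarrow> cs \<noteq> {} \<Longrightarrow> selc r n x F D X cs \<in> cs"
  using valid by (simp_all add: valid_rules_def)

lemma part_subset: "i \<in> {1..20} \<Longrightarrow> part r n i \<subseteq> {0..<n}"
  using Un_part by blast

lemma finite_part: "i \<in> {1..20} \<Longrightarrow> finite (part r n i)"
  using part_subset by (rule finite_subset) auto

lemma part_unique: "i \<in> {1..20} \<Longrightarrow> j \<in> {1..20} \<Longrightarrow> x \<in> part r n i \<Longrightarrow> x \<in> part r n j \<Longrightarrow> i = j"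
  using disjoint_part by blast

lemma grow_total: "finite L \<Longrightarrow> \<exists>Cf. grow r n u i p R C L Cf"
proof (induction L arbitrary: C rule: finite_psubset_induct)
  case (psubset L)
  show ?case
  proof (cases "L = {} \<or> s \<le> card C")
    case True
    then show ?thesis by (subst grow_iff) auto
  next
    case False
    then have "L - {selw r n i p R C L} \<subset> L" using selw_in psubset.hyps by blast
    with False show ?thesis by (subst grow_iff) (auto simp: Let_def intro: psubset.IH)
  qed
qed

lemma grow_unique:
  "finite L \<Longrightarrow> grow r n u i p R C L Cf \<Longrightarrow> grow r n u i p R C L Cf' \<Longrightarrow> Cf = Cf'"
proof (induction L arbitrary: C rule: finite_psubset_induct)
  case (psubset L)
  show ?case
  proof (cases "L = {} \<or> s \<le> card C")
    case True
    then show ?thesis using psubset.prems by (simp add: grow_iff[of r n u i p R C L])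
  next
    case False
    then have "L - {selw r n i p R C L} \<subset> L" using selw_in psubset.hyps by blast
    then show ?thesis
      using psubset.prems psubset.IH False by (simp add: grow_iff[of r n u i p R C L] Let_def)
  qed
qed

lemma grow_upper: "finite L \<Longrightarrow> grow r n u i p R C L Cf \<Longrightarrow> Cf \<subseteq> C \<union> L"
proof (induction L arbitrary: C rule: finite_psubset_induct)
  case (psubset L)
  show ?case
  proof (cases "L = {} \<or> s \<le> card C")
    case True
    then show ?thesis using psubset.prems by (simp add: grow_iff[of r n u i p R C L])
  next
    case False
    let ?w = "selw r n i p R C L"
    have w: "?w \<in> L" using False selw_in psubset.hyps by blast
    define C' where "C' = (if \<forall>z\<in>C. 1/2 \<le> u ?w z \<and> 1/2 \<le> u z ?w then insert ?w C else C)"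
    have "grow r n u i p R C' (L - {?w}) Cf"
      using psubset.prems False by (simp add: grow_iff[of r n u i p R C L] Let_def C'_def)
    then have "Cf \<subseteq> C' \<union> (L - {?w})" using psubset.IH[of "L - {?w}" C'] w by blast
    also have "\<dots> \<subseteq> C \<union> L" using w by (auto simp: C'_def split: if_splits)
    finally show ?thesis .
  qed
qed

text \<open>Every test compares a candidate with members of the current \<open>C\<close>. If
  \<open>C\<close> is not contained in \<open>Cf\<close>, the outcome \<open>Cf\<close> is
  impossible; otherwise the tests all touch \<open>Cf\<close>. The pairs within
  \<open>V - Cf\<close> thus remain unread, so the next clique meets a fresh game.\<close>

lemma ev_grow:
  "finite L \<Longrightarrow> finite V \<Longrightarrow> C \<union> L \<subseteq> V \<Longrightarrow>
    ev (Cf \<times> V \<union> V \<times> Cf) (\<lambda>f. grow r n (curry f) i p R C L Cf)"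
proof (induction L arbitrary: C rule: finite_psubset_induct)
  case (psubset L)
  let ?J = "Cf \<times> V \<union> V \<times> Cf"
  show ?case
  proof (cases "L = {} \<or> s \<le> card C")
    case True
    then show ?thesis by (subst grow_iff) auto
  next
    case False
    let ?w = "selw r n i p R C L"
    have w: "?w \<in> L" using False selw_in psubset.hyps by blast
    show ?thesis
    proof (cases "C \<subseteq> Cf")
      case True
      let ?Q = "\<lambda>f. \<forall>z\<in>C. 1/2 \<le> f (?w, z) \<and> 1/2 \<le> f (z, ?w)"
      have fC: "finite C" using psubset.prems by (auto intro: finite_subset)
      have "ev ?J (\<lambda>f. 1/2 \<le> f j)" if "j \<in> ?J" for j
        using ev_coord[of "{1/2..}" j ?J] that by simp
      then have Q: "ev ?J ?Q"
        using True w psubset.prems fC by (intro ev_ball ev_conj) blast+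
      have "ev ?J (\<lambda>f. ?Q f \<and> grow r n (curry f) i p R (insert ?w C) (L - {?w}) Cf
                   \<or> \<not> ?Q f \<and> grow r n (curry f) i p R C (L - {?w}) Cf)"
        using w psubset.prems by (intro ev_disj ev_conj ev_not Q psubset.IH) auto
      then show ?thesis
      proof (rule ev_cong)
        fix f :: "nat \<times> nat \<Rightarrow> real"
        show "grow r n (curry f) i p R C L Cf \<longleftrightarrow>
          ?Q f \<and> grow r n (curry f) i p R (insert ?w C) (L - {?w}) Cf
          \<or> \<not> ?Q f \<and> grow r n (curry f) i p R C (L - {?w}) Cf"
          using False unfolding grow_iff[of r n "curry f" i p R C L]
          by (cases "?Q f") (auto simp: Let_def)
      qed
    next
      case False
      then have "\<not> grow r n (curry f) i p R C L Cf" for f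
        using grow_subset by blast
      then show ?thesis by (intro ev_cong[OF ev_const[of _ False]]) blast
    qed
  qed
qed

abbreviation grown :: "util \<Rightarrow> nat \<Rightarrow> nat set set \<Rightarrow> nat set \<Rightarrow> nat set \<Rightarrow> bool" where
  "grown u i p R C \<equiv> grow r n u i p R {selv r n i p R} (R - {selv r n i p R}) C"

lemma grown_props:
  assumes "finite R" "R \<noteq> {}" "grown u i p R C"
  shows "selv r n i p R \<in> C" "C \<subseteq> R" "card C \<le> s" "clique u C" "R - C \<subset> R"
proof -
  show v: "selv r n i p R \<in> C" using grow_subset[OF assms(3)] by simp
  show "C \<subseteq> R" using grow_upper[OF _ assms(3)] selv_in[OF assms(1,2)] assms(1) by blast
  show "card C \<le> s" using grow_card[OF assms(3)] spar_pos by simp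
  show "clique u C" by (rule grow_clique[OF assms(3)]) (simp add: clique_def)
  show "R - C \<subset> R" using v selv_in[OF assms(1,2)] by blast
qed

lemma greedy_total: "finite R \<Longrightarrow> \<exists>pf Rf. greedy r n u i p R pf Rf"
proof (induction R arbitrary: p rule: finite_psubset_induct)
  case (psubset R)
  show ?case
  proof (cases "R = {}")
    case False
    obtain C where C: "grown u i p R C" using grow_total psubset.hyps by blast
    show ?thesis
    proof (cases "card C < s")
      case True
      then have "greedy r n u i p R p R" using C False by (subst greedy_iff) auto
      then show ?thesis by blast
    next
      case large: False
      obtain pf Rf where "greedy r n u i (insert C p) (R - C) pf Rf"
        using psubset.IH[OF grown_props(5)[OF psubset.hyps False C]] by blast
      then have "greedy r n u i p R pf Rf" using C False large by (subst greedy_iff) auto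
      then show ?thesis by blast
    qed
  qed (subst greedy_iff, auto)
qed

lemma greedy_unique:
  "finite R \<Longrightarrow> greedy r n u i p R pf Rf \<Longrightarrow> greedy r n u i p R pf' Rf' \<Longrightarrow> pf = pf' \<and> Rf = Rf'"
proof (induction R arbitrary: p rule: finite_psubset_induct)
  case (psubset R)
  show ?case
  proof (cases "R = {}")
    case True
    then show ?thesis using psubset.prems by (simp add: greedy_iff[of r n u i p "{}"])
  next
    case False
    then obtain C C' where C: "grown u i p R C" "grown u i p R C'"
      "if card C < s then pf = p \<and> Rf = R else greedy r n u i (insert C p) (R - C) pf Rf"
      "if card C' < s then pf' = p \<and> Rf' = R else greedy r n u i (insert C' p) (R - C') pf' Rf'"
      using psubset.prems unfolding greedy_iff[of r n u i p R] by auto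
    have "C' = C" using grow_unique[OF _ C(1,2)] psubset.hyps by simp
    then show ?thesis
      using C(3,4) psubset.IH[OF grown_props(5)[OF psubset.hyps False C(1)]]
      by (auto split: if_splits)
  qed
qed

text \<open>Loop invariant of the greedy procedure, with \<open>A\<close> the whole part,
  \<open>p\<close> the cliques found so far and \<open>R\<close> what is left.\<close>

definition packing :: "util \<Rightarrow> nat set \<Rightarrow> nat set set \<Rightarrow> nat set \<Rightarrow> bool" where
  "packing u A p R \<longleftrightarrow> finite A \<and> disjoint p \<and> R = A - \<Union>p \<and>
     (\<forall>C\<in>p. C \<subseteq> A \<and> card C = s \<and> clique u C)"

lemma greedy_packing:
  "greedy r n u i p R pf Rf \<Longrightarrow> packing u A p R \<Longrightarrow> packing u A pf Rf"
proof (induction rule: greedy.induct)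
  case (greedy_step R v p C pf Rf)
  have fin: "finite R" using greedy_step.prems by (auto simp: packing_def)
  have g: "grown u i p R C" using greedy_step by simp
  note C = grown_props[OF fin \<open>R \<noteq> {}\<close> g]
  have "C \<inter> D = {}" if "D \<in> p" for D
    using C(2) greedy_step.prems that by (auto simp: packing_def)
  moreover have "R \<subseteq> A" "R - C = A - \<Union>(insert C p)"
    using greedy_step.prems by (auto simp: packing_def)
  moreover have "card C = s" using C(3) greedy_step.hyps(4) by simp
  ultimately have "packing u A (insert C p) (R - C)"
    using C(2,4) greedy_step.prems unfolding packing_def disjoint_def
    by (simp add: Int_commute subset_trans)
  then show ?case by (rule greedy_step.IH)
qed

text \<open>A finite disjunction over the possible first cliques \<open>C\<close>; the continuation
  after \<open>C\<close> reads only pairs inside \<open>R - C\<close>.\<close>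

lemma ev_greedy:
  "finite R \<Longrightarrow> ev (R \<times> R) (\<lambda>f. greedy r n (curry f) i p R pf Rf)"
proof (induction R arbitrary: p rule: finite_psubset_induct)
  case (psubset R)
  show ?case
  proof (cases "R = {}")
    case True
    then show ?thesis by (subst greedy_iff) auto
  next
    case False
    let ?v = "selv r n i p R"
    have v: "?v \<in> R" using selv_in psubset.hyps False by blast
    have "ev (R \<times> R) (\<lambda>f. \<exists>C\<in>{C\<in>Pow R. ?v \<in> C}. grown (curry f) i p R C \<and>
      (if card C < s then pf = p \<and> Rf = R else greedy r n (curry f) i (insert C p) (R - C) pf Rf))"
    proof (intro ev_bex ev_conj)
      show "finite {C\<in>Pow R. ?v \<in> C}" using psubset.hyps by auto
      fix C assume C: "C \<in> {C\<in>Pow R. ?v \<in> C}"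
      show "ev (R \<times> R) (\<lambda>f. grown (curry f) i p R C)"
        by (rule ev_mono[OF ev_grow[of _ R]]) (use C v psubset.hyps in auto)
      have "ev (R \<times> R) (\<lambda>f. greedy r n (curry f) i (insert C p) (R - C) pf Rf)"
        by (rule ev_mono[OF psubset.IH]) (use C v in auto)
      then show "ev (R \<times> R) (\<lambda>f. if card C < s then pf = p \<and> Rf = R
          else greedy r n (curry f) i (insert C p) (R - C) pf Rf)"
        by (cases "card C < s") auto
    qed
    then show ?thesis
    proof (rule ev_cong)
      fix f :: "nat \<times> nat \<Rightarrow> real"
      let ?u = "curry f"
      show "greedy r n ?u i p R pf Rf \<longleftrightarrow> (\<exists>C\<in>{C\<in>Pow R. ?v \<in> C}. grown ?u i p R C \<and>
        (if card C < s then pf = p \<and> Rf = R else greedy r n ?u i (insert C p) (R - C) pf Rf))"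
        using False grown_props(1,2)[OF psubset.hyps False]
        unfolding greedy_iff[of r n ?u i p R] by (simp only: if_False) blast
    qed
  qed
qed

end

section \<open>Stage 2: merging cliques\<close>

lemma uset_Union:
  assumes "finite L" "\<And>D. D \<in> L \<Longrightarrow> finite D" "disjoint L"
  shows "uset u a (\<Union>L) = (\<Sum>D\<in>L. uset u a D)"
  using assms
proof (induction L)
  case (insert D L)
  have "D \<inter> \<Union>L = {}"
    using insert.prems(2) insert.hyps by (auto simp: disjoint_def)
  then have "uset u a (D \<union> \<Union>L) = uset u a D + uset u a (\<Union>L)"
    using insert by (intro uset_Un) auto
  then show ?case using insert by (simp add: disjoint_def)
qed (simp add: uset_def)

lemma scan_NoneD:
  "scan u n k M Cs = (None, c) \<Longrightarrow> c \<subseteq> M \<times> \<Union>(set Cs) \<and> (\<forall>C\<in>set Cs. \<not> compatible u n k M C)"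
proof (induction Cs arbitrary: c)
  case (Cons C Cs)
  then obtain c' where c': "\<not> compatible u n k M C" "scan u n k M Cs = (None, c')" "c = M \<times> C \<union> c'"
    by (auto split: if_splits prod.splits)
  with Cons.IH[OF c'(2)] show ?case by auto
qed simp

text \<open>The scan ends at the first success, so each clique that was read was either taken or
  rejected. This last clause is the link from Stage 2 checks to conflicts.\<close>

lemma scan_SomeD:
  "scan u n k M Cs = (Some C, c) \<Longrightarrow>
    C \<in> set Cs \<and> compatible u n k M C \<and> c \<subseteq> M \<times> \<Union>(set Cs) \<and>
    (\<forall>(a, b)\<in>c. \<exists>D\<in>set Cs. b \<in> D \<and> (D = C \<or> \<not> compatible u n k M D))"
proof (induction Cs arbitrary: c)
  case (Cons D Cs)
  show ?case
  proof (cases "compatible u n k M D")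
    case True
    then show ?thesis using Cons.prems by auto
  next
    case False
    then obtain c' where c': "scan u n k M Cs = (Some C, c')" "c = M \<times> D \<union> c'"
      using Cons.prems by (auto split: prod.splits)
    then show ?thesis using Cons.IH[OF c'(1)] False by auto
  qed
qed simp

text \<open>With \<open>Suc j\<close> steps to go the family being scanned has index
  \<open>20 - j\<close>.\<close>

lemma round2_SucE:
  assumes "round2 r n u pis (Suc j) M = (res, c)"
  obtains (stop) "scan u n (20 - j) M (ord2 r n (20 - j) M (pis (20 - j))) = (None, c)" "res = None"
  | (step) C c1 res' c2 where
      "scan u n (20 - j) M (ord2 r n (20 - j) M (pis (20 - j))) = (Some C, c1)"
      "round2 r n u pis j (M \<union> C) = (res', c2)" "res = map_option (Cons C) res'" "c = c1 \<union> c2"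
proof -
  obtain o1 c1 where s: "scan u n (20 - j) M (ord2 r n (20 - j) M (pis (20 - j))) = (o1, c1)"
    by fastforce
  show thesis
  proof (cases o1)
    case None
    then show ?thesis using assms s by (intro stop) (auto simp: Let_def)
  next
    case (Some C)
    obtain res' c2 where r: "round2 r n u pis j (M \<union> C) = (res', c2)" by fastforce
    show ?thesis using assms s r Some by (intro step[OF _ r]) (auto simp: Let_def)
  qed
qed

context algorithm
begin

section \<open>Families of disjoint cliques and conflicts between them\<close>

definition family :: "(nat \<Rightarrow> nat set set) \<Rightarrow> bool" where
  "family pis \<longleftrightarrow> (\<forall>k\<in>{1..20}. disjoint (pis k) \<and> (\<forall>C\<in>pis k. C \<subseteq> part r n k \<and> card C = s))"

definition members :: "(nat \<Rightarrow> nat set set) \<Rightarrow> nat set set" where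
  "members pis = (\<Union>k\<in>{1..20}. pis k)"

definition agents :: "(nat \<Rightarrow> nat set set) \<Rightarrow> nat set" where
  "agents pis = \<Union>(members pis)"

definition badpair :: "util \<Rightarrow> nat set \<Rightarrow> nat set \<Rightarrow> bool" where
  "badpair u D C \<longleftrightarrow> (\<exists>a\<in>D. uset u a C < - real s / 80) \<or> (\<exists>b\<in>C. uset u b D < - real s / 80)"

text \<open>Two cliques of the same part never count as conflicting, so conflicts depend only on
  utilities across parts, which Stage 1 has not read.\<close>

definition conflict :: "util \<Rightarrow> nat set \<Rightarrow> nat set \<Rightarrow> bool" where
  "conflict u D C \<longleftrightarrow> (\<forall>i\<in>{1..20}. D \<subseteq> part r n i \<longrightarrow> \<not> C \<subseteq> part r n i) \<and> badpair u D C"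

definition intra :: "(nat \<times> nat) set" where
  "intra = (\<Union>i\<in>{1..20}. part r n i \<times> part r n i)"

lemma family_finite_member:
  "family pis \<Longrightarrow> k \<in> {1..20} \<Longrightarrow> C \<in> pis k \<Longrightarrow> finite C"
  unfolding family_def by (meson finite_part finite_subset)

lemma family_member: "family pis \<Longrightarrow> k \<in> {1..20} \<Longrightarrow> C \<in> pis k \<Longrightarrow> C \<subseteq> part r n k \<and> card C = s \<and> C \<noteq> {}"
  unfolding family_def using spar_pos by (metis card.empty not_less_zero)

lemma family_finite: "family pis \<Longrightarrow> k \<in> {1..20} \<Longrightarrow> finite (pis k)"
  by (rule finite_subset[of _ "Pow (part r n k)"]) (auto dest: family_member simp: finite_part)

lemma family_unique:
  assumes "family pis" "k \<in> {1..20}" "l \<in> {1..20}" "C \<in> pis k" "D \<in> pis l" "x \<in> C" "x \<in> D"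
  shows "k = l \<and> C = D"
proof -
  have "k = l" using assms family_member part_unique by blast
  then show ?thesis using assms unfolding family_def disjoint_def by blast
qed

lemma finite_members: "family pis \<Longrightarrow> finite (members pis)"
  unfolding members_def using family_finite by auto

lemma disjoint_members: "family pis \<Longrightarrow> disjoint (members pis)"
  unfolding members_def disjoint_def using family_unique by blast

lemma members_unique:
  "family pis \<Longrightarrow> C \<in> members pis \<Longrightarrow> D \<in> members pis \<Longrightarrow> x \<in> C \<Longrightarrow> x \<in> D \<Longrightarrow> C = D"
  using disjoint_members unfolding disjoint_def by (metis disjoint_iff)

lemma member_props: "family pis \<Longrightarrow> C \<in> members pis \<Longrightarrow> finite C \<and> card C = s \<and> C \<noteq> {} \<and> C \<subseteq> {0..<n}"
  unfolding members_def using family_member family_finite_member part_subset by blast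

lemma agents_subset: "family pis \<Longrightarrow> agents pis \<subseteq> {0..<n}"
  unfolding agents_def using member_props by blast

text \<open>The threshold for the utility of \<open>b\<close> towards the whole coalition is
  \<open>k - 1\<close> times \<open>- s / 80\<close>, one share for each clique merged so far, so
  its violation can be charged to a single clique. Compatibility is thereby controlled by relations
  between pairs of cliques.\<close>

lemma incompatible_badpair:
  assumes L: "finite L" "disjoint L" "\<And>D. D \<in> L \<Longrightarrow> finite D" "real k - 1 = real (card L)"
    and C: "C \<inter> \<Union>L = {}" and inc: "\<not> compatible u n k (\<Union>L) C"
  shows "\<exists>D\<in>L. badpair u D C"
proof (rule ccontr)
  assume no: "\<not> (\<exists>D\<in>L. badpair u D C)"
  have "- real s / 80 \<le> uset u a C" if "a \<in> \<Union>L" for a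
    using no that unfolding badpair_def not_less[symmetric] by auto
  moreover have "- ((real k - 1) / 80) * real s \<le> uset u b (\<Union>L)" if "b \<in> C" for b
  proof -
    have "- ((real k - 1) / 80) * real s = (\<Sum>D\<in>L. - real s / 80)"
      by (simp add: L(4))
    also have "\<dots> \<le> (\<Sum>D\<in>L. uset u b D)"
      using no that unfolding badpair_def by (intro sum_mono) (auto simp: not_less)
    also have "\<dots> = uset u b (\<Union>L)"
      using L by (intro uset_Union[symmetric]) auto
    finally show ?thesis .
  qed
  ultimately show False using inc unfolding compatible_def by simp
qed

text \<open>An old member loses at most \<open>s / 80\<close> to the new clique. A new member starts
  with \<open>(s - 1) / 2\<close> from its own clique and loses at most \<open>m * s / 80\<close> to
  \<open>M\<close>, so both kinds stay within the same bound.\<close>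

lemma compatible_stable:
  fixes m :: nat
  assumes comp: "compatible u n (Suc m) M C" and C: "clique u C" "card C = s" "finite C"
    and M: "finite M" "M \<inter> C = {}" "\<forall>a\<in>M. (real s - 1) / 2 - m * real s / 80 \<le> uset u a M"
  shows "\<forall>a\<in>M \<union> C. (real s - 1) / 2 - real (Suc m) * real s / 80 \<le> uset u a (M \<union> C)"
proof
  fix a assume "a \<in> M \<union> C"
  then consider "a \<in> M" | "a \<in> C" by blast
  then show "(real s - 1) / 2 - real (Suc m) * real s / 80 \<le> uset u a (M \<union> C)"
  proof cases
    case 1
    have "C \<noteq> {}" using C(2) spar_pos by auto
    then have "- real s / 80 \<le> uset u a C"
      using comp 1 unfolding compatible_def by auto
    then show ?thesis using M C 1 by (auto simp: uset_Un algebra_simps add_divide_distrib)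
  next
    case 2
    \<comment> \<open>For \<open>M = {}\<close> the compatibility condition is vacuous, and the
      bound holds because the sum is empty.\<close>
    have "M = {} \<or> - (real m / 80) * real s \<le> uset u a M"
      using comp 2 unfolding compatible_def by auto
    then have "- (real m / 80) * real s \<le> uset u a M"
      by (auto simp: uset_def)
    moreover have "(real s - 1) / 2 \<le> uset u a C"
      using uset_clique_ge[OF C(1) 2 C(3)] C(2) by simp
    ultimately show ?thesis using M C 2 by (simp add: uset_Un algebra_simps add_divide_distrib)
  qed
qed

text \<open>The coalition \<open>M\<close> under construction is represented as a union of
  \<open>m\<close> cliques, since the thresholds in \<open>compatible\<close> are proportional to
  the number of cliques merged.\<close>

definition earlier :: "(nat \<Rightarrow> nat set set) \<Rightarrow> nat \<Rightarrow> nat set set \<Rightarrow> bool" where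
  "earlier pis m L \<longleftrightarrow> L \<subseteq> (\<Union>k\<in>{1..m}. pis k) \<and> card L = m \<and> finite L"

lemma earlier_props:
  assumes "family pis" "earlier pis m L" "m < 20"
  shows "disjoint L" "\<And>D. D \<in> L \<Longrightarrow> finite D \<and> D \<noteq> {} \<and> card D = s" "\<Union>L \<subseteq> agents pis" "finite (\<Union>L)"
    "C \<in> pis (Suc m) \<Longrightarrow> C \<inter> \<Union>L = {}" "C \<in> pis (Suc m) \<Longrightarrow> earlier pis (Suc m) (insert C L)"
proof -
  have sub: "L \<subseteq> members pis"
    using assms(2,3) unfolding earlier_def members_def by fastforce
  show "disjoint L" using disjoint_members[OF assms(1)] sub by (auto simp: disjoint_def)
  show D: "finite D \<and> D \<noteq> {} \<and> card D = s" if "D \<in> L" for D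
    using member_props[OF assms(1)] sub that by blast
  show "\<Union>L \<subseteq> agents pis" using sub by (auto simp: agents_def)
  show "finite (\<Union>L)" using D assms(2) by (auto simp: earlier_def)
  assume C: "C \<in> pis (Suc m)"
  have "x \<notin> D" if "x \<in> C" "D \<in> L" for x D
  proof
    assume "x \<in> D"
    obtain k where "k \<in> {1..m}" "D \<in> pis k" using \<open>D \<in> L\<close> assms(2) by (auto simp: earlier_def)
    then show False
      using family_unique[OF assms(1), of "Suc m" k C D x] C that \<open>x \<in> D\<close> assms(3) by auto
  qed
  then show disj: "C \<inter> \<Union>L = {}" by blast
  moreover have "C \<noteq> {}" using family_member[OF assms(1) _ C] assms(3) by simp
  ultimately have "C \<notin> L" by blast
  then show "earlier pis (Suc m) (insert C L)"
    using assms(2) C by (fastforce simp: earlier_def)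
qed

lemma round2_checks:
  assumes "family pis" "j \<le> 20" "round2 r n u pis j M = (res, c)"
  shows "c \<subseteq> (M \<union> agents pis) \<times> agents pis"
  using assms(2,3)
proof (induction j arbitrary: M res c)
  case (Suc j)
  have k: "20 - j \<in> {1..20}" using Suc.prems by auto
  have o: "set (ord2 r n (20 - j) M (pis (20 - j))) = pis (20 - j)" for M
    using family_finite[OF assms(1) k] by (rule set_ord2)
  have sub: "\<Union>(pis (20 - j)) \<subseteq> agents pis" using k unfolding agents_def members_def by blast
  from Suc.prems(2) show ?case
  proof (cases rule: round2_SucE)
    case stop
    then show ?thesis using scan_NoneD[OF stop(1)] sub by (auto simp: o)
  next
    case (step C c1 res' c2)
    have "c2 \<subseteq> (M \<union> C \<union> agents pis) \<times> agents pis"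
      using Suc.IH[OF _ step(2)] Suc.prems by simp
    then show ?thesis using scan_SomeD[OF step(1)] sub step(4) unfolding o by blast
  qed
qed simp

text \<open>The cliques of \<open>L\<close> come from families of smaller index than the one
  scanned, so each pair that is read joins two different parts.\<close>

lemma round2_inter:
  assumes fam: "family pis"
  shows "j \<le> 20 \<Longrightarrow> earlier pis (20 - j) L \<Longrightarrow> round2 r n u pis j (\<Union>L) = (res, c) \<Longrightarrow> c \<inter> intra = {}"
proof (induction j arbitrary: L res c)
  case (Suc j)
  let ?k = "20 - j"
  have k: "?k \<in> {1..20}" "?k = Suc (20 - Suc j)" "20 - Suc j < 20" using Suc.prems by auto
  have o: "set (ord2 r n ?k M (pis ?k)) = pis ?k" for M
    using family_finite[OF assms(1) k(1)] by (rule set_ord2)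
  note e = earlier_props[OF fam Suc.prems(2) k(3)]
  have "(a, b) \<notin> intra" if "a \<in> \<Union>L" "b \<in> \<Union>(pis ?k)" for a b
  proof
    assume "(a, b) \<in> intra"
    then obtain i where i: "i \<in> {1..20}" "a \<in> part r n i" "b \<in> part r n i"
      unfolding intra_def by blast
    obtain D l where D: "D \<in> pis l" "a \<in> D" and l: "l \<in> {1..20 - Suc j}"
      using Suc.prems(2) \<open>a \<in> \<Union>L\<close> by (auto simp: earlier_def)
    have l20: "l \<in> {1..20}" "l \<noteq> ?k" using l k(2) by auto
    obtain C where C: "C \<in> pis ?k" "b \<in> C" using \<open>b \<in> \<Union>(pis ?k)\<close> by blast
    have "a \<in> part r n l" using family_member[OF fam l20(1) D(1)] D(2) by blast
    moreover have "b \<in> part r n ?k" using family_member[OF fam k(1) C(1)] C(2) by blast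
    ultimately show False
      using part_unique[OF i(1) l20(1) i(2)] part_unique[OF i(1) k(1) i(3)] l20(2) by blast
  qed
  then have inter: "(\<Union>L \<times> \<Union>(pis ?k)) \<inter> intra = {}" by auto
  from Suc.prems(3) show ?case
  proof (cases rule: round2_SucE)
    case stop
    then show ?thesis using scan_NoneD[OF stop(1), unfolded o] inter by blast
  next
    case (step C c1 res' c2)
    note sc = scan_SomeD[OF step(1), unfolded o]
    have "earlier pis ?k (insert C L)" using e(6)[of C] sc k(2) by simp
    moreover have "round2 r n u pis j (\<Union>(insert C L)) = (res', c2)"
      using step(2) by (simp add: Un_commute)
    ultimately have "c2 \<inter> intra = {}" using Suc.IH[of "insert C L"] Suc.prems(1) by simp
    moreover have "c1 \<inter> intra = {}" using sc inter by blast
    ultimately show ?thesis using step(4) by blast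
  qed
qed simp

text \<open>Stated for an arbitrary partial coalition \<open>\<Union>L\<close> so that the induction
  goes through; with \<open>j\<close> steps to go the next family has index \<open>21 - j\<close>.
  Every read pair is charged to a clique that is taken or that conflicts with a clique of the
  coalition. The losses of \<open>s / 80\<close> per step add up to
  \<open>20 * s / 80 = s / 4\<close>.\<close>

lemma round2_SomeD:
  assumes fam: "family pis" and "j \<le> 20" "earlier pis (20 - j) L"
    "round2 r n u pis j (\<Union>L) = (Some Cs, c)"
  shows "length Cs = j" "\<forall>i<j. Cs ! i \<in> pis (21 - j + i)"
    "c \<subseteq> \<Union>(L \<union> set Cs) \<times> agents pis"
    "\<forall>(a, b)\<in>c. \<exists>D\<in>members pis. b \<in> D \<and> (D \<in> set Cs \<or> (\<exists>D'\<in>L \<union> set Cs. conflict u D' D))"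
    "\<forall>C\<in>members pis. clique u C \<Longrightarrow>
      \<forall>a\<in>\<Union>L. (real s - 1) / 2 - real (20 - j) * real s / 80 \<le> uset u a (\<Union>L) \<Longrightarrow>
      \<forall>a\<in>\<Union>(L \<union> set Cs). (real s - 1) / 2 - real s / 4 \<le> uset u a (\<Union>(L \<union> set Cs))"
  using assms(2-)
proof (atomize(full), induction j arbitrary: L Cs c)
  case 0
  then show ?case by auto
next
  case (Suc j)
  let ?k = "20 - j"
  have k: "?k \<in> {1..20}" "?k = Suc (20 - Suc j)" "20 - Suc j < 20" using Suc.prems by auto
  have o: "set (ord2 r n ?k M (pis ?k)) = pis ?k" for M
    using family_finite[OF assms(1) k(1)] by (rule set_ord2)
  from Suc.prems(3) show ?case
  proof (cases rule: round2_SucE)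
    case (step C c1 res' c2)
    then obtain Cs' where Cs': "res' = Some Cs'" "Cs = C # Cs'" by (cases res') auto
    note sc = scan_SomeD[OF step(1), unfolded o]
    have C: "C \<in> pis (Suc (20 - Suc j))" using sc k(2) by simp
    note e = earlier_props[OF fam Suc.prems(2) k(3)]
    have e': "earlier pis ?k (insert C L)" using e(6)[OF C] k(2) by simp
    have "round2 r n u pis j (\<Union>(insert C L)) = (Some Cs', c2)"
      using step(2) Cs' by (simp add: Un_commute)
    from Suc.IH[OF _ e' this] Suc.prems(1)
    have IH: "length Cs' = j" "\<forall>i<j. Cs' ! i \<in> pis (21 - j + i)"
      "c2 \<subseteq> \<Union>(insert C L \<union> set Cs') \<times> agents pis"
      "\<forall>(a, b)\<in>c2. \<exists>D\<in>members pis. b \<in> D \<and> (D \<in> set Cs' \<or> (\<exists>D'\<in>insert C L \<union> set Cs'. conflict u D' D))"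
      "\<forall>C\<in>members pis. clique u C \<Longrightarrow>
      \<forall>a\<in>\<Union>(insert C L). (real s - 1) / 2 - real ?k * real s / 80 \<le> uset u a (\<Union>(insert C L)) \<Longrightarrow>
      \<forall>a\<in>\<Union>(insert C L \<union> set Cs'). (real s - 1) / 2 - real s / 4 \<le> uset u a (\<Union>(insert C L \<union> set Cs'))"
      by auto
    have un: "insert C L \<union> set Cs' = L \<union> set Cs" using Cs' by auto
    have 1: "length Cs = Suc j" using IH(1) Cs' by simp
    have 2: "\<forall>i<Suc j. Cs ! i \<in> pis (21 - Suc j + i)"
    proof (intro allI impI)
      fix i assume "i < Suc j"
      then show "Cs ! i \<in> pis (21 - Suc j + i)"
      proof (cases i)
        case 0
        have "21 - Suc j + 0 = Suc (20 - Suc j)" using Suc.prems(1) by arith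
        then show ?thesis using C Cs' 0 by simp
      next
        case (Suc i')
        have "21 - Suc j + Suc i' = 21 - j + i'" using Suc.prems(1) by arith
        moreover have "Cs' ! i' \<in> pis (21 - j + i')" using IH(2) \<open>i < Suc j\<close> Suc by simp
        ultimately show ?thesis using Cs' Suc by (simp only: nth_Cons_Suc)
      qed
    qed
    have subk: "pis ?k \<subseteq> members pis" unfolding members_def by (rule UN_upper[OF k(1)])
    have "c1 \<subseteq> \<Union>L \<times> \<Union>(pis ?k)" using sc by (elim conjE)
    also have "\<dots> \<subseteq> \<Union>L \<times> agents pis"
      unfolding agents_def by (intro Sigma_mono Union_mono order_refl subk)
    finally have "c1 \<subseteq> \<Union>L \<times> agents pis" .
    then have 3: "c \<subseteq> \<Union>(L \<union> set Cs) \<times> agents pis"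
      using IH(3) step(4) unfolding un by auto
    have 4: "\<forall>(a, b)\<in>c. \<exists>D\<in>members pis. b \<in> D \<and> (D \<in> set Cs \<or> (\<exists>D'\<in>L \<union> set Cs. conflict u D' D))"
    proof (intro ballI, clarify)
      fix a b assume "(a, b) \<in> c"
      then consider "(a, b) \<in> c1" | "(a, b) \<in> c2" using step(4) by blast
      then show "\<exists>D\<in>members pis. b \<in> D \<and> (D \<in> set Cs \<or> (\<exists>D'\<in>L \<union> set Cs. conflict u D' D))"
      proof cases
        case 1
        then obtain D where D: "D \<in> pis ?k" "b \<in> D" "D = C \<or> \<not> compatible u n ?k (\<Union>L) D"
          using sc by blast
        have "\<exists>D'\<in>L. badpair u D' D" if "D \<noteq> C"
        proof (rule incompatible_badpair)
          show "finite L" using Suc.prems(2) by (simp add: earlier_def)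
          show "real ?k - 1 = real (card L)"
            using Suc.prems(1,2) by (simp add: earlier_def of_nat_diff)
          show "D \<inter> \<Union>L = {}" using e(5)[of D] D(1) k(2) by simp
        qed (use e D that in auto)
        moreover have "conflict u D' D" if D': "D' \<in> L" "badpair u D' D" for D'
        proof -
          obtain l where l: "l \<in> {1..20 - Suc j}" "D' \<in> pis l"
            using D'(1) Suc.prems(2) by (auto simp: earlier_def)
          have l20: "l \<in> {1..20}" "l \<noteq> ?k" using l(1) k(2) by auto
          obtain x y where "x \<in> D'" "y \<in> D" "D' \<subseteq> part r n l" "D \<subseteq> part r n ?k"
            using family_member[OF fam l20(1) l(2)] family_member[OF fam k(1) D(1)] by blast
          then have "\<not> (D' \<subseteq> part r n i \<and> D \<subseteq> part r n i)" if "i \<in> {1..20}" for i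
            using part_unique[OF that l20(1), of x] part_unique[OF that k(1), of y] l20(2) by blast
          then show ?thesis using D'(2) by (auto simp: conflict_def)
        qed
        ultimately show ?thesis using D subk Cs' by fastforce
      next
        case 2
        then show ?thesis using IH(4) un Cs' by fastforce
      qed
    qed
    have 5: "\<forall>a\<in>\<Union>(L \<union> set Cs). (real s - 1) / 2 - real s / 4 \<le> uset u a (\<Union>(L \<union> set Cs))"
      if cl: "\<forall>C\<in>members pis. clique u C"
        and M: "\<forall>a\<in>\<Union>L. (real s - 1) / 2 - real (20 - Suc j) * real s / 80 \<le> uset u a (\<Union>L)"
    proof -
      have "C \<in> members pis" using sc subk by blast
      then have "\<forall>a\<in>\<Union>L \<union> C. (real s - 1) / 2 - real (Suc (20 - Suc j)) * real s / 80 \<le> uset u a (\<Union>L \<union> C)"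
        using cl sc k(2) e(4) e(5)[OF C] M member_props[OF fam]
        by (intro compatible_stable) (auto simp: Int_commute)
      then have "\<forall>a\<in>\<Union>(insert C L). (real s - 1) / 2 - real ?k * real s / 80 \<le> uset u a (\<Union>(insert C L))"
        using k(2) by (simp add: Un_commute)
      then show ?thesis using IH(5) cl unfolding un by blast
    qed
    show ?thesis using 1 2 3 4 5 by blast
  qed simp
qed

end

section \<open>Runs of Stages 2 and 3\<close>

definition discard :: "(nat \<Rightarrow> nat set set) \<Rightarrow> nat set list \<Rightarrow> nat \<Rightarrow> nat set set" where
  "discard pis Cs = (\<lambda>k. if 1 \<le> k \<and> k \<le> 20 then pis k - {Cs ! (k - 1)} else pis k)"

lemma stage2_iff:
  "stage2 r n u pis Pc ch pisf Pf chf \<longleftrightarrow>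
    pis 1 = {} \<and> pisf = pis \<and> Pf = Pc \<and> chf = ch \<or>
    (\<exists>c. pis 1 \<noteq> {} \<and> round2 r n u pis 20 {} = (None, c) \<and> pisf = pis \<and> Pf = Pc \<and> chf = ch \<union> c) \<or>
    (\<exists>Cs c. pis 1 \<noteq> {} \<and> round2 r n u pis 20 {} = (Some Cs, c) \<and>
      stage2 r n u (discard pis Cs) (insert (\<Union>(set Cs)) Pc) (ch \<union> c) pisf Pf chf)"
  unfolding discard_def
proof
  assume "stage2 r n u pis Pc ch pisf Pf chf"
  then show "pis 1 = {} \<and> pisf = pis \<and> Pf = Pc \<and> chf = ch \<or>
    (\<exists>c. pis 1 \<noteq> {} \<and> round2 r n u pis 20 {} = (None, c) \<and> pisf = pis \<and> Pf = Pc \<and> chf = ch \<union> c) \<or>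
    (\<exists>Cs c. pis 1 \<noteq> {} \<and> round2 r n u pis 20 {} = (Some Cs, c) \<and>
      stage2 r n u (\<lambda>k. if 1 \<le> k \<and> k \<le> 20 then pis k - {Cs ! (k - 1)} else pis k)
        (insert (\<Union>(set Cs)) Pc) (ch \<union> c) pisf Pf chf)"
    by (cases rule: stage2.cases) simp_all
next
  let ?pis' = "\<lambda>Cs k. if 1 \<le> k \<and> k \<le> 20 then pis k - {Cs ! (k - 1)} else pis k"
  assume "pis 1 = {} \<and> pisf = pis \<and> Pf = Pc \<and> chf = ch \<or>
    (\<exists>c. pis 1 \<noteq> {} \<and> round2 r n u pis 20 {} = (None, c) \<and> pisf = pis \<and> Pf = Pc \<and> chf = ch \<union> c) \<or>
    (\<exists>Cs c. pis 1 \<noteq> {} \<and> round2 r n u pis 20 {} = (Some Cs, c) \<and>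
      stage2 r n u (?pis' Cs) (insert (\<Union>(set Cs)) Pc) (ch \<union> c) pisf Pf chf)"
  then consider (finished) "pis 1 = {}" "pisf = pis" "Pf = Pc" "chf = ch"
    | (stop) c where "pis 1 \<noteq> {}" "round2 r n u pis 20 {} = (None, c)" "pisf = pis" "Pf = Pc" "chf = ch \<union> c"
    | (step) Cs c where "pis 1 \<noteq> {}" "round2 r n u pis 20 {} = (Some Cs, c)"
        "stage2 r n u (?pis' Cs) (insert (\<Union>(set Cs)) Pc) (ch \<union> c) pisf Pf chf"
    by blast
  then show "stage2 r n u pis Pc ch pisf Pf chf"
  proof cases
    case finished
    then show ?thesis using s2_done by blast
  next
    case stop
    then show ?thesis using s2_stop by blast
  next
    case step
    then show ?thesis by (rule s2_step)
  qed
qed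

text \<open>Stage 2 stripped of the coalitions and checks it accumulates, so that its failure
  probability can be bounded by induction on \<open>pis\<close> alone.\<close>

inductive stuck :: "sel_rules \<Rightarrow> nat \<Rightarrow> util \<Rightarrow> nat \<Rightarrow> (nat \<Rightarrow> nat set set) \<Rightarrow> bool" for r n u t where
  stuck_now: "pis 1 \<noteq> {} \<Longrightarrow> round2 r n u pis 20 {} = (None, c) \<Longrightarrow> \<forall>k\<in>{1..20}. t \<le> card (pis k) \<Longrightarrow>
    stuck r n u t pis"
| stuck_later: "pis 1 \<noteq> {} \<Longrightarrow> round2 r n u pis 20 {} = (Some Cs, c) \<Longrightarrow> stuck r n u t (discard pis Cs) \<Longrightarrow>
    stuck r n u t pis"

text \<open>Because \<open>0 < t\<close>, a run that ends with \<open>pis 1 = {}\<close> leaves a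
  family smaller than \<open>t\<close>; if all families stay large, the run must have ended with a
  failed round.\<close>

lemma stage2_stuck:
  "stage2 r n u pis Pc ch pisf Pf chf \<Longrightarrow> \<forall>k\<in>{1..20}. t \<le> card (pisf k) \<Longrightarrow> 0 < t \<Longrightarrow> stuck r n u t pis"
proof (induction rule: stage2.induct)
  case (s2_done pis Pc ch)
  have "t \<le> card (pis 1)" using s2_done.prems(1) by (rule bspec) simp
  then have "t \<le> 0" using s2_done.hyps by (simp only: card.empty)
  then show ?case using s2_done.prems(2) by simp
next
  case (s2_stop pis c Pc ch)
  then show ?case by (intro stuck_now)
next
  case (s2_step pis Cs c Pc ch pisf Pf chf)
  then show ?case using stuck_later[OF s2_step.hyps(1,2)] unfolding discard_def by simp
qed

lemma no_check_Un: "no_check (ch \<union> c) x P \<longleftrightarrow> no_check ch x P \<and> no_check c x P"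
  by (auto simp: no_check_def)

lemma stage3_iff:
  "stage3 r n u ch F D X res \<longleftrightarrow>
    (if X = {} then res = Some (F \<union> D)
     else let x = selx r n F D X; cs = {C \<in> F. 0 < uset u x C \<and> no_check ch x C};
              C = selc r n x F D X cs in
       if cs = {} then res = None
       else stage3 r n u ch (F - {C}) (insert (insert x C) D) (X - {x}) res)"
  by (subst stage3.simps) (auto simp: Let_def)

context algorithm
begin

section \<open>Whole rounds and the invariant of Stage 2\<close>

lemma round_checks:
  assumes "family pis" "round2 r n u pis 20 {} = (res, c)"
  shows "c \<subseteq> agents pis \<times> agents pis - intra"
proof -
  have "earlier pis (20 - 20) {}" by (simp add: earlier_def)
  then have "c \<inter> intra = {}"
    using round2_inter[OF assms(1) order_refl, of "{}"] assms(2) unfolding Union_empty by blast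
  then show ?thesis using round2_checks[OF assms(1) order_refl assms(2)] by blast
qed

text \<open>\<open>round2_SomeD\<close> started from the empty coalition. One clique comes from each
  part, so the coalition meets part \<open>k\<close> exactly in \<open>Cs ! (k - 1)\<close>;
  families are numbered from 1, list positions from 0.\<close>

lemma round_SomeD:
  assumes fam: "family pis" and round: "round2 r n u pis 20 {} = (Some Cs, c)"
  shows "length Cs = 20" "\<And>k. k \<in> {1..20} \<Longrightarrow> Cs ! (k - 1) \<in> pis k" "set Cs \<subseteq> members pis"
    "\<And>k. k \<in> {1..20} \<Longrightarrow> set Cs \<inter> pis k = {Cs ! (k - 1)}"
    "\<And>k. k \<in> {1..20} \<Longrightarrow> \<Union>(set Cs) \<inter> part r n k = Cs ! (k - 1)"
    "c \<subseteq> \<Union>(set Cs) \<times> agents pis"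
    "\<And>a b. (a, b) \<in> c \<Longrightarrow> \<exists>D\<in>members pis. b \<in> D \<and> (D \<in> set Cs \<or> (\<exists>D'\<in>set Cs. conflict u D' D))"
    "\<forall>C\<in>members pis. clique u C \<Longrightarrow>
      \<forall>a\<in>\<Union>(set Cs). (real s - 1) / 2 - real s / 4 \<le> uset u a (\<Union>(set Cs))"
proof -
  have "earlier pis (20 - 20) {}" by (simp add: earlier_def)
  from round2_SomeD[OF fam order_refl this, unfolded Union_empty, OF round]
  have *: "length Cs = 20" "\<forall>i<20. Cs ! i \<in> pis (21 - 20 + i)" "c \<subseteq> \<Union>(set Cs) \<times> agents pis"
    "\<forall>(a, b)\<in>c. \<exists>D\<in>members pis. b \<in> D \<and> (D \<in> set Cs \<or> (\<exists>D'\<in>set Cs. conflict u D' D))"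
    "\<forall>C\<in>members pis. clique u C \<Longrightarrow>
      \<forall>a\<in>\<Union>(set Cs). (real s - 1) / 2 - real s / 4 \<le> uset u a (\<Union>(set Cs))"
    by auto
  show "length Cs = 20" "c \<subseteq> \<Union>(set Cs) \<times> agents pis"
    "\<And>a b. (a, b) \<in> c \<Longrightarrow> \<exists>D\<in>members pis. b \<in> D \<and> (D \<in> set Cs \<or> (\<exists>D'\<in>set Cs. conflict u D' D))"
    "\<forall>C\<in>members pis. clique u C \<Longrightarrow>
      \<forall>a\<in>\<Union>(set Cs). (real s - 1) / 2 - real s / 4 \<le> uset u a (\<Union>(set Cs))"
    using * by auto
  show mem: "Cs ! (k - 1) \<in> pis k" if "k \<in> {1..20}" for k
  proof -
    have "k - 1 < 20" "21 - 20 + (k - 1) = k" using that by auto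
    then show ?thesis using *(2)[rule_format, of "k - 1"] by (simp only:)
  qed
  have elem: "\<exists>k\<in>{1..20}. C = Cs ! (k - 1)" if "C \<in> set Cs" for C
  proof -
    obtain i where "i < 20" "C = Cs ! i" using \<open>C \<in> set Cs\<close> *(1) by (metis in_set_conv_nth)
    then show ?thesis by (intro bexI[of _ "Suc i"]) auto
  qed
  have nth: "Cs ! (k - 1) \<in> set Cs" if "k \<in> {1..20}" for k
    using that *(1) by (intro nth_mem) auto
  show "set Cs \<subseteq> members pis" using elem mem unfolding members_def by blast
  show "set Cs \<inter> pis k = {Cs ! (k - 1)}" if k: "k \<in> {1..20}" for k
  proof -
    have "C = Cs ! (k - 1)" if C: "C \<in> set Cs" "C \<in> pis k" for C
    proof -
      obtain l where l: "l \<in> {1..20}" "C = Cs ! (l - 1)" using elem[OF C(1)] by blast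
      obtain x where "x \<in> C" using family_member[OF fam k C(2)] by blast
      then have "k = l" using family_unique[OF fam k l(1) C(2), of C x] mem[OF l(1)] l(2) by simp
      then show ?thesis using l by simp
    qed
    then show ?thesis using mem[OF k] nth[OF k] by blast
  qed
  show "\<Union>(set Cs) \<inter> part r n k = Cs ! (k - 1)" if k: "k \<in> {1..20}" for k
  proof
    show "Cs ! (k - 1) \<subseteq> \<Union>(set Cs) \<inter> part r n k"
      using nth[OF k] family_member[OF fam k mem[OF k]] by blast
    show "\<Union>(set Cs) \<inter> part r n k \<subseteq> Cs ! (k - 1)"
    proof
      fix x assume x: "x \<in> \<Union>(set Cs) \<inter> part r n k"
      then obtain l where l: "l \<in> {1..20}" "x \<in> Cs ! (l - 1)" using elem by blast
      then have "x \<in> part r n l" using family_member[OF fam l(1) mem[OF l(1)]] by blast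
      then have "l = k" using part_unique[OF l(1) k] x by blast
      then show "x \<in> Cs ! (k - 1)" using l by simp
    qed
  qed
qed

lemma discard_props:
  assumes fam: "family pis" and round: "round2 r n u pis 20 {} = (Some Cs, c)"
  shows "family (discard pis Cs)" "\<And>k. k \<in> {1..20} \<Longrightarrow> card (discard pis Cs k) + 1 = card (pis k)"
    "\<And>k. discard pis Cs k \<subseteq> pis k"
    "members (discard pis Cs) = members pis - set Cs" "agents (discard pis Cs) = agents pis - \<Union>(set Cs)"
proof -
  note rs = round_SomeD[OF fam round]
  show sub: "discard pis Cs k \<subseteq> pis k" for k by (auto simp: discard_def)
  show "family (discard pis Cs)"
    using fam sub unfolding family_def disjoint_def by (meson subsetD)
  show "card (discard pis Cs k) + 1 = card (pis k)" if k: "k \<in> {1..20}" for k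
    using rs(2)[OF k] family_finite[OF fam k] k card_Suc_Diff1[of "pis k"] by (simp add: discard_def)
  show mem: "members (discard pis Cs) = members pis - set Cs"
  proof -
    have "discard pis Cs k = pis k - set Cs" if "k \<in> {1..20}" for k
      using rs(4)[OF that] that unfolding discard_def by auto
    then show ?thesis unfolding members_def by blast
  qed
  show "agents (discard pis Cs) = agents pis - \<Union>(set Cs)"
  proof -
    have "x \<notin> D" if "x \<in> C" "C \<in> members pis" "C \<notin> set Cs" "D \<in> set Cs" for x C D
      using members_unique[OF fam, of C D x] rs(3) that by blast
    then show ?thesis unfolding agents_def mem by blast
  qed
qed

lemma stage2_total: "family pis \<Longrightarrow> \<exists>pisf Pf chf. stage2 r n u pis Pc ch pisf Pf chf"
proof (induction "card (pis 1)" arbitrary: pis Pc ch rule: less_induct)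
  case less
  show ?case
  proof (cases "pis 1 = {}")
    case True
    then show ?thesis using s2_done by blast
  next
    case False
    obtain res c where rd: "round2 r n u pis 20 {} = (res, c)" by fastforce
    show ?thesis
    proof (cases res)
      case None
      then have "stage2 r n u pis Pc ch pis Pc (ch \<union> c)"
        using rd False by (intro s2_stop) simp_all
      then show ?thesis by blast
    next
      case (Some Cs)
      note d = discard_props[OF less.prems, of u Cs c]
      have "card (discard pis Cs 1) < card (pis 1)" using d(2)[of 1] rd Some by simp
      then obtain pisf Pf chf where
        "stage2 r n u (discard pis Cs) (insert (\<Union>(set Cs)) Pc) (ch \<union> c) pisf Pf chf"
        using less.hyps d(1) rd Some by blast
      then have "stage2 r n u pis Pc ch pisf Pf chf"
        using rd Some False unfolding stage2_iff[of r n u pis] by blast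
      then show ?thesis by blast
    qed
  qed
qed

lemma stage2_unique:
  "stage2 r n u pis Pc ch pisf Pf chf \<Longrightarrow> stage2 r n u pis Pc ch pisf' Pf' chf' \<Longrightarrow>
    pisf' = pisf \<and> Pf' = Pf \<and> chf' = chf"
proof (induction rule: stage2.induct)
  case (s2_done pis Pc ch)
  then show ?case unfolding stage2_iff[of r n u pis] by auto
next
  case (s2_stop pis c Pc ch)
  then show ?case unfolding stage2_iff[of r n u pis] by auto
next
  case (s2_step pis Cs c Pc ch pisf Pf chf)
  then have "stage2 r n u (discard pis Cs) (insert (\<Union>(set Cs)) Pc) (ch \<union> c) pisf' Pf' chf'"
    unfolding stage2_iff[of r n u pis] by auto
  then show ?case using s2_step.IH unfolding discard_def by blast
qed

text \<open>Invariant of Stage 2 relative to the initial families \<open>pis0\<close>. The last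
  clause is the one that Stage 3 relies on: a coalition that was read against a leftover clique
  contains a clique in conflict with it.\<close>

definition matched :: "util \<Rightarrow> (nat \<Rightarrow> nat set set) \<Rightarrow> (nat \<Rightarrow> nat set set) \<Rightarrow> nat set set \<Rightarrow>
    (nat \<times> nat) set \<Rightarrow> bool" where
  "matched u pis0 pis Pc ch \<longleftrightarrow>
    family pis \<and> (\<forall>k. pis k \<subseteq> pis0 k) \<and> (\<forall>k\<in>{1..20}. card (pis k) + card Pc = card (pis0 k)) \<and>
    finite Pc \<and> disjoint Pc \<and>
    (\<forall>P\<in>Pc. (\<forall>k\<in>{1..20}. card (P \<inter> part r n k) = s) \<and>
       (\<forall>a\<in>P. (real s - 1) / 2 - real s / 4 \<le> uset u a P)) \<and>
    \<Union>Pc \<inter> agents pis = {} \<and> \<Union>Pc \<union> agents pis = agents pis0 \<and>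
    (\<forall>P\<in>Pc. \<forall>C\<in>members pis. \<forall>x\<in>C. \<not> no_check ch x P \<longrightarrow>
       (\<exists>D\<in>members pis0. D \<subseteq> P \<and> conflict u D C))"

lemma matched_init: "family pis \<Longrightarrow> matched u pis pis {} {}"
  unfolding matched_def by auto

text \<open>A round reads only pairs among cliques that are not yet merged, and these are disjoint
  from all finished coalitions.\<close>

lemma matched_stop:
  assumes "matched u pis0 pis Pc ch" "round2 r n u pis 20 {} = (res, c)"
  shows "matched u pis0 pis Pc (ch \<union> c)"
proof -
  have "c \<subseteq> agents pis \<times> agents pis"
    using round2_checks[OF _ _ assms(2)] assms(1) by (auto simp: matched_def)
  moreover have "\<Union>Pc \<inter> agents pis = {}" using assms(1) by (simp add: matched_def)
  ultimately have "no_check c x P" if "P \<in> Pc" for x P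
    using that unfolding no_check_def by blast
  then have "no_check (ch \<union> c) x P \<longleftrightarrow> no_check ch x P" if "P \<in> Pc" for x P
    using that by (simp add: no_check_Un)
  then show ?thesis using assms(1) unfolding matched_def by simp
qed

text \<open>Read pairs are oriented, with the first component in the coalition under construction.
  While rounds succeed that coalition gets finished, whence the side invariant
  \<open>ch \<subseteq> \<Union>Pc \<times> UNIV\<close>. A final failed round may violate it and is
  handled by \<open>matched_stop\<close>.\<close>

lemma matched_step:
  assumes m: "matched u pis0 pis Pc ch" and sub: "ch \<subseteq> \<Union>Pc \<times> UNIV"
    and cl: "\<forall>C\<in>members pis0. clique u C"
    and round: "round2 r n u pis 20 {} = (Some Cs, c)"
  shows "matched u pis0 (discard pis Cs) (insert (\<Union>(set Cs)) Pc) (ch \<union> c)"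
    "ch \<union> c \<subseteq> \<Union>(insert (\<Union>(set Cs)) Pc) \<times> UNIV"
proof -
  let ?P = "\<Union>(set Cs)"
  have fam: "family pis" and pk: "\<And>k. pis k \<subseteq> pis0 k"
    and cards: "\<And>k. k \<in> {1..20} \<Longrightarrow> card (pis k) + card Pc = card (pis0 k)"
    and finPc: "finite Pc" and dPc: "disjoint Pc"
    and disj: "\<Union>Pc \<inter> agents pis = {}" and un: "\<Union>Pc \<union> agents pis = agents pis0"
    using m by (auto simp: matched_def)
  note rs = round_SomeD[OF fam round] and d = discard_props[OF fam round]
  have mem: "members pis \<subseteq> members pis0" using pk by (auto simp: members_def)
  have Psub: "?P \<subseteq> agents pis" using rs(3) by (auto simp: agents_def)
  have cardP: "card (?P \<inter> part r n k) = s" if "k \<in> {1..20}" for k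
    using rs(2,5)[OF that] family_member[OF fam that] by simp
  have Pne: "?P \<noteq> {}"
  proof
    assume "?P = {}"
    then have "?P \<inter> part r n 1 = {}" by blast
    then show False using cardP[of 1] spar_pos by simp
  qed
  have PPc: "?P \<inter> \<Union>Pc = {}" using Psub disj by blast
  then have Pnotin: "?P \<notin> Pc" using Pne by blast
  show chsub: "ch \<union> c \<subseteq> \<Union>(insert ?P Pc) \<times> UNIV" using sub rs(6) by auto
  have blocked: "\<exists>D\<in>members pis0. D \<subseteq> P \<and> conflict u D C"
    if P: "P \<in> insert ?P Pc" and C: "C \<in> members (discard pis Cs)" "x \<in> C"
      and nc: "\<not> no_check (ch \<union> c) x P" for P C x
  proof -
    have C': "C \<in> members pis" "C \<notin> set Cs" using C d(4) by auto
    have xa: "x \<in> agents pis" "x \<notin> ?P" using C d(5) by (auto simp: agents_def)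
    obtain y where y: "y \<in> P" "(x, y) \<in> ch \<union> c \<or> (y, x) \<in> ch \<union> c"
      using nc by (auto simp: no_check_def)
    have xch: "(x, y) \<notin> ch" using sub xa disj by auto
    have xc: "(x, y) \<notin> c" using rs(6) xa by auto
    show ?thesis
    proof (cases "P \<in> Pc")
      case True
      then have "y \<notin> agents pis" using y disj by auto
      then have "(y, x) \<notin> c" using rs(6) Psub by auto
      then have "\<not> no_check ch x P" using y xch xc by (auto simp: no_check_def)
      then show ?thesis using m True C'(1) C(2) unfolding matched_def by blast
    next
      case False
      then have P: "P = ?P" using P by simp
      then have "y \<in> agents pis" using y Psub by auto
      then have "(y, x) \<notin> ch" using sub disj by auto
      then have "(y, x) \<in> c" using y xch xc by blast
      then obtain D where D: "D \<in> members pis" "x \<in> D" "D \<in> set Cs \<or> (\<exists>D'\<in>set Cs. conflict u D' D)"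
        using rs(7) by blast
      have "D = C" using members_unique[OF fam D(1) C'(1) D(2) C(2)] .
      then obtain D' where "D' \<in> set Cs" "conflict u D' C" using D C' by blast
      then show ?thesis using rs(3) mem P by blast
    qed
  qed
  have IR: "\<forall>a\<in>?P. (real s - 1) / 2 - real s / 4 \<le> uset u a ?P"
    using rs(8) cl mem by blast
  show "matched u pis0 (discard pis Cs) (insert ?P Pc) (ch \<union> c)"
    unfolding matched_def
  proof (intro conjI)
    show "family (discard pis Cs)" by (rule d(1))
    show "\<forall>k. discard pis Cs k \<subseteq> pis0 k" using d(3) pk by blast
    show "\<forall>k\<in>{1..20}. card (discard pis Cs k) + card (insert ?P Pc) = card (pis0 k)"
    proof
      fix k :: nat assume "k \<in> {1..20}"
      then show "card (discard pis Cs k) + card (insert ?P Pc) = card (pis0 k)"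
        using d(2)[of k] cards[of k] Pnotin finPc by simp
    qed
    show "finite (insert ?P Pc)" using finPc by simp
    show "disjoint (insert ?P Pc)"
    proof (rule disjointI)
      fix A B assume AB: "A \<in> insert ?P Pc" "B \<in> insert ?P Pc" "A \<noteq> B"
      have q: "?P \<inter> Q = {}" if "Q \<in> Pc" for Q using PPc that by blast
      consider "A = ?P" "B \<in> Pc" | "B = ?P" "A \<in> Pc" | "A \<in> Pc" "B \<in> Pc" using AB by blast
      then show "A \<inter> B = {}"
      proof cases
        case 1
        show ?thesis unfolding 1(1) by (rule q[OF 1(2)])
      next
        case 2
        show ?thesis unfolding 2(1) Int_commute[of A] by (rule q[OF 2(2)])
      next
        case 3
        then show ?thesis using disjointD[OF dPc _ _ AB(3)] by blast
      qed
    qed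
    show "\<forall>P\<in>insert ?P Pc. (\<forall>k\<in>{1..20}. card (P \<inter> part r n k) = s) \<and>
       (\<forall>a\<in>P. (real s - 1) / 2 - real s / 4 \<le> uset u a P)"
    proof
      fix P assume "P \<in> insert ?P Pc"
      then consider "P = ?P" | "P \<in> Pc" by blast
      then show "(\<forall>k\<in>{1..20}. card (P \<inter> part r n k) = s) \<and>
        (\<forall>a\<in>P. (real s - 1) / 2 - real s / 4 \<le> uset u a P)"
      proof cases
        case 1
        show ?thesis unfolding 1 using IR cardP by blast
      next
        case 2
        then show ?thesis using m by (simp add: matched_def)
      qed
    qed
    show "\<Union>(insert ?P Pc) \<inter> agents (discard pis Cs) = {}" using disj d(5) by auto
    show "\<Union>(insert ?P Pc) \<union> agents (discard pis Cs) = agents pis0"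
      using un d(5) Psub by auto
    show "\<forall>P\<in>insert ?P Pc. \<forall>C\<in>members (discard pis Cs). \<forall>x\<in>C. \<not> no_check (ch \<union> c) x P \<longrightarrow>
       (\<exists>D\<in>members pis0. D \<subseteq> P \<and> conflict u D C)"
      using blocked by blast
  qed
qed

lemma stage2_matched:
  "stage2 r n u pis Pc ch pisf Pf chf \<Longrightarrow> matched u pis0 pis Pc ch \<Longrightarrow> ch \<subseteq> \<Union>Pc \<times> UNIV \<Longrightarrow>
    \<forall>C\<in>members pis0. clique u C \<Longrightarrow> matched u pis0 pisf Pf chf"
proof (induction rule: stage2.induct)
  case (s2_stop pis c Pc ch)
  then show ?case by (intro matched_stop)
next
  case (s2_step pis Cs c Pc ch pisf Pf chf)
  note ms = matched_step[OF s2_step.prems s2_step.hyps(2)]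
  show ?case
    by (rule s2_step.IH) (use ms s2_step.prems in \<open>simp_all only: discard_def\<close>)
qed

text \<open>Placement succeeds under every selection rule: it removes one agent and at most one
  acceptable coalition from the list of each other agent, so the counting hypothesis persists. A
  coalition is extended once only, and the surplus 1 of its members pays for an extra agent valued
  at -1 or more.\<close>

lemma stage3_success:
  assumes "finite X" "finite F" "\<forall>x\<in>X. card X \<le> card {C \<in> F. 0 < uset u x C \<and> no_check ch x C}"
    and "disjoint (F \<union> D)" "\<Union>(F \<union> D) \<inter> X = {}" "{} \<notin> F \<union> D" "\<forall>C\<in>F. finite C"
    and "\<forall>C\<in>F. \<forall>a\<in>C. 1 \<le> uset u a C" "individually_rational u D"
    and "\<forall>C\<in>F. \<forall>a\<in>C. \<forall>x\<in>X. -1 \<le> u a x" "F \<inter> D = {}"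
  shows "\<exists>P. stage3 r n u ch F D X (Some P) \<and> partition_on (\<Union>(F \<union> D) \<union> X) P \<and> individually_rational u P"
  using assms
proof (induction X arbitrary: F D rule: finite_psubset_induct)
  case (psubset X)
  show ?case
  proof (cases "X = {}")
    case True
    have "individually_rational u (F \<union> D)"
      using psubset.prems(7,8) unfolding individually_rational_def by fastforce
    moreover have "partition_on (\<Union>(F \<union> D) \<union> X) (F \<union> D)"
      using psubset.prems True by (auto simp: partition_on_def)
    ultimately show ?thesis using s3_done True by blast
  next
    case False
    define x where "x = selx r n F D X"
    define cs where "cs = {C \<in> F. 0 < uset u x C \<and> no_check ch x C}"
    define C where "C = selc r n x F D X cs"
    have x: "x \<in> X" unfolding x_def using psubset.hyps False by (rule selx_in)
    have "0 < card X" using False psubset.hyps by auto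
    moreover have "card X \<le> card cs" using psubset.prems(2) x by (simp add: cs_def)
    ultimately have "cs \<noteq> {}" by auto
    moreover have "finite cs" using psubset.prems(1) by (simp add: cs_def)
    ultimately have "C \<in> cs" unfolding C_def by (intro selc_in)
    then have C: "C \<in> F" "0 < uset u x C" by (auto simp: cs_def)
    have xC: "x \<notin> C" using psubset.prems(4) x C by auto
    have fC: "finite C" using psubset.prems(6) C by blast
    let ?F = "F - {C}" and ?D = "insert (insert x C) D" and ?X = "X - {x}"
    have CD: "C \<inter> B = {}" if "B \<in> F \<union> D" "B \<noteq> C" for B
      using psubset.prems(3) C(1) that unfolding disjoint_def by blast
    have CnD: "C \<notin> F - {C}" by simp
    have union: "\<Union>(?F \<union> ?D) \<union> ?X = \<Union>(F \<union> D) \<union> X" using C(1) x by auto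
    have "\<exists>P. stage3 r n u ch ?F ?D ?X (Some P) \<and> partition_on (\<Union>(?F \<union> ?D) \<union> ?X) P \<and>
        individually_rational u P"
    proof (rule psubset.IH)
      show "?X \<subset> X" using x by blast
      show "finite ?F" using psubset.prems(1) by simp
      show "\<forall>y\<in>?X. card ?X \<le> card {C \<in> ?F. 0 < uset u y C \<and> no_check ch y C}"
      proof
        fix y assume "y \<in> ?X"
        then have "card X \<le> card {C \<in> F. 0 < uset u y C \<and> no_check ch y C}"
          using psubset.prems(2) by blast
        moreover have "{B \<in> ?F. 0 < uset u y B \<and> no_check ch y B}
            = {B \<in> F. 0 < uset u y B \<and> no_check ch y B} - {C}" by auto
        moreover have "card {B \<in> F. 0 < uset u y B \<and> no_check ch y B} - 1
            \<le> card ({B \<in> F. 0 < uset u y B \<and> no_check ch y B} - {C})"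
          using diff_card_le_card_Diff[of "{C}" "{B \<in> F. 0 < uset u y B \<and> no_check ch y B}"] by simp
        ultimately show "card ?X \<le> card {B \<in> ?F. 0 < uset u y B \<and> no_check ch y B}"
          using x by simp
      qed
      show "disjoint (?F \<union> ?D)"
      proof -
        have "insert x C \<inter> B = {}" if "B \<in> ?F \<union> D" "B \<noteq> insert x C" for B
        proof -
          have "B \<noteq> C" using that(1) C(1) psubset.prems(10) by blast
          then show ?thesis using CD[of B] that psubset.prems(4) x by blast
        qed
        note new = this
        show ?thesis
        proof (rule disjointI)
          fix A B assume AB: "A \<in> ?F \<union> ?D" "B \<in> ?F \<union> ?D" "A \<noteq> B"
          consider "A = insert x C" "B \<in> ?F \<union> D" | "B = insert x C" "A \<in> ?F \<union> D"
            | "A \<in> F \<union> D" "B \<in> F \<union> D"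
            using AB by blast
          then show "A \<inter> B = {}"
          proof cases
            case 1
            then show ?thesis using new[of B] AB(3) by simp
          next
            case 2
            then show ?thesis using new[of A] AB(3) by (simp add: Int_commute)
          next
            case 3
            then show ?thesis using disjointD[OF psubset.prems(3) _ _ AB(3)] by blast
          qed
        qed
      qed
      show "\<Union>(?F \<union> ?D) \<inter> ?X = {}" using psubset.prems(4) C(1) by auto
      show "{} \<notin> ?F \<union> ?D" using psubset.prems(5) by auto
      show "\<forall>C\<in>?F. finite C" using psubset.prems(6) by blast
      show "\<forall>C\<in>?F. \<forall>a\<in>C. 1 \<le> uset u a C" using psubset.prems(7) by blast
      show "individually_rational u ?D"
      proof -
        have "0 \<le> uset u a (insert x C)" if "a \<in> insert x C" for a
        proof (cases "a = x")
          case True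
          then show ?thesis using C(2) xC by (simp add: uset_def)
        next
          case False
          then have a: "a \<in> C" using that by blast
          have "uset u a (C \<union> {x}) = uset u a C + uset u a {x}"
            using fC xC by (intro uset_Un) auto
          moreover have "1 \<le> uset u a C" "-1 \<le> u a x"
            using psubset.prems(7,9) a C(1) x by blast+
          ultimately show ?thesis using False by (simp add: uset_def)
        qed
        then show ?thesis using psubset.prems(8) unfolding individually_rational_def by blast
      qed
      show "\<forall>C\<in>?F. \<forall>a\<in>C. \<forall>x\<in>?X. -1 \<le> u a x" using psubset.prems(9) by blast
      show "?F \<inter> ?D = {}" using psubset.prems(4,10) x by blast
    qed
    then obtain P where P: "stage3 r n u ch ?F ?D ?X (Some P)"
      "partition_on (\<Union>(F \<union> D) \<union> X) P" "individually_rational u P"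
      unfolding union by blast
    have "stage3 r n u ch F D X (Some P)"
      by (rule s3_step[OF False x_def cs_def \<open>cs \<noteq> {}\<close> C_def P(1)])
    then show ?thesis using P by blast
  qed
qed

section \<open>Coordinates read by the algorithm\<close>

lemma ev_compatible:
  assumes "finite M" "finite C" "M \<times> C \<union> C \<times> M \<subseteq> J"
  shows "ev J (\<lambda>f. compatible (curry f) n k M C)"
  unfolding compatible_def using assms by (intro ev_ball ev_conj ev_uset_ge) auto

text \<open>A recorded pair \<open>(a, b)\<close> stands for reading both \<open>u a b\<close> and
  \<open>u b a\<close>, hence the converse of \<open>c\<close>. As \<open>c\<close> is part of the
  outcome, the event is decided by what was actually read, although later reads depend on earlier
  ones.\<close>

lemma ev_scan:
  assumes "finite M"
  shows "\<forall>C\<in>set Cs. finite C \<Longrightarrow> ev (c \<union> c\<inverse>) (\<lambda>f. scan (curry f) n k M Cs = (res, c))"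
proof (induction Cs arbitrary: c)
  case Nil
  then show ?case by simp
next
  case (Cons C Cs)
  let ?J = "c \<union> c\<inverse>" and ?comp = "\<lambda>f. compatible (curry f) n k M C"
  have fin: "finite (M \<times> \<Union>(set Cs))" using assms Cons.prems by auto
  have ev: "ev ?J ?comp" if "M \<times> C \<subseteq> c"
    using that assms Cons.prems by (intro ev_compatible) auto
  have "ev ?J (\<lambda>f. (M \<times> C = c \<and> res = Some C) \<and> ?comp f \<or>
      (\<exists>c'\<in>Pow (M \<times> \<Union>(set Cs)). M \<times> C \<union> c' = c \<and> (\<not> ?comp f \<and> scan (curry f) n k M Cs = (res, c'))))"
    using fin Cons.prems
    by (intro ev_disj ev_bex ev_conj_const ev_conj ev_not ev ev_mono[OF Cons.IH]) auto
  then show ?case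
  proof (rule ev_cong)
    fix f :: "nat \<times> nat \<Rightarrow> real"
    have "c' \<in> Pow (M \<times> \<Union>(set Cs))" if "scan (curry f) n k M Cs = (res, c')" for c'
    proof (cases res)
      case None
      then show ?thesis using scan_NoneD[of "curry f" n k M Cs c'] that by auto
    next
      case (Some C)
      then show ?thesis using scan_SomeD[of "curry f" n k M Cs C c'] that by auto
    qed
    then show "scan (curry f) n k M (C # Cs) = (res, c) \<longleftrightarrow>
      (M \<times> C = c \<and> res = Some C) \<and> ?comp f \<or>
      (\<exists>c'\<in>Pow (M \<times> \<Union>(set Cs)). M \<times> C \<union> c' = c \<and> (\<not> ?comp f \<and> scan (curry f) n k M Cs = (res, c')))"
      by (cases "?comp f"; cases "scan (curry f) n k M Cs") auto
  qed
qed

lemma ev_round2: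
  assumes fam: "family pis"
  shows "j \<le> 20 \<Longrightarrow> finite M \<Longrightarrow> ev (c \<union> c\<inverse>) (\<lambda>f. round2 r n (curry f) pis j M = (res, c))"
proof (induction j arbitrary: M res c)
  case 0
  then show ?case by simp
next
  case (Suc j)
  let ?k = "20 - j" and ?J = "c \<union> c\<inverse>" and ?A = "agents pis"
  let ?scan = "\<lambda>f. scan (curry f) n ?k M (ord2 r n ?k M (pis ?k))"
  \<comment> \<open>\<open>tl\<close> recovers the result of the remaining steps from
    \<open>res\<close>, so no quantifier over that result is needed; for \<open>None\<close> both
    are \<open>None\<close>.\<close>
  let ?res = "map_option tl res"
  have k: "?k \<in> {1..20}" using Suc.prems by auto
  have o: "set (ord2 r n ?k M (pis ?k)) = pis ?k"
    using family_finite[OF fam k] by (rule set_ord2)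
  have fC: "finite C" if "C \<in> pis ?k" for C using family_finite_member[OF fam k that] .
  have fA: "finite ?A" using agents_subset[OF fam] by (rule finite_subset) simp
  have ev_s: "ev ?J (\<lambda>f. ?scan f = (x, c1))" if "c1 \<subseteq> c" for x c1
  proof (rule ev_mono[OF ev_scan])
    show "finite M" by (rule Suc.prems)
    show "\<forall>C\<in>set (ord2 r n ?k M (pis ?k)). finite C" using fC o by simp
  qed (use that in auto)
  have "ev ?J (\<lambda>f. res = None \<and> ?scan f = (None, c) \<or>
      (\<exists>C\<in>pis ?k. \<exists>c1\<in>Pow (M \<times> ?A). \<exists>c2\<in>Pow ((M \<union> C \<union> ?A) \<times> ?A).
         (c = c1 \<union> c2 \<and> res = map_option (Cons C) ?res) \<and>
         (?scan f = (Some C, c1) \<and> round2 r n (curry f) pis j (M \<union> C) = (?res, c2))))"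
    using Suc.prems fA fC family_finite[OF fam k]
    by (intro ev_disj ev_bex ev_conj_const ev_conj ev_s ev_mono[OF Suc.IH]) auto
  then show ?case
  proof (rule ev_cong)
    fix f :: "nat \<times> nat \<Rightarrow> real"
    show "round2 r n (curry f) pis (Suc j) M = (res, c) \<longleftrightarrow> res = None \<and> ?scan f = (None, c) \<or>
      (\<exists>C\<in>pis ?k. \<exists>c1\<in>Pow (M \<times> ?A). \<exists>c2\<in>Pow ((M \<union> C \<union> ?A) \<times> ?A).
         (c = c1 \<union> c2 \<and> res = map_option (Cons C) ?res) \<and>
         (?scan f = (Some C, c1) \<and> round2 r n (curry f) pis j (M \<union> C) = (?res, c2)))" (is "?l \<longleftrightarrow> ?r")
    proof
      assume ?l
      then show ?r
      proof (cases rule: round2_SucE)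
        case stop
        obtain c' where c': "?scan f = (None, c')" "c = c'"
          using \<open>?l\<close> stop by (auto simp: Let_def)
        then show ?thesis using stop(2) by blast
      next
        case (step C c1 res' c2)
        note sc = scan_SomeD[OF step(1), unfolded o]
        have "\<Union>(pis ?k) \<subseteq> ?A" using k unfolding agents_def members_def by blast
        then have "c1 \<in> Pow (M \<times> ?A)" using sc by (meson PowI Sigma_mono order_refl subset_trans)
        moreover have "c2 \<in> Pow ((M \<union> C \<union> ?A) \<times> ?A)"
          using round2_checks[OF fam _ step(2)] Suc.prems by simp
        moreover have "res' = ?res" "res = map_option (Cons C) ?res"
          using step(3) by (simp_all add: option.map_comp comp_def option.map_ident)
        ultimately show ?thesis using sc step by blast
      qed
    next
      assume ?r
      then show ?l by (auto simp: Let_def)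
    qed
  qed
qed

lemma ev_stage2:
  "family pis \<Longrightarrow> ev (chf \<union> chf\<inverse>) (\<lambda>f. stage2 r n (curry f) pis Pc ch pisf Pf chf)"
proof (induction "card (pis 1)" arbitrary: pis Pc ch rule: less_induct)
  case less
  let ?J = "chf \<union> chf\<inverse>" and ?A = "agents pis"
  let ?round = "\<lambda>f. round2 r n (curry f) pis 20 {}"
  let ?W = "{Cs. set Cs \<subseteq> members pis \<and> length Cs = 20}"
  have fA: "finite ?A" using agents_subset[OF less.prems] by (rule finite_subset) simp
  have fW: "finite ?W" using finite_members[OF less.prems] by (rule finite_lists_length_eq)
  have ev_r: "ev ?J (\<lambda>f. ?round f = (x, c))" if "c \<subseteq> chf" for x c
    by (rule ev_mono[OF ev_round2[OF less.prems]]) (use that in auto)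
  let ?next = "\<lambda>f Cs c. stage2 r n (curry f) (discard pis Cs) (insert (\<Union>(set Cs)) Pc) (ch \<union> c) pisf Pf chf"
  have ev_n: "ev ?J (\<lambda>f. ?round f = (Some Cs, c) \<and> ?next f Cs c)" if "c \<subseteq> chf" for Cs c
  \<comment> \<open>The induction hypothesis needs facts about \<open>discard pis Cs\<close> that
    are known only when some utilities produce this round; if none do, the event is empty.\<close>
  proof (cases "\<exists>u. round2 r n u pis 20 {} = (Some Cs, c)")
    case True
    then obtain u where "round2 r n u pis 20 {} = (Some Cs, c)" by blast
    note d = discard_props[OF less.prems this]
    have "card (discard pis Cs 1) < card (pis 1)" using d(2)[of 1] by simp
    then show ?thesis using d(1) that by (intro ev_conj ev_r less.hyps)
  next
    case False
    then show ?thesis by simp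
  qed
  have "ev ?J (\<lambda>f. (pis 1 = {} \<and> pisf = pis \<and> Pf = Pc \<and> chf = ch) \<or>
    (\<exists>c\<in>Pow (?A \<times> ?A). (pis 1 \<noteq> {} \<and> pisf = pis \<and> Pf = Pc \<and> chf = ch \<union> c) \<and> ?round f = (None, c)) \<or>
    (\<exists>Cs\<in>?W. \<exists>c\<in>Pow (?A \<times> ?A). (c \<subseteq> chf \<and> pis 1 \<noteq> {}) \<and> (?round f = (Some Cs, c) \<and> ?next f Cs c)))"
    using fA fW by (intro ev_disj ev_bex ev_conj_const ev_const ev_r ev_n) auto
  then show ?case
  proof (rule ev_cong)
    fix f :: "nat \<times> nat \<Rightarrow> real"
    have c: "c \<in> Pow (?A \<times> ?A)" if "?round f = (res, c)" for res c
      using round2_checks[OF less.prems _ that] by simp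
    have w: "Cs \<in> ?W" if "?round f = (Some Cs, c)" for Cs c
      using round_SomeD[OF less.prems that] by simp
    have mono: "stage2 r n (curry f) pis' Pc' ch' pisf Pf chf \<Longrightarrow> ch' \<subseteq> chf" for pis' Pc' ch'
      by (induction rule: stage2.induct) auto
    show "stage2 r n (curry f) pis Pc ch pisf Pf chf \<longleftrightarrow>
      (pis 1 = {} \<and> pisf = pis \<and> Pf = Pc \<and> chf = ch) \<or>
      (\<exists>c\<in>Pow (?A \<times> ?A). (pis 1 \<noteq> {} \<and> pisf = pis \<and> Pf = Pc \<and> chf = ch \<union> c) \<and> ?round f = (None, c)) \<or>
      (\<exists>Cs\<in>?W. \<exists>c\<in>Pow (?A \<times> ?A). (c \<subseteq> chf \<and> pis 1 \<noteq> {}) \<and> (?round f = (Some Cs, c) \<and> ?next f Cs c))"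
      (is "_ \<longleftrightarrow> ?a \<or> ?b \<or> ?c")
    proof
      assume "stage2 r n (curry f) pis Pc ch pisf Pf chf"
      then consider ?a | c where "pis 1 \<noteq> {}" "?round f = (None, c)" "pisf = pis" "Pf = Pc" "chf = ch \<union> c"
        | Cs c where "pis 1 \<noteq> {}" "?round f = (Some Cs, c)" "?next f Cs c"
        unfolding stage2_iff[of r n "curry f" pis] by blast
      then show "?a \<or> ?b \<or> ?c"
      proof cases
        case 2
        then have ?b using c by blast
        then show ?thesis by blast
      next
        case 3
        then have "c \<subseteq> chf" using mono by blast
        then have ?c using 3 c w by blast
        then show ?thesis by blast
      qed blast
    next
      assume "?a \<or> ?b \<or> ?c"
      then show "stage2 r n (curry f) pis Pc ch pisf Pf chf"
        unfolding stage2_iff[of r n "curry f" pis] by blast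
    qed
  qed
qed

lemma ev_stuck:
  "family pis \<Longrightarrow> ev (agents pis \<times> agents pis - intra) (\<lambda>f. stuck r n (curry f) t pis)"
proof (induction "card (pis 1)" arbitrary: pis rule: less_induct)
  case less
  let ?A = "agents pis" and ?J = "agents pis \<times> agents pis - intra"
  let ?round = "\<lambda>f. round2 r n (curry f) pis 20 {}"
  let ?W = "{Cs. set Cs \<subseteq> members pis \<and> length Cs = 20}"
  have fA: "finite ?A" using agents_subset[OF less.prems] by (rule finite_subset) simp
  have fW: "finite ?W" using finite_members[OF less.prems] by (rule finite_lists_length_eq)
  have ev_r: "ev ?J (\<lambda>f. ?round f = (x, c))" if "c \<subseteq> ?J" for x c
    by (rule ev_mono[OF ev_round2[OF less.prems]]) (use that in \<open>auto simp: intra_def\<close>)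
  have ev_n: "ev ?J (\<lambda>f. ?round f = (Some Cs, c) \<and> stuck r n (curry f) t (discard pis Cs))"
    if "c \<subseteq> ?J" for Cs c
  proof (cases "\<exists>u. round2 r n u pis 20 {} = (Some Cs, c)")
    case True
    then obtain u where "round2 r n u pis 20 {} = (Some Cs, c)" by blast
    note d = discard_props[OF less.prems this]
    have "card (discard pis Cs 1) < card (pis 1)" using d(2)[of 1] by simp
    then show ?thesis
      using d(1,5) that by (intro ev_conj ev_r ev_mono[OF less.hyps]) auto
  next
    case False
    then show ?thesis by simp
  qed
  have "ev ?J (\<lambda>f. (\<exists>c\<in>Pow ?J. (pis 1 \<noteq> {} \<and> (\<forall>k\<in>{1..20}. t \<le> card (pis k))) \<and> ?round f = (None, c)) \<or>
    (\<exists>Cs\<in>?W. \<exists>c\<in>Pow ?J. pis 1 \<noteq> {} \<and> (?round f = (Some Cs, c) \<and> stuck r n (curry f) t (discard pis Cs))))"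
    using fA fW by (intro ev_disj ev_bex ev_conj_const ev_r ev_n) auto
  then show ?case
  proof (rule ev_cong)
    fix f :: "nat \<times> nat \<Rightarrow> real"
    have c: "c \<in> Pow ?J" if "?round f = (res, c)" for res c
      using round_checks[OF less.prems that] by blast
    have w: "Cs \<in> ?W" if "?round f = (Some Cs, c)" for Cs c
      using round_SomeD[OF less.prems that] by simp
    show "stuck r n (curry f) t pis \<longleftrightarrow>
      (\<exists>c\<in>Pow ?J. (pis 1 \<noteq> {} \<and> (\<forall>k\<in>{1..20}. t \<le> card (pis k))) \<and> ?round f = (None, c)) \<or>
      (\<exists>Cs\<in>?W. \<exists>c\<in>Pow ?J. pis 1 \<noteq> {} \<and> (?round f = (Some Cs, c) \<and> stuck r n (curry f) t (discard pis Cs)))"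
      (is "_ \<longleftrightarrow> ?b \<or> ?c")
    proof
      assume "stuck r n (curry f) t pis"
      then show "?b \<or> ?c"
      proof (cases rule: stuck.cases)
        case (stuck_now c)
        then have ?b using c by blast
        then show ?thesis by blast
      next
        case (stuck_later Cs c)
        then have ?c using c w by blast
        then show ?thesis by blast
      qed
    next
      assume "?b \<or> ?c"
      then show "stuck r n (curry f) t pis"
        using stuck.intros[of pis r n "curry f"] by blast
    qed
  qed
qed

lemma ev_stage3:
  "finite X \<Longrightarrow> finite F \<Longrightarrow> ev UNIV (\<lambda>f. stage3 r n (curry f) ch F D X res)"
proof (induction X arbitrary: F D rule: finite_psubset_induct)
  case (psubset X)
  show ?case
  proof (cases "X = {}")
    case True
    then show ?thesis by (subst stage3_iff) simp
  next
    case False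
    let ?x = "selx r n F D X"
    let ?P = "\<lambda>f C. no_check ch ?x C \<and> 0 < uset (curry f) ?x C"
    let ?next = "\<lambda>f cs. let C = selc r n ?x F D X cs in
      stage3 r n (curry f) ch (F - {C}) (insert (insert ?x C) D) (X - {?x}) res"
    have x: "?x \<in> X" using selx_in psubset.hyps False by blast
    have ev_n: "ev UNIV (\<lambda>f. ?next f cs)" for cs
      unfolding Let_def using x psubset.prems by (intro psubset.IH) auto
    have "ev UNIV (\<lambda>f. \<exists>cs\<in>Pow F. (\<forall>C\<in>F. C \<in> cs \<longleftrightarrow> ?P f C) \<and>
        ((cs = {} \<and> res = None) \<or> (cs \<noteq> {} \<and> ?next f cs)))"
      using psubset.prems
      by (intro ev_bex ev_conj ev_ball ev_iff_const ev_conj_const ev_uset_gt ev_disj ev_n) auto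
    then show ?thesis
    proof (rule ev_cong)
      fix f :: "nat \<times> nat \<Rightarrow> real"
      let ?cs = "{C \<in> F. 0 < uset (curry f) ?x C \<and> no_check ch ?x C}"
      have eq: "cs = ?cs" if "cs \<in> Pow F" "\<forall>C\<in>F. C \<in> cs \<longleftrightarrow> ?P f C" for cs
        using that by blast
      have "stage3 r n (curry f) ch F D X res \<longleftrightarrow> (?cs = {} \<and> res = None) \<or> (?cs \<noteq> {} \<and> ?next f ?cs)"
        using False unfolding stage3_iff[of r n "curry f" ch F D X] Let_def
        by (simp only: if_False split: if_split) blast
      also have "\<dots> \<longleftrightarrow> (\<exists>cs\<in>Pow F. (\<forall>C\<in>F. C \<in> cs \<longleftrightarrow> ?P f C) \<and>
        ((cs = {} \<and> res = None) \<or> (cs \<noteq> {} \<and> ?next f cs)))"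
      proof
        assume "(?cs = {} \<and> res = None) \<or> (?cs \<noteq> {} \<and> ?next f ?cs)"
        moreover have "?cs \<in> Pow F" "\<forall>C\<in>F. C \<in> ?cs \<longleftrightarrow> ?P f C" by auto
        ultimately show "\<exists>cs\<in>Pow F. (\<forall>C\<in>F. C \<in> cs \<longleftrightarrow> ?P f C) \<and>
          ((cs = {} \<and> res = None) \<or> (cs \<noteq> {} \<and> ?next f cs))" by blast
      next
        assume "\<exists>cs\<in>Pow F. (\<forall>C\<in>F. C \<in> cs \<longleftrightarrow> ?P f C) \<and>
          ((cs = {} \<and> res = None) \<or> (cs \<noteq> {} \<and> ?next f cs))"
        then obtain cs where "cs \<in> Pow F" "\<forall>C\<in>F. C \<in> cs \<longleftrightarrow> ?P f C"
          "(cs = {} \<and> res = None) \<or> (cs \<noteq> {} \<and> ?next f cs)" by blast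
        then show "(?cs = {} \<and> res = None) \<or> (?cs \<noteq> {} \<and> ?next f ?cs)"
          using eq[of cs] by (simp only:)
      qed
      finally show "stage3 r n (curry f) ch F D X res \<longleftrightarrow> (\<exists>cs\<in>Pow F. (\<forall>C\<in>F. C \<in> cs \<longleftrightarrow> ?P f C) \<and>
        ((cs = {} \<and> res = None) \<or> (cs \<noteq> {} \<and> ?next f cs)))" .
    qed
  qed
qed

section \<open>Failure probabilities of Stages 1 and 2\<close>

text \<open>Both utilities of a pair must be at least 1/2, each with probability 1/4. This is the
  origin of the base 16 in \<open>spar\<close>.\<close>

lemma prob_attached:
  assumes C: "finite C" "x \<notin> C" "insert x C \<subseteq> {0..<n}"
  shows "\<P>(f in G. \<forall>z\<in>C. 1/2 \<le> f (x, z) \<and> 1/2 \<le> f (z, x)) = (1/16) ^ card C"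
proof -
  have ev: "ev {j} (\<lambda>f. 1/2 \<le> f j)" for j :: "nat \<times> nat"
    using ev_coord[of "{1/2..}" j "{j}"] by simp
  have "\<P>(f in G. \<forall>z\<in>C. 1/2 \<le> f (x, z) \<and> 1/2 \<le> f (z, x))
    = (\<Prod>z\<in>C. \<P>(f in G. 1/2 \<le> f (x, z) \<and> 1/2 \<le> f (z, x)))"
    using C by (intro prob_ball_indep[of _ "\<lambda>z. {(x, z), (z, x)}"] ev_conj ev_mono[OF ev])
      (auto simp: disjoint_family_on_def)
  also have "\<dots> = (\<Prod>z\<in>C. 1/16)"
  proof (intro prod.cong refl)
    fix z assume z: "z \<in> C"
    then have "(x, z) \<in> offdiag n" "(z, x) \<in> offdiag n" "(x, z) \<noteq> (z, x)"
      using C by (auto simp: offdiag_def)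
    then have "\<P>(f in G. 1/2 \<le> f (x, z) \<and> 1/2 \<le> f (z, x)) = 1/4 * (1/4)"
      using prob_indep[OF ev[of "(x, z)"] ev[of "(z, x)"]] by (simp only: prob_ge_half) blast
    then show "\<P>(f in G. 1/2 \<le> f (x, z) \<and> 1/2 \<le> f (z, x)) = 1/16" by simp
  qed
  finally show ?thesis by simp
qed

text \<open>A union bound: at most \<open>n ^ (s - 1)\<close> candidates for the final short clique,
  and at least \<open>m - s\<close> outside agents each of which fails to attach to it.\<close>

definition short_bound :: "nat \<Rightarrow> real" where
  "short_bound m = real n ^ (s - 1) * (1 - (1/16) ^ (s - 1)) ^ (m - s)"

lemma short_bound_nonneg: "0 \<le> short_bound m"
  unfolding short_bound_def by (intro mult_nonneg_nonneg zero_le_power) (auto simp: power_le_one)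

text \<open>To a short final clique no other agent of \<open>R\<close> attaches. That clique depends
  on the utilities, so all sets of fewer than \<open>s\<close> agents are tried; for a fixed set the
  outside agents involve disjoint pairs and are independent.\<close>

lemma prob_grown_short:
  assumes R: "R \<subseteq> {0..<n}" "R \<noteq> {}" "m \<le> card R"
  shows "\<P>(f in G. \<exists>C\<in>Pow R. grown (curry f) i p R C \<and> card C < s) \<le> short_bound m"
proof -
  have fR: "finite R" using R(1) by (rule finite_subset) simp
  let ?T = "{l. set l \<subseteq> R \<and> length l = s - 1}"
  let ?A = "\<lambda>x C f. \<forall>z\<in>C. 1/2 \<le> f (x, z) \<and> 1/2 \<le> f (z, x :: nat)"
  let ?q = "1 - (1/16) ^ (s - 1) :: real"
  have q: "0 \<le> ?q" "?q \<le> 1" by (auto simp: power_le_one)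
  have fT: "finite ?T" using fR by (rule finite_lists_length_eq)
  have ev1: "ev {j} (\<lambda>f. 1/2 \<le> f j)" for j :: "nat \<times> nat"
    using ev_coord[of "{1/2..}" j "{j}"] by simp
  have ev: "ev ({x} \<times> C \<union> C \<times> {x}) (?A x C)" if "C \<subseteq> R" for x C
    using finite_subset[OF that fR] by (intro ev_ball ev_conj ev_mono[OF ev1]) auto
  have ev': "ev UNIV (\<lambda>f. \<forall>x\<in>R - set l. \<not> ?A x (set l) f)" if "l \<in> ?T" for l
    using that fR by (intro ev_ball ev_not ev_mono[OF ev]) auto
  have "\<P>(f in G. \<exists>C\<in>Pow R. grown (curry f) i p R C \<and> card C < s)
    \<le> \<P>(f in G. \<exists>l\<in>?T. \<forall>x\<in>R - set l. \<not> ?A x (set l) f)"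
  proof (rule prob_mono_ev)
    show "ev UNIV (\<lambda>f. \<exists>l\<in>?T. \<forall>x\<in>R - set l. \<not> ?A x (set l) f)"
      using fT ev' by (rule ev_bex)
    fix f assume "\<exists>C\<in>Pow R. grown (curry f) i p R C \<and> card C < s"
    then obtain C where C: "grown (curry f) i p R C" "card C < s" by blast
    note gp = grown_props[OF fR R(2) C(1)]
    define v where "v = selv r n i p R"
    obtain l where l: "set l = C" "distinct l"
      using finite_distinct_list[OF finite_subset[OF gp(2) fR]] by blast
    then have len: "length l \<le> s - 1" using C(2) distinct_card[of l] by simp
    \<comment> \<open>Repeating the member \<open>v\<close> turns the clique into a list of length
      exactly \<open>s - 1\<close>, so that one count covers all smaller sizes.\<close>
    let ?l = "l @ replicate (s - 1 - length l) v"
    have sl: "set ?l = C" using l(1) gp(1) by (auto simp: v_def)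
    have "\<forall>x\<in>R - C. \<not> ?A x C f"
    proof
      fix x assume "x \<in> R - C"
      then have "x \<in> R - {v} - C" using gp(1) by (auto simp: v_def)
      then show "\<not> ?A x C f"
        using grow_maximal[OF C(1,2), of x] unfolding v_def curry_conv by blast
    qed
    moreover have "?l \<in> ?T" using sl gp(2) len by simp
    ultimately show "\<exists>l\<in>?T. \<forall>x\<in>R - set l. \<not> ?A x (set l) f"
      unfolding sl[symmetric] by blast
  qed
  also have "\<dots> \<le> card ?T * ?q ^ (m - s)"
  proof (rule prob_bex_le_card[OF fT ev'])
    fix l assume l: "l \<in> ?T"
    let ?C = "set l"
    have C: "?C \<subseteq> R" "finite ?C" "card ?C \<le> s - 1" using l card_length[of l] by auto
    have "\<P>(f in G. \<forall>x\<in>R - ?C. \<not> ?A x ?C f) = (\<Prod>x\<in>R - ?C. \<P>(f in G. \<not> ?A x ?C f))"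
      using fR C by (intro prob_ball_indep[of _ "\<lambda>x. {x} \<times> ?C \<union> ?C \<times> {x}"] ev_not ev)
        (auto simp: disjoint_family_on_def)
    also have "\<dots> = (\<Prod>x\<in>R - ?C. 1 - (1/16) ^ card ?C)"
    proof (intro prod.cong refl)
      fix x assume x: "x \<in> R - ?C"
      then have "\<P>(f in G. ?A x ?C f) = (1/16) ^ card ?C"
        using C R(1) by (intro prob_attached) auto
      then show "\<P>(f in G. \<not> ?A x ?C f) = 1 - (1/16) ^ card ?C"
        using prob_neg[OF ev_sets[OF ev[OF C(1), of x]]] by simp
    qed
    \<comment> \<open>Attaching to a smaller set is likelier, so size \<open>s - 1\<close> is the
      worst case.\<close>
    also have "\<dots> \<le> (\<Prod>x\<in>R - ?C. ?q)"
      using C(3) by (intro prod_mono) (auto simp: power_le_one power_decreasing)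
    also have "\<dots> = ?q ^ card (R - ?C)" by simp
    also have "\<dots> \<le> ?q ^ (m - s)"
    proof (rule power_decreasing[OF _ q])
      have "card R - card ?C \<le> card (R - ?C)" using C(2) by (rule diff_card_le_card_Diff)
      then show "m - s \<le> card (R - ?C)" using C(3) R(3) by linarith
    qed
    finally show "\<P>(f in G. \<forall>x\<in>R - ?C. \<not> ?A x ?C f) \<le> ?q ^ (m - s)" .
  qed
  also have "card ?T = card R ^ (s - 1)" using fR by (rule card_lists_length_eq)
  also have "real (card R ^ (s - 1)) * ?q ^ (m - s) \<le> real n ^ (s - 1) * ?q ^ (m - s)"
  proof (rule mult_right_mono)
    have "card R \<le> n" using card_mono[OF _ R(1)] by simp
    then show "real (card R ^ (s - 1)) \<le> real n ^ (s - 1)" by (simp add: power_mono)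
  qed (use q in simp)
  finally show ?thesis unfolding short_bound_def .
qed

text \<open>Confines the possible results to a finite set, which makes the existential in
  \<open>ev_greedy_large\<close> a finite disjunction.\<close>

lemma greedy_range:
  "greedy r n u i p R pf Rf \<Longrightarrow> finite R \<Longrightarrow> pf \<in> (\<lambda>q. p \<union> q) ` Pow (Pow R) \<and> Rf \<subseteq> R"
proof (induction rule: greedy.induct)
  case (greedy_step R v p C pf Rf)
  have "grown u i p R C" using greedy_step.hyps by simp
  note gp = grown_props[OF greedy_step.prems greedy_step.hyps(1) this]
  have "finite (R - C)" using greedy_step.prems by simp
  then obtain q where q: "q \<subseteq> Pow (R - C)" "pf = insert C p \<union> q" "Rf \<subseteq> R - C"
    using greedy_step.IH by blast
  have "insert C q \<in> Pow (Pow R)" using q(1) gp(2) by blast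
  moreover have "pf = p \<union> insert C q" using q(2) by simp
  moreover have "Rf \<subseteq> R" using q(3) by blast
  ultimately show ?case by blast
qed auto

lemma ev_greedy_large:
  assumes "finite R"
  shows "ev (R \<times> R) (\<lambda>f. \<exists>pf Rf. greedy r n (curry f) i p R pf Rf \<and> m \<le> card Rf)"
proof -
  have "ev (R \<times> R) (\<lambda>f. \<exists>pf\<in>(\<lambda>q. p \<union> q) ` Pow (Pow R). \<exists>Rf\<in>Pow R.
    m \<le> card Rf \<and> greedy r n (curry f) i p R pf Rf)"
    using assms by (intro ev_bex ev_conj_const ev_greedy) auto
  then show ?thesis
  proof (rule ev_cong)
    fix f :: "nat \<times> nat \<Rightarrow> real"
    have "pf \<in> (\<lambda>q. p \<union> q) ` Pow (Pow R) \<and> Rf \<in> Pow R"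
      if "greedy r n (curry f) i p R pf Rf" for pf Rf
      using greedy_range[OF that assms] by (simp only: Pow_iff)
    then show "(\<exists>pf Rf. greedy r n (curry f) i p R pf Rf \<and> m \<le> card Rf) \<longleftrightarrow>
      (\<exists>pf\<in>(\<lambda>q. p \<union> q) ` Pow (Pow R). \<exists>Rf\<in>Pow R. m \<le> card Rf \<and> greedy r n (curry f) i p R pf Rf)"
      by meson
  qed
qed

text \<open>Each clique removes at least one agent, so at most \<open>card R\<close> cliques are
  grown, and each comes out short while \<open>m\<close> agents remain with probability at most
  \<open>short_bound m\<close>. After a clique \<open>C\<close> the pairs within
  \<open>R - C\<close> are unread, so \<open>prob_revealed_le\<close> carries the induction
  hypothesis over.\<close>

lemma prob_greedy_large:
  assumes "0 < m"
  shows "R \<subseteq> {0..<n} \<Longrightarrow>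
    \<P>(f in G. \<exists>pf Rf. greedy r n (curry f) i p R pf Rf \<and> m \<le> card Rf) \<le> card R * short_bound m"
proof (induction "card R" arbitrary: p R rule: less_induct)
  case less
  have fR: "finite R" using less.prems by (rule finite_subset) simp
  let ?B = "\<lambda>p R f. \<exists>pf Rf. greedy r n (curry f) i p R pf Rf \<and> m \<le> card Rf"
  show ?case
  proof (cases "m \<le> card R")
    case False
    have "\<not> ?B p R f" for f
    proof
      assume "?B p R f"
      then obtain pf Rf where g: "greedy r n (curry f) i p R pf Rf" "m \<le> card Rf" by (elim exE conjE)
      have "card Rf \<le> card R" using greedy_range[OF g(1) fR] by (intro card_mono fR) (elim conjE)
      then show False using g(2) False by linarith
    qed
    then have "{f \<in> space G. ?B p R f} = {}" by blast
    then show ?thesis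
      by (simp only: measure_empty) (intro mult_nonneg_nonneg short_bound_nonneg of_nat_0_le_iff)
  next
    case True
    then have R: "R \<noteq> {}" using \<open>0 < m\<close> by auto
    let ?v = "selv r n i p R"
    have v: "?v \<in> R" using selv_in fR R by blast
    let ?W = "{C\<in>Pow R. ?v \<in> C}"
    let ?Q1 = "\<lambda>f. \<exists>C\<in>Pow R. grown (curry f) i p R C \<and> card C < s"
    let ?Q2 = "\<lambda>f. \<exists>C\<in>?W. grown (curry f) i p R C \<and> ?B (insert C p) (R - C) f"
    let ?e = "(real (card R) - 1) * short_bound m"
    have ev_g: "ev (C \<times> R \<union> R \<times> C) (\<lambda>f. grown (curry f) i p R C)" for C
      using fR v by (intro ev_grow) auto
    have ev1: "ev UNIV ?Q1"
      using fR by (intro ev_bex ev_conj ev_mono[OF ev_g]) auto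
    have ev_B: "ev ((R - C) \<times> (R - C)) (?B (insert C p) (R - C))" for C
      using fR by (intro ev_greedy_large) simp
    have ev2: "ev UNIV ?Q2"
      using fR by (intro ev_bex ev_conj ev_mono[OF ev_g] ev_mono[OF ev_B]) auto
    have "\<P>(f in G. ?B p R f) \<le> \<P>(f in G. ?Q1 f \<or> ?Q2 f)"
    proof (rule prob_mono_ev)
      show "ev UNIV (\<lambda>f. ?Q1 f \<or> ?Q2 f)" by (intro ev_disj ev1 ev2)
      fix f assume "?B p R f"
      then obtain pf Rf where B: "greedy r n (curry f) i p R pf Rf" "m \<le> card Rf" by blast
      then obtain C where C: "grown (curry f) i p R C"
        "if card C < s then pf = p \<and> Rf = R else greedy r n (curry f) i (insert C p) (R - C) pf Rf"
        using R unfolding greedy_iff[of r n "curry f" i p R] by (simp only: if_False) blast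
      note gp = grown_props[OF fR R C(1)]
      show "?Q1 f \<or> ?Q2 f"
      proof (cases "card C < s")
        case True
        then show ?thesis using C(1) gp(2) by blast
      next
        case False
        then have "?B (insert C p) (R - C) f" using C(2) B(2) by auto
        then show ?thesis using C(1) gp(1,2) by blast
      qed
    qed
    also have "\<dots> \<le> \<P>(f in G. ?Q1 f) + \<P>(f in G. ?Q2 f)"
      by (rule prob_disj_le[OF ev1 ev2])
    also have "\<P>(f in G. ?Q2 f) \<le> ?e"
    proof (rule prob_revealed_le)
      show "finite ?W" using fR by simp
      show "0 \<le> ?e" using short_bound_nonneg True \<open>0 < m\<close> by (intro mult_nonneg_nonneg) auto
      show "(C \<times> R \<union> R \<times> C) \<inter> ((R - C) \<times> (R - C)) = {}" for C by auto
      show "C = C'" if "grown (curry f) i p R C" "grown (curry f) i p R C'" for f C C'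
        using grow_unique that fR by blast
      fix C assume C: "C \<in> ?W"
      have "card (R - C) < card R" using C v fR by (intro psubset_card_mono) auto
      then have "\<P>(f in G. ?B (insert C p) (R - C) f) \<le> card (R - C) * short_bound m"
        using less.prems by (intro less.hyps) auto
      also have "\<dots> \<le> ?e"
        using \<open>card (R - C) < card R\<close> short_bound_nonneg by (intro mult_right_mono) auto
      finally show "\<P>(f in G. ?B (insert C p) (R - C) f) \<le> ?e" .
    qed (rule ev_g, rule ev_B)
    also have "\<P>(f in G. ?Q1 f) \<le> short_bound m"
      using less.prems R True by (rule prob_grown_short)
    finally show ?thesis by (simp add: algebra_simps)
  qed
qed

text \<open>A pair of cliques involves \<open>2 * s\<close> sums of \<open>s\<close> utilities each.
  Hoeffding's inequality at deviation \<open>s / 80\<close> gives the exponent, with 12800 = 2 *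
  80^2.\<close>

definition conflict_bound :: real where
  "conflict_bound = 2 * real s * exp (- real s / 12800)"

lemma ev_uset_lt: "{a} \<times> (X - {a}) \<subseteq> J \<Longrightarrow> ev J (\<lambda>f. uset (curry f) a X < c)"
  using ev_uset[of "{..<c}"] by simp

lemma ev_badpair:
  assumes "finite D" "finite C" "D \<times> C \<union> C \<times> D \<subseteq> J"
  shows "ev J (\<lambda>f. badpair (curry f) D C)"
  unfolding badpair_def using assms by (intro ev_disj ev_bex ev_uset_lt) auto

lemma prob_uset_low:
  assumes "a \<notin> C" "card C = s" "insert a C \<subseteq> {0..<n}"
  shows "\<P>(f in G. uset (curry f) a C < - real s / 80) \<le> exp (- real s / 12800)"
proof -
  let ?J = "{a} \<times> C"
  have fC: "finite C" using assms(3) by (auto intro: finite_subset)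
  have J: "?J \<subseteq> offdiag n" "?J \<noteq> {}" "card ?J = s"
    using assms spar_pos by (auto simp: offdiag_def card_cartesian_product)
  have sum: "uset (curry f) a C = (\<Sum>j\<in>?J. f j)" for f
  proof -
    have "?J = Pair a ` C" by auto
    then show ?thesis using assms(1) by (simp add: uset_notin sum.reindex inj_on_def)
  qed
  have "\<P>(f in G. uset (curry f) a C < - real s / 80) \<le> \<P>(f in G. (\<Sum>j\<in>?J. f j) \<le> - (real s / 80))"
    using ev_sum[of "{..- (real s / 80)}" ?J ?J] by (intro prob_mono_ev[of ?J]) (auto simp: sum)
  also have "\<dots> \<le> exp (- (real s / 80)\<^sup>2 / (2 * card ?J))"
    by (rule prob_sum_le_neg[OF J(1,2)]) simp
  also have "- (real s / 80)\<^sup>2 / (2 * card ?J) = - real s / 12800"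
    unfolding J(3) using spar_pos by (simp add: power2_eq_square field_simps)
  finally show ?thesis .
qed

lemma prob_badpair:
  assumes "D \<inter> C = {}" "card D = s" "card C = s" "D \<union> C \<subseteq> {0..<n}"
  shows "\<P>(f in G. badpair (curry f) D C) \<le> conflict_bound"
proof -
  have fin: "finite D" "finite C" using assms(4) by (auto intro: finite_subset)
  have ev: "ev UNIV (\<lambda>f. uset (curry f) a X < c)" for a X c
    by (rule ev_uset_lt) simp
  have "\<P>(f in G. badpair (curry f) D C)
    \<le> \<P>(f in G. \<exists>a\<in>D. uset (curry f) a C < - real s / 80)
      + \<P>(f in G. \<exists>b\<in>C. uset (curry f) b D < - real s / 80)"
    unfolding badpair_def using fin by (intro prob_disj_le[of UNIV _ UNIV] ev_bex ev) auto
  also have "\<dots> \<le> card D * exp (- real s / 12800) + card C * exp (- real s / 12800)"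
    using assms fin by (intro add_mono prob_bex_le_card[of _ UNIV] ev prob_uset_low) auto
  finally show ?thesis using assms by (simp add: conflict_bound_def)
qed

section \<open>Rounds that find no compatible clique\<close>

lemma ev_round_None:
  assumes "family pis" "j \<le> 20" "finite M"
  shows "ev UNIV (\<lambda>f. fst (round2 r n (curry f) pis j M) = None)"
proof -
  let ?W = "Pow ((M \<union> agents pis) \<times> agents pis)"
  have fin: "finite ?W"
    using assms(3) finite_subset[OF agents_subset[OF assms(1)]] by simp
  have "ev UNIV (\<lambda>f. \<exists>c\<in>?W. round2 r n (curry f) pis j M = (None, c))"
    using fin by (intro ev_bex ev_mono[OF ev_round2[OF assms]]) auto
  then show ?thesis
  proof (rule ev_cong)
    fix f :: "nat \<times> nat \<Rightarrow> real"
    obtain res c where rd: "round2 r n (curry f) pis j M = (res, c)" by fastforce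
    have "c \<in> ?W" using round2_checks[OF assms(1,2) rd] by simp
    then show "fst (round2 r n (curry f) pis j M) = None \<longleftrightarrow>
      (\<exists>c\<in>?W. round2 r n (curry f) pis j M = (None, c))"
      unfolding rd by auto
  qed
qed

lemma prob_incompatible:
  assumes fam: "family pis" and m: "m < 20" "earlier pis m L" and C: "C \<in> pis (Suc m)"
  shows "\<P>(f in G. \<not> compatible (curry f) n (Suc m) (\<Union>L) C) \<le> 20 * conflict_bound"
proof -
  note e = earlier_props[OF fam m(2,1)]
  have k: "Suc m \<in> {1..20}" using m(1) by simp
  note C' = family_member[OF fam k C] family_finite_member[OF fam k C]
  have L: "finite L" "card L = m" using m(2) by (auto simp: earlier_def)
  have disj: "C \<inter> \<Union>L = {}" by (rule e(5)[OF C])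
  have "\<P>(f in G. \<not> compatible (curry f) n (Suc m) (\<Union>L) C) \<le> \<P>(f in G. \<exists>D\<in>L. badpair (curry f) D C)"
  proof (rule prob_mono_ev)
    show "ev UNIV (\<lambda>f. \<exists>D\<in>L. badpair (curry f) D C)"
      using L e(2) C' by (intro ev_bex ev_badpair) auto
    show "\<exists>D\<in>L. badpair (curry f) D C" if "\<not> compatible (curry f) n (Suc m) (\<Union>L) C" for f
      using L e(1,2) disj that by (intro incompatible_badpair) auto
  qed
  also have "\<dots> \<le> card L * conflict_bound"
  proof (rule prob_bex_le_card[OF L(1)])
    fix D assume D: "D \<in> L"
    show "ev UNIV (\<lambda>f. badpair (curry f) D C)" using e(2)[OF D] C' by (intro ev_badpair) auto
    have "D \<union> C \<subseteq> {0..<n}"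
      using D e(3) agents_subset[OF fam] C' part_subset[OF k] by blast
    then show "\<P>(f in G. badpair (curry f) D C) \<le> conflict_bound"
      using e(2)[OF D] C' D disj by (intro prob_badpair) auto
  qed
  also have "\<dots> \<le> 20 * conflict_bound"
    using L(2) m(1) by (intro mult_right_mono) (auto simp: conflict_bound_def)
  finally show ?thesis .
qed

text \<open>The partial coalition depends on the utilities, so rather than conditioning on it the
  bound runs over every clique \<open>C\<close> that the next step might take, at the price of a
  factor \<open>n\<close> per step. For a fixed \<open>L\<close> the candidates involve disjoint
  pairs, so all \<open>t\<close> or more of them are incompatible with probability at most
  \<open>(1/2) ^ t\<close>.\<close>

lemma prob_round_None:
  assumes fam: "family pis" and t: "\<And>k. k \<in> {1..20} \<Longrightarrow> t \<le> card (pis k)"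
    and b: "20 * conflict_bound \<le> 1/2"
  shows "j \<le> 20 \<Longrightarrow> earlier pis (20 - j) L \<Longrightarrow>
    \<P>(f in G. fst (round2 r n (curry f) pis j (\<Union>L)) = None) \<le> real (n + 1) ^ j * (1/2) ^ t"
proof (induction j arbitrary: L)
  case (Suc j)
  let ?k = "20 - j" and ?m = "20 - Suc j"
  have k: "?k \<in> {1..20}" "?k = Suc ?m" "?m < 20" using Suc.prems by auto
  note e = earlier_props[OF fam Suc.prems(2) k(3)]
  have o: "set (ord2 r n ?k M (pis ?k)) = pis ?k" for M
    using family_finite[OF assms(1) k(1)] by (rule set_ord2)
  let ?I = "\<lambda>C f. \<not> compatible (curry f) n ?k (\<Union>L) C"
  let ?N = "\<lambda>C f. fst (round2 r n (curry f) pis j (\<Union>(insert C L))) = None"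
  have fk: "finite (pis ?k)" by (rule family_finite[OF fam k(1)])
  have evI: "ev (\<Union>L \<times> C \<union> C \<times> \<Union>L) (?I C)" if "C \<in> pis ?k" for C
    using e(4) family_finite_member[OF fam k(1) that] by (intro ev_not ev_compatible) auto
  have evN: "ev UNIV (?N C)" if "C \<in> pis ?k" for C
    using Suc.prems(1) e(4) family_finite_member[OF fam k(1) that] by (intro ev_round_None[OF fam]) auto
  have ev1: "ev UNIV (\<lambda>f. \<forall>C\<in>pis ?k. ?I C f)"
    using fk by (intro ev_ball ev_mono[OF evI]) auto
  have ev2: "ev UNIV (\<lambda>f. \<exists>C\<in>pis ?k. ?N C f)"
    using fk evN by (intro ev_bex)
  have "\<P>(f in G. fst (round2 r n (curry f) pis (Suc j) (\<Union>L)) = None)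
    \<le> \<P>(f in G. (\<forall>C\<in>pis ?k. ?I C f) \<or> (\<exists>C\<in>pis ?k. ?N C f))"
  proof (rule prob_mono_ev)
    show "ev UNIV (\<lambda>f. (\<forall>C\<in>pis ?k. ?I C f) \<or> (\<exists>C\<in>pis ?k. ?N C f))" by (intro ev_disj ev1 ev2)
    fix f assume "fst (round2 r n (curry f) pis (Suc j) (\<Union>L)) = None"
    then obtain c where "round2 r n (curry f) pis (Suc j) (\<Union>L) = (None, c)"
      by (metis prod.collapse)
    then show "(\<forall>C\<in>pis ?k. ?I C f) \<or> (\<exists>C\<in>pis ?k. ?N C f)"
    proof (cases rule: round2_SucE)
      case stop
      then show ?thesis using scan_NoneD[OF stop(1), unfolded o] by blast
    next
      case (step C c1 res' c2)
      then have "C \<in> pis ?k" using scan_SomeD[OF step(1), unfolded o] by blast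
      moreover have "?N C f" using step(2,3) by (simp add: Un_commute)
      ultimately show ?thesis by blast
    qed
  qed
  also have "\<dots> \<le> \<P>(f in G. \<forall>C\<in>pis ?k. ?I C f) + \<P>(f in G. \<exists>C\<in>pis ?k. ?N C f)"
    by (rule prob_disj_le[OF ev1 ev2])
  finally have split: "\<P>(f in G. fst (round2 r n (curry f) pis (Suc j) (\<Union>L)) = None)
    \<le> \<P>(f in G. \<forall>C\<in>pis ?k. ?I C f) + \<P>(f in G. \<exists>C\<in>pis ?k. ?N C f)" .
  have none: "\<P>(f in G. \<forall>C\<in>pis ?k. ?I C f) \<le> (1/2) ^ t"
  proof -
    have "\<P>(f in G. \<forall>C\<in>pis ?k. ?I C f) = (\<Prod>C\<in>pis ?k. \<P>(f in G. ?I C f))"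
    proof (rule prob_ball_indep[OF fk evI])
      show "disjoint_family_on (\<lambda>C. \<Union>L \<times> C \<union> C \<times> \<Union>L) (pis ?k)"
        unfolding disjoint_family_on_def
      proof (intro ballI impI)
        fix C D assume CD: "C \<in> pis ?k" "D \<in> pis ?k" "C \<noteq> D"
        have "C \<inter> D = {}" using family_unique[OF fam k(1) k(1) CD(1,2)] CD(3) by blast
        moreover have "C \<inter> \<Union>L = {}" "D \<inter> \<Union>L = {}" using e(5) CD k(2) by auto
        ultimately show "(\<Union>L \<times> C \<union> C \<times> \<Union>L) \<inter> (\<Union>L \<times> D \<union> D \<times> \<Union>L) = {}" by blast
      qed
    qed
    also have "\<dots> \<le> (\<Prod>C\<in>pis ?k. 1/2)"
    proof (rule prod_mono)
      fix C assume "C \<in> pis ?k"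
      then have "\<P>(f in G. ?I C f) \<le> 20 * conflict_bound"
        using prob_incompatible[OF fam k(3) Suc.prems(2), of C] k(2) by simp
      then show "0 \<le> \<P>(f in G. ?I C f) \<and> \<P>(f in G. ?I C f) \<le> 1/2" using b by simp
    qed
    also have "\<dots> = (1/2) ^ card (pis ?k)" by simp
    also have "\<dots> \<le> (1/2) ^ t" using t[OF k(1)] by (intro power_decreasing) auto
    finally show ?thesis .
  qed
  have "\<P>(f in G. \<exists>C\<in>pis ?k. ?N C f) \<le> card (pis ?k) * (real (n + 1) ^ j * (1/2) ^ t)"
  proof (rule prob_bex_le_card[OF fk evN])
    fix C assume "C \<in> pis ?k"
    then have "earlier pis (20 - j) (insert C L)" using e(6)[of C] k(2) by simp
    then show "\<P>(f in G. ?N C f) \<le> real (n + 1) ^ j * (1/2) ^ t"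
      by (rule Suc.IH[OF Suc_leD[OF Suc.prems(1)]])
  qed
  also have "\<dots> \<le> n * (real (n + 1) ^ j * (1/2) ^ t)"
  proof (rule mult_right_mono)
    have "card (\<Union>(pis ?k)) \<le> n"
      using card_mono[of "{0..<n}" "\<Union>(pis ?k)"] family_member[OF fam k(1)] part_subset[OF k(1)] by auto
    moreover have "card (pis ?k) \<le> card (\<Union>(pis ?k))"
    proof -
      obtain g where g: "\<And>C. C \<in> pis ?k \<Longrightarrow> g C \<in> C"
        using family_member[OF fam k(1)] by (metis ex_in_conv)
      have "inj_on g (pis ?k)"
        using g family_unique[OF fam k(1) k(1)] by (metis inj_onI)
      moreover have "g ` pis ?k \<subseteq> \<Union>(pis ?k)" using g by blast
      moreover have "finite (\<Union>(pis ?k))" using fk family_finite_member[OF fam k(1)] by blast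
      ultimately show ?thesis by (rule card_inj_on_le)
    qed
    ultimately show "real (card (pis ?k)) \<le> real n" by linarith
  qed auto
  finally have rest: "\<P>(f in G. \<exists>C\<in>pis ?k. ?N C f) \<le> n * (real (n + 1) ^ j * (1/2) ^ t)" .
  \<comment> \<open>Rests on \<open>1 + n * (n + 1) ^ j \<le> (n + 1) ^ Suc j\<close>, the reason
    for the base \<open>n + 1\<close>.\<close>
  have "(1/2) ^ t + n * (real (n + 1) ^ j * (1/2) ^ t) \<le> real (n + 1) ^ Suc j * (1/2) ^ t"
    using mult_right_mono[of 1 "real (n + 1) ^ j" "(1/2) ^ t"] by (simp add: algebra_simps)
  then show ?case using split none rest by linarith
qed simp

definition stuck_bound :: "nat \<Rightarrow> real" where
  "stuck_bound t = real (n + 1) ^ 20 * (1/2) ^ t"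

text \<open>All pairs read in a successful round touch the coalition that it forms, and its agents
  leave, so the remaining game is fresh. There are at most \<open>card (pis 1)\<close> rounds, each
  failing with probability at most \<open>stuck_bound t\<close> while all families are
  large.\<close>

lemma prob_stuck:
  assumes b: "20 * conflict_bound \<le> 1/2"
  shows "family pis \<Longrightarrow> \<P>(f in G. stuck r n (curry f) t pis) \<le> card (pis 1) * stuck_bound t"
proof (induction "card (pis 1)" arbitrary: pis rule: less_induct)
  case less
  note fam = less.prems
  show ?case
  proof (cases "pis 1 = {}")
    case True
    have "\<not> stuck r n (curry f) t pis" for f
      using True by (auto elim: stuck.cases)
    then show ?thesis by (simp add: stuck_bound_def)
  next
    case False
    have fin1: "finite (pis 1)" by (rule family_finite[OF fam]) simp
    let ?round = "\<lambda>f. round2 r n (curry f) pis 20 {}"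
    let ?A = "agents pis"
    \<comment> \<open>The last condition retains only results realised by some utilities, because
      \<open>discard_props\<close> is available for these alone.\<close>
    let ?W = "{(Cs, c). (set Cs \<subseteq> members pis \<and> length Cs = 20) \<and> c \<in> Pow (?A \<times> ?A) \<and>
      (\<exists>u. round2 r n u pis 20 {} = (Some Cs, c))}"
    let ?X = "\<lambda>w f. ?round f = (Some (fst w), snd w)"
    let ?Y = "\<lambda>w f. stuck r n (curry f) t (discard pis (fst w))"
    let ?Q1 = "\<lambda>f. (\<forall>k\<in>{1..20}. t \<le> card (pis k)) \<and> fst (round2 r n (curry f) pis 20 {}) = None"
    let ?Q2 = "\<lambda>f. \<exists>w\<in>?W. ?X w f \<and> ?Y w f"
    let ?e = "(real (card (pis 1)) - 1) * stuck_bound t"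
    have fW: "finite ?W"
    proof (rule finite_subset)
      show "?W \<subseteq> {Cs. set Cs \<subseteq> members pis \<and> length Cs = 20} \<times> Pow (?A \<times> ?A)" by auto
      show "finite ({Cs. set Cs \<subseteq> members pis \<and> length Cs = 20} \<times> Pow (?A \<times> ?A))"
        using finite_lists_length_eq[OF finite_members[OF fam]] finite_subset[OF agents_subset[OF fam]]
        by (intro finite_cartesian_product) auto
    qed
    have evX: "ev (snd w \<union> (snd w)\<inverse>) (?X w)" for w
      by (rule ev_round2[OF fam]) auto
    have evY: "ev (agents (discard pis (fst w)) \<times> agents (discard pis (fst w))) (?Y w)" if "w \<in> ?W" for w
      using that discard_props(1)[OF fam] by (intro ev_mono[OF ev_stuck]) auto
    have ev1: "ev UNIV ?Q1" by (intro ev_conj_const ev_round_None[OF fam]) auto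
    have ev2: "ev UNIV ?Q2"
    proof (rule ev_bex[OF fW])
      fix w assume "w \<in> ?W"
      then show "ev UNIV (\<lambda>f. ?X w f \<and> ?Y w f)"
        by (intro ev_conj ev_mono[OF evX] ev_mono[OF evY]) auto
    qed
    have "\<P>(f in G. stuck r n (curry f) t pis) \<le> \<P>(f in G. ?Q1 f \<or> ?Q2 f)"
    proof (rule prob_mono_ev)
      show "ev UNIV (\<lambda>f. ?Q1 f \<or> ?Q2 f)" by (intro ev_disj ev1 ev2)
      fix f assume "stuck r n (curry f) t pis"
      then show "?Q1 f \<or> ?Q2 f"
      proof (cases rule: stuck.cases)
        case (stuck_now c)
        then show ?thesis by simp
      next
        case (stuck_later Cs c)
        have "(Cs, c) \<in> ?W"
          using round_SomeD(1,3)[OF fam stuck_later(2)] round_checks[OF fam stuck_later(2)] stuck_later(2)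
          by blast
        then have "?Q2 f" using stuck_later by (intro bexI[of _ "(Cs, c)"]) auto
        then show ?thesis by blast
      qed
    qed
    also have "\<dots> \<le> \<P>(f in G. ?Q1 f) + \<P>(f in G. ?Q2 f)"
      by (rule prob_disj_le[OF ev1 ev2])
    also have "\<P>(f in G. ?Q2 f) \<le> ?e"
    proof (rule prob_revealed_le[OF fW evX evY])
      show "0 \<le> ?e"
        using False fin1 by (intro mult_nonneg_nonneg) (auto simp: stuck_bound_def Suc_le_eq card_gt_0_iff)
      fix w assume w: "w \<in> ?W"
      then obtain u where u: "round2 r n u pis 20 {} = (Some (fst w), snd w)" by auto
      note d = discard_props[OF fam u]
      show "(snd w \<union> (snd w)\<inverse>) \<inter> (agents (discard pis (fst w)) \<times> agents (discard pis (fst w))) = {}"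
        using round_SomeD(6)[OF fam u] unfolding d(5) by blast
      have c: "card (discard pis (fst w) 1) + 1 = card (pis 1)" by (rule d(2)) simp
      then have "\<P>(f in G. ?Y w f) \<le> card (discard pis (fst w) 1) * stuck_bound t"
        by (intro less.hyps d(1)) simp
      also have "real (card (discard pis (fst w) 1)) = real (card (pis 1)) - 1" using c by simp
      finally show "\<P>(f in G. ?Y w f) \<le> ?e" .
    qed (auto simp: prod_eq_iff)
    also have "\<P>(f in G. ?Q1 f) \<le> stuck_bound t"
    proof (cases "\<forall>k\<in>{1..20}. t \<le> card (pis k)")
      case True
      have "earlier pis (20 - 20) {}" by (simp add: earlier_def)
      from prob_round_None[OF fam _ b order_refl this, of t] True
      show ?thesis by (simp add: stuck_bound_def)
    next
      case False
      then have "{f \<in> space G. ?Q1 f} = {}" by blast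
      then show ?thesis by (simp only: measure_empty) (simp add: stuck_bound_def)
    qed
    finally show ?thesis by (simp add: algebra_simps)
  qed
qed

text \<open>Counts conflicts among all cliques, read or not, so that the selections of Stage 2 do
  not enter.\<close>

definition crowded :: "(nat \<Rightarrow> nat set set) \<Rightarrow> nat \<Rightarrow> util \<Rightarrow> bool" where
  "crowded pis h u \<longleftrightarrow> (\<exists>C\<in>members pis. h \<le> card {D\<in>members pis. conflict u D C})"

lemma conflict_cases:
  assumes "family pis" "C \<in> members pis" "D \<in> members pis" "conflict u D C"
  shows "D \<inter> C = {}" "(D \<times> C \<union> C \<times> D) \<inter> intra = {}"
proof -
  obtain k l where k: "k \<in> {1..20}" "C \<in> pis k" and l: "l \<in> {1..20}" "D \<in> pis l"
    using assms(2,3) unfolding members_def by blast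
  have sub: "C \<subseteq> part r n k" "D \<subseteq> part r n l" using family_member[OF assms(1)] k l by blast+
  then have "k \<noteq> l" using assms(4) k(1) unfolding conflict_def by blast
  then show "D \<inter> C = {}" using sub part_unique[OF k(1) l(1)] by blast
  show "(D \<times> C \<union> C \<times> D) \<inter> intra = {}"
    using \<open>k \<noteq> l\<close> sub part_unique[OF k(1)] part_unique[OF l(1)] unfolding intra_def by blast
qed

text \<open>For cliques of different parts removing \<open>intra\<close> changes nothing; for
  cliques of a common part the event is false whatever the utilities are.\<close>

lemma ev_conflict:
  assumes "family pis" "C \<in> members pis" "D \<in> members pis"
  shows "ev (D \<times> C \<union> C \<times> D - intra) (\<lambda>f. conflict (curry f) D C)"
proof (cases "\<forall>i\<in>{1..20}. D \<subseteq> part r n i \<longrightarrow> \<not> C \<subseteq> part r n i")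
  case True
  obtain k l where k: "k \<in> {1..20}" "C \<in> pis k" and l: "l \<in> {1..20}" "D \<in> pis l"
    using assms(2,3) unfolding members_def by blast
  have sub: "C \<subseteq> part r n k" "D \<subseteq> part r n l" using family_member[OF assms(1)] k l by blast+
  then have "k \<noteq> l" using True k(1) by blast
  then have "(D \<times> C \<union> C \<times> D) \<inter> intra = {}"
    using sub part_unique[OF k(1)] part_unique[OF l(1)] unfolding intra_def by blast
  then have "D \<times> C \<union> C \<times> D - intra = D \<times> C \<union> C \<times> D" by blast
  then show ?thesis
    unfolding conflict_def using member_props[OF assms(1)] assms(2,3)
    by (intro ev_conj_const ev_badpair) auto
next
  case False
  then show ?thesis unfolding conflict_def by (intro ev_conj_const) blast
qed

lemma ev_crowded:
  assumes "family pis"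
  shows "ev (agents pis \<times> agents pis - intra) (\<lambda>f. crowded pis h (curry f))"
proof -
  have "D \<times> C \<union> C \<times> D - intra \<subseteq> agents pis \<times> agents pis - intra"
    if "C \<in> members pis" "D \<in> members pis" for C D
    using that unfolding agents_def by blast
  then show ?thesis
    unfolding crowded_def using finite_members[OF assms]
    by (intro ev_bex ev_card[where R="\<lambda>m. h \<le> m"] ev_mono[OF ev_conflict[OF assms]])
qed

lemma card_members_le: "family pis \<Longrightarrow> card (members pis) * s \<le> n"
proof -
  assume fam: "family pis"
  have "card (members pis) * s = (\<Sum>C\<in>members pis. card C)"
    using member_props[OF fam] by simp
  also have "\<dots> = card (\<Union>(members pis))"
    using member_props[OF fam] disjoint_members[OF fam]
    by (intro card_Union_disjoint[symmetric]) (auto simp: disjoint_def pairwise_def disjnt_def)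
  also have "\<dots> \<le> card {0..<n}"
    using agents_subset[OF fam] unfolding agents_def by (intro card_mono) auto
  finally show ?thesis by simp
qed

text \<open>For a fixed \<open>C\<close>, conflicts with distinct cliques concern disjoint pairs.
  The crude estimate of the binomial by all subsets is affordable because
  \<open>conflict_bound\<close> falls below every fixed power of 1/2.\<close>

lemma prob_crowded:
  assumes fam: "family pis"
  shows "\<P>(f in G. crowded pis h (curry f)) \<le> n * (2 ^ (n div s) * conflict_bound ^ h)"
proof -
  let ?M = "members pis"
  have fM: "finite ?M" by (rule finite_members[OF fam])
  have cM: "card ?M \<le> n div s" using card_members_le[OF fam] spar_pos
    by (simp add: less_eq_div_iff_mult_less_eq)
  have p0: "0 \<le> conflict_bound" by (simp add: conflict_bound_def)
  have ev: "ev (D \<times> C \<union> C \<times> D) (\<lambda>f. conflict (curry f) D C)" if "C \<in> ?M" "D \<in> ?M" for C D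
    by (rule ev_mono[OF ev_conflict[OF fam that]]) blast
  have "\<P>(f in G. crowded pis h (curry f)) \<le> card ?M * (2 ^ (n div s) * conflict_bound ^ h)"
    unfolding crowded_def
  proof (rule prob_bex_le_card[OF fM])
    fix C assume C: "C \<in> ?M"
    show "ev UNIV (\<lambda>f. h \<le> card {D \<in> ?M. conflict (curry f) D C})"
      using fM C by (intro ev_card[where R="\<lambda>m. h \<le> m"] ev_mono[OF ev]) auto
    have bound: "\<P>(f in G. conflict (curry f) D C) \<le> conflict_bound" if D: "D \<in> ?M" for D
    proof (cases "\<exists>u. conflict u D C")
      case True
      then obtain u where u: "conflict u D C" by blast
      have disj: "D \<inter> C = {}" by (rule conflict_cases[OF fam C D u])
      have fin: "finite D" "finite C" using member_props[OF fam] C D by blast+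
      have "\<P>(f in G. conflict (curry f) D C) \<le> \<P>(f in G. badpair (curry f) D C)"
        using fin by (intro prob_mono_ev[of UNIV] ev_badpair) (auto simp: conflict_def)
      also have "\<dots> \<le> conflict_bound"
        using disj member_props[OF fam C] member_props[OF fam D] by (intro prob_badpair) auto
      finally show ?thesis .
    next
      case False
      then show ?thesis using p0 by simp
    qed
    have "\<P>(f in G. h \<le> card {D \<in> ?M - {C}. conflict (curry f) D C})
      \<le> (card (?M - {C}) choose h) * conflict_bound ^ h"
    proof (rule prob_card_ge_le)
      show "finite (?M - {C})" using fM by simp
      show "disjoint_family_on (\<lambda>D. D \<times> C \<union> C \<times> D) (?M - {C})"
        unfolding disjoint_family_on_def
      proof (intro ballI impI)
        fix D E assume DE: "D \<in> ?M - {C}" "E \<in> ?M - {C}" "D \<noteq> E"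
        have "D \<inter> E = {}" "D \<inter> C = {}" "E \<inter> C = {}"
          using members_unique[OF fam] DE C by blast+
        then show "(D \<times> C \<union> C \<times> D) \<inter> (E \<times> C \<union> C \<times> E) = {}" by blast
      qed
    qed (use ev C bound in auto)
    moreover have "{D \<in> ?M - {C}. conflict u D C} = {D \<in> ?M. conflict u D C}" for u
    proof -
      have "C \<noteq> {}" using member_props[OF fam C] by blast
      then have "\<not> conflict u C C" using conflict_cases(1)[OF fam C C] by blast
      then show ?thesis by blast
    qed
    moreover have "(card (?M - {C}) choose h) * conflict_bound ^ h \<le> 2 ^ (n div s) * conflict_bound ^ h"
    proof (rule mult_right_mono)
      have "card (?M - {C}) choose h \<le> 2 ^ card (?M - {C})" by (rule binomial_le_pow2)
      also have "\<dots> \<le> 2 ^ (n div s)"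
        using card_Diff1_le[of ?M C] cM by (intro power_increasing) auto
      finally show "real (card (?M - {C}) choose h) \<le> 2 ^ (n div s)"
        by (metis of_nat_le_iff of_nat_numeral of_nat_power)
    qed (use p0 in simp)
    ultimately show "\<P>(f in G. h \<le> card {D \<in> ?M. conflict (curry f) D C}) \<le> 2 ^ (n div s) * conflict_bound ^ h"
      by simp
  qed
  also have "\<dots> \<le> n * (2 ^ (n div s) * conflict_bound ^ h)"
    using order_trans[OF cM div_le_dividend] p0 by (intro mult_right_mono) auto
  finally show ?thesis .
qed

end

section \<open>Outcomes of a run\<close>

lemma round2_cong:
  "\<forall>k\<in>{1..20}. pis' k = pis k \<Longrightarrow> j \<le> 20 \<Longrightarrow> round2 r n u pis' j M = round2 r n u pis j M"
proof (induction j arbitrary: M)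
  case (Suc j)
  have "pis' (20 - j) = pis (20 - j)" using Suc.prems by auto
  moreover have "round2 r n u pis' j = round2 r n u pis j"
    using Suc by (intro ext) simp
  ultimately show ?case by (simp add: Let_def split: prod.split option.split)
qed simp

text \<open>Stage 2 looks only at the indices in \<open>{1..20}\<close>, so any run can be replaced
  by one whose families are trimmed to these indices.\<close>

lemma stage2_cong:
  "stage2 r n u pis Pc ch pisf Pf chf \<Longrightarrow> \<forall>k\<in>{1..20}. pis' k = pis k \<Longrightarrow>
    \<exists>pisf'. (\<forall>k\<in>{1..20}. pisf' k = pisf k) \<and> stage2 r n u pis' Pc ch pisf' Pf chf"
proof (induction arbitrary: pis' rule: stage2.induct)
  case (s2_done pis Pc ch)
  have "pis' 1 = pis 1" using s2_done.prems by (rule bspec) simp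
  then have "stage2 r n u pis' Pc ch pis' Pc ch" using s2_done.hyps by (intro stage2.s2_done) simp
  then show ?case using s2_done.prems by blast
next
  case (s2_stop pis c Pc ch)
  have "pis' 1 = pis 1" using s2_stop.prems by (rule bspec) simp
  moreover have "round2 r n u pis' 20 {} = (None, c)"
    using round2_cong[OF s2_stop.prems order_refl] s2_stop.hyps(2) by simp
  ultimately have "stage2 r n u pis' Pc ch pis' Pc (ch \<union> c)"
    using s2_stop.hyps(1) by (intro stage2.s2_stop) simp_all
  then show ?case using s2_stop.prems by blast
next
  case (s2_step pis Cs c Pc ch pisf Pf chf)
  have "pis' 1 = pis 1" using s2_step.prems by (rule bspec) simp
  then have 1: "pis' 1 \<noteq> {}" using s2_step.hyps(1) by simp
  have 2: "round2 r n u pis' 20 {} = (Some Cs, c)"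
    using round2_cong[OF s2_step.prems order_refl] s2_step.hyps(2) by simp
  have "\<forall>k\<in>{1..20}. discard pis' Cs k = discard pis Cs k"
    using s2_step.prems by (simp add: discard_def)
  then obtain pisf' where pisf': "\<forall>k\<in>{1..20}. pisf' k = pisf k"
    "stage2 r n u (discard pis' Cs) (insert (\<Union>(set Cs)) Pc) (ch \<union> c) pisf' Pf chf"
    using s2_step.IH[of "discard pis' Cs"] unfolding discard_def by blast
  have "stage2 r n u pis' Pc ch pisf' Pf chf"
    using stage2.s2_step[OF 1 2] pisf'(2) unfolding discard_def by blast
  then show ?case using pisf'(1) by blast
qed

context algorithm
begin

section \<open>Complete runs of Stages 1 and 2 and their finitely many outcomes\<close>

definition stage1 :: "util \<Rightarrow> (nat \<Rightarrow> nat set set) \<Rightarrow> (nat \<Rightarrow> nat set) \<Rightarrow> bool" where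
  "stage1 u pis R1 \<longleftrightarrow> (\<forall>i\<in>{1..20}. greedy r n u i {} (part r n i) (pis i) (R1 i))"

lemma stage1_props:
  assumes "stage1 u pis R1"
  shows "family pis" "\<forall>C\<in>members pis. clique u C" "\<And>i. i \<in> {1..20} \<Longrightarrow> R1 i = part r n i - \<Union>(pis i)"
proof -
  have p: "packing u (part r n i) (pis i) (R1 i)" if "i \<in> {1..20}" for i
  proof (rule greedy_packing)
    show "greedy r n u i {} (part r n i) (pis i) (R1 i)" using assms that by (simp add: stage1_def)
    show "packing u (part r n i) {} (part r n i)" using finite_part[OF that] by (simp add: packing_def)
  qed
  show "family pis" using p unfolding family_def packing_def by blast
  show "\<forall>C\<in>members pis. clique u C" using p unfolding members_def packing_def by blast
  show "R1 i = part r n i - \<Union>(pis i)" if "i \<in> {1..20}" for i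
    using p[OF that] unfolding packing_def by blast
qed

definition leftover :: "(nat \<Rightarrow> nat set) \<Rightarrow> (nat \<Rightarrow> nat set set) \<Rightarrow> nat set" where
  "leftover R1 pis2 = (\<Union>i\<in>{1..20}. R1 i) \<union> (\<Union>k\<in>{1..20}. \<Union>(pis2 k))"

definition run :: "util \<Rightarrow> (nat \<Rightarrow> nat set set) \<Rightarrow> (nat \<Rightarrow> nat set) \<Rightarrow> (nat \<Rightarrow> nat set set) \<Rightarrow>
    nat set set \<Rightarrow> (nat \<times> nat) set \<Rightarrow> bool" where
  "run u pis R1 pis2 Pc ch \<longleftrightarrow> stage1 u pis R1 \<and> stage2 r n u pis {} {} pis2 Pc ch"

lemma stage2_checks:
  "stage2 r n u pis Pc ch pisf Pf chf \<Longrightarrow> family pis \<Longrightarrow> chf \<subseteq> ch \<union> agents pis \<times> agents pis"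
proof (induction rule: stage2.induct)
  case (s2_stop pis c Pc ch)
  then show ?case using round_checks[OF s2_stop.prems s2_stop.hyps(2)] by blast
next
  case (s2_step pis Cs c Pc ch pisf Pf chf)
  note d = discard_props[OF s2_step.prems s2_step.hyps(2)]
  have "chf \<subseteq> (ch \<union> c) \<union> agents (discard pis Cs) \<times> agents (discard pis Cs)"
    using s2_step.IH d(1) unfolding discard_def by blast
  then show ?case using round_checks[OF s2_step.prems s2_step.hyps(2)] d(5) by blast
qed blast

lemma run_props:
  assumes "run u pis R1 pis2 Pc ch"
  shows "matched u pis pis2 Pc ch" "ch \<subseteq> agents pis \<times> agents pis"
    "leftover R1 pis2 \<inter> \<Union>Pc = {}" "leftover R1 pis2 \<union> \<Union>Pc = {0..<n}"
    "leftover R1 pis2 = {0..<n} - agents pis \<union> agents pis2"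
proof -
  have s1: "stage1 u pis R1" and s2: "stage2 r n u pis {} {} pis2 Pc ch"
    using assms by (auto simp: run_def)
  note p = stage1_props[OF s1]
  show m: "matched u pis pis2 Pc ch"
    using stage2_matched[OF s2 matched_init[OF p(1)]] p(2) by blast
  show "ch \<subseteq> agents pis \<times> agents pis" using stage2_checks[OF s2 p(1)] by simp
  have eq: "\<Union>Pc \<inter> agents pis2 = {}" "\<Union>Pc \<union> agents pis2 = agents pis"
    using m by (auto simp: matched_def)
  have "(\<Union>i\<in>{1..20}. R1 i) = {0..<n} - agents pis"
  proof
    show "(\<Union>i\<in>{1..20}. R1 i) \<subseteq> {0..<n} - agents pis"
    proof
      fix x assume "x \<in> (\<Union>i\<in>{1..20}. R1 i)"
      then obtain i where i: "i \<in> {1..20}" "x \<in> part r n i" "x \<notin> \<Union>(pis i)" using p(3) by blast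
      have "x \<notin> agents pis"
      proof
        assume "x \<in> agents pis"
        then obtain k C where k: "k \<in> {1..20}" "C \<in> pis k" "x \<in> C"
          unfolding agents_def members_def by blast
        then have "x \<in> part r n k" using family_member[OF p(1)] by blast
        then show False using part_unique[OF i(1) k(1) i(2)] i(3) k by blast
      qed
      then show "x \<in> {0..<n} - agents pis" using part_subset[OF i(1)] i(2) by blast
    qed
    show "{0..<n} - agents pis \<subseteq> (\<Union>i\<in>{1..20}. R1 i)"
    proof
      fix x assume x: "x \<in> {0..<n} - agents pis"
      then obtain i where i: "i \<in> {1..20}" "x \<in> part r n i" using Un_part by blast
      then have "x \<notin> \<Union>(pis i)" using x unfolding agents_def members_def by blast
      then show "x \<in> (\<Union>i\<in>{1..20}. R1 i)" using i p(3) by blast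
    qed
  qed
  moreover have "(\<Union>k\<in>{1..20}. \<Union>(pis2 k)) = agents pis2"
    unfolding agents_def members_def by blast
  ultimately show lo: "leftover R1 pis2 = {0..<n} - agents pis \<union> agents pis2"
    by (simp add: leftover_def)
  show "leftover R1 pis2 \<inter> \<Union>Pc = {}" unfolding lo using eq by blast
  show "leftover R1 pis2 \<union> \<Union>Pc = {0..<n}" unfolding lo using eq agents_subset[OF p(1)] by blast
qed

text \<open>Outside \<open>{1..20}\<close> the families are set to \<open>{}\<close>, so that only finitely many outcomes remain.\<close>
definition indexed :: "'a set set \<Rightarrow> (nat \<Rightarrow> 'a set) set" where
  "indexed A = {g. \<forall>k. (k \<in> {1..20} \<longrightarrow> g k \<in> A) \<and> (k \<notin> {1..20} \<longrightarrow> g k = {})}"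

definition outcomes1 :: "((nat \<Rightarrow> nat set set) \<times> (nat \<Rightarrow> nat set)) set" where
  "outcomes1 = indexed (Pow (Pow {0..<n})) \<times> indexed (Pow {0..<n})"

definition outcomes :: "((nat \<Rightarrow> nat set set) \<times> (nat \<Rightarrow> nat set) \<times> (nat \<Rightarrow> nat set set) \<times>
    nat set set \<times> (nat \<times> nat) set) set" where
  "outcomes = indexed (Pow (Pow {0..<n})) \<times> indexed (Pow {0..<n}) \<times> indexed (Pow (Pow {0..<n})) \<times>
     Pow (Pow {0..<n}) \<times> Pow ({0..<n} \<times> {0..<n})"

lemma finite_indexed: "finite A \<Longrightarrow> finite (indexed A)"
  unfolding indexed_def by (rule finite_set_of_finite_funs) auto

lemma finite_outcomes1: "finite outcomes1" and finite_outcomes: "finite outcomes"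
  unfolding outcomes1_def outcomes_def by (intro finite_cartesian_product finite_indexed; simp)+

definition trim :: "(nat \<Rightarrow> 'a set) \<Rightarrow> nat \<Rightarrow> 'a set" where
  "trim g k = (if k \<in> {1..20} then g k else {})"

lemma stage1_trim: "stage1 u pis R1 \<Longrightarrow> stage1 u (trim pis) (trim R1)"
  by (simp add: stage1_def trim_def)

lemma stage1_outcome:
  assumes "stage1 u pis R1"
  shows "(trim pis, trim R1) \<in> outcomes1"
proof -
  note p = stage1_props[OF assms]
  have "pis k \<subseteq> Pow {0..<n}" if "k \<in> {1..20}" for k
    using family_member[OF p(1) that] part_subset[OF that] by blast
  moreover have "R1 k \<subseteq> {0..<n}" if "k \<in> {1..20}" for k
    using p(3)[OF that] part_subset[OF that] by blast
  ultimately show ?thesis by (simp add: outcomes1_def indexed_def trim_def)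
qed

lemma stage1_total: "\<exists>w\<in>outcomes1. stage1 u (fst w) (snd w)"
proof -
  have "\<exists>p. greedy r n u i {} (part r n i) (fst p) (snd p)" if "i \<in> {1..20}" for i
    using greedy_total[OF finite_part[OF that], of u i "{}"] by auto
  then obtain g where g: "\<And>i. i \<in> {1..20} \<Longrightarrow> greedy r n u i {} (part r n i) (fst (g i)) (snd (g i))"
    by metis
  then have "stage1 u (\<lambda>i. fst (g i)) (\<lambda>i. snd (g i))" by (simp add: stage1_def)
  then show ?thesis using stage1_outcome stage1_trim by (metis fst_conv snd_conv)
qed

lemma run_outcome:
  assumes "(pis, R1) \<in> outcomes1" "run u pis R1 pis2 Pc ch"
  shows "(pis, R1, pis2, Pc, ch) \<in> outcomes"
proof -
  note p = run_props[OF assms(2)]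
  have fam: "family pis" using assms(2) stage1_props(1)[of u pis R1] by (simp add: run_def)
  have sub: "pis2 k \<subseteq> pis k" for k using p(1) by (simp add: matched_def)
  have "pis2 \<in> indexed (Pow (Pow {0..<n}))"
    unfolding indexed_def mem_Collect_eq
  proof (intro allI conjI impI)
    fix k :: nat
    show "pis2 k \<in> Pow (Pow {0..<n})" if "k \<in> {1..20}"
    proof -
      have "pis k \<subseteq> Pow {0..<n}" using assms(1) that by (simp add: outcomes1_def indexed_def)
      then show ?thesis using sub[of k] by (intro PowI) (rule subset_trans)
    qed
    show "pis2 k = {}" if "k \<notin> {1..20}"
    proof -
      have "pis k = {}" using assms(1) that by (simp add: outcomes1_def indexed_def)
      then show ?thesis using sub[of k] by simp
    qed
  qed
  moreover have "Pc \<subseteq> Pow {0..<n}" using p(4) by blast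
  moreover have "ch \<subseteq> {0..<n} \<times> {0..<n}" using p(2) agents_subset[OF fam] by blast
  ultimately show ?thesis using assms(1) by (simp add: outcomes_def outcomes1_def)
qed

lemma run_total:
  assumes "stage1 u pis R1"
  shows "\<exists>pis2 Pc ch. run u pis R1 pis2 Pc ch"
  using assms stage2_total[OF stage1_props(1)[OF assms]] unfolding run_def by blast

lemma stage1_unique:
  assumes "w \<in> outcomes1" "w' \<in> outcomes1" "stage1 u (fst w) (snd w)" "stage1 u (fst w') (snd w')"
  shows "w = w'"
proof -
  have "fst w i = fst w' i \<and> snd w i = snd w' i" for i
  proof (cases "i \<in> {1..20}")
    case True
    then show ?thesis using assms(3,4) greedy_unique[OF finite_part[OF True]] unfolding stage1_def by blast
  next
    case False
    then show ?thesis using assms(1,2) by (auto simp: outcomes1_def indexed_def)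
  qed
  then show ?thesis by (auto simp: prod_eq_iff fun_eq_iff)
qed

definition run_of :: "_ \<Rightarrow> util \<Rightarrow> bool" where
  "run_of w u = (case w of (pis, R1, pis2, Pc, ch) \<Rightarrow> run u pis R1 pis2 Pc ch)"

text \<open>With fixed selection rules and trimmed families all stages are deterministic. This is
  the mutual exclusion that \<open>prob_revealed_le\<close> asks for.\<close>

lemma run_unique:
  assumes "w \<in> outcomes" "w' \<in> outcomes" "run_of w u" "run_of w' u"
  shows "w = w'"
proof -
  obtain pis R1 pis2 Pc ch where w: "w = (pis, R1, pis2, Pc, ch)" by (cases w)
  obtain pis' R1' pis2' Pc' ch' where w': "w' = (pis', R1', pis2', Pc', ch')" by (cases w')
  have 1: "(pis, R1) = (pis', R1')"
    using assms by (intro stage1_unique[of _ _ u]) (auto simp: w w' outcomes_def outcomes1_def run_of_def run_def)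
  have "pis2' = pis2 \<and> Pc' = Pc \<and> ch' = ch"
    by (rule stage2_unique[of u pis "{}" "{}"])
      (use assms 1 in \<open>simp_all add: w w' run_of_def run_def\<close>)
  then show ?thesis using 1 by (simp add: w w')
qed

text \<open>Trimming replaces the existential over arbitrary functions by one over a finite set, as
  measurability and the union bounds require.\<close>

lemma alg_output_iff:
  "alg_output r n u res \<longleftrightarrow> (\<exists>(pis, R1, pis2, Pc, ch)\<in>outcomes. run u pis R1 pis2 Pc ch \<and>
    stage3 r n u ch Pc {} (leftover R1 pis2) res)"
proof
  assume "alg_output r n u res"
  then obtain pis R1 pis2 Pc ch where a: "stage1 u pis R1" "stage2 r n u pis {} {} pis2 Pc ch"
    "stage3 r n u ch Pc {} (leftover R1 pis2) res"
    unfolding alg_output_def stage1_def leftover_def by blast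
  have "\<forall>k\<in>{1..20}. trim pis k = pis k" by (simp add: trim_def)
  then obtain pis2' where pis2': "\<forall>k\<in>{1..20}. pis2' k = pis2 k"
    "stage2 r n u (trim pis) {} {} pis2' Pc ch"
    using stage2_cong[OF a(2)] by blast
  have run: "run u (trim pis) (trim R1) pis2' Pc ch"
    using stage1_trim[OF a(1)] pis2'(2) by (simp add: run_def)
  have "leftover (trim R1) pis2' = leftover R1 pis2"
    using pis2'(1) by (simp add: leftover_def trim_def)
  then show "\<exists>(pis, R1, pis2, Pc, ch)\<in>outcomes. run u pis R1 pis2 Pc ch \<and>
    stage3 r n u ch Pc {} (leftover R1 pis2) res"
    using run run_outcome[OF stage1_outcome[OF a(1)] run] a(3) by fastforce
next
  assume "\<exists>(pis, R1, pis2, Pc, ch)\<in>outcomes. run u pis R1 pis2 Pc ch \<and>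
    stage3 r n u ch Pc {} (leftover R1 pis2) res"
  then show "alg_output r n u res"
    unfolding alg_output_def run_def stage1_def leftover_def by blast
qed

lemma ev_stage1: "ev intra (\<lambda>f. stage1 (curry f) pis R1)"
  unfolding stage1_def
proof (intro ev_ball)
  fix i :: nat assume i: "i \<in> {1..20}"
  show "ev intra (\<lambda>f. greedy r n (curry f) i {} (part r n i) (pis i) (R1 i))"
    by (rule ev_mono[OF ev_greedy[OF finite_part[OF i]]]) (use i in \<open>auto simp: intra_def\<close>)
qed simp

text \<open>If \<open>pis\<close> is not a family, Stage 1 cannot produce it and the event is empty,
  so \<open>ev_stage2\<close> is needed for families only.\<close>

lemma ev_run: "ev (intra \<union> ch \<union> ch\<inverse>) (\<lambda>f. run (curry f) pis R1 pis2 Pc ch)"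
proof (cases "family pis")
  case True
  show ?thesis
    unfolding run_def
    by (intro ev_conj ev_mono[OF ev_stage1] ev_mono[OF ev_stage2[OF True]]) auto
next
  case False
  then show ?thesis using stage1_props(1)
    by (intro ev_cong[OF ev_const[of _ False]]) (auto simp: run_def)
qed

lemma ev_individually_rational: "ev UNIV (\<lambda>f. individually_rational (curry f) P)" if "finite P" "\<forall>C\<in>P. finite C"
  unfolding individually_rational_def using that by (intro ev_ball ev_uset_ge) auto

lemma ev_success: "ev UNIV (\<lambda>f. alg_success r n (curry f))"
proof -
  have "ev UNIV (\<lambda>f. \<exists>P\<in>Pow (Pow {0..<n}). partition_on {0..<n} P \<and>
    (individually_rational (curry f) P \<and> (\<exists>w\<in>outcomes. (case w of (pis, R1, pis2, Pc, ch) \<Rightarrow>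
      run (curry f) pis R1 pis2 Pc ch \<and> stage3 r n (curry f) ch Pc {} (leftover R1 pis2) (Some P)))))"
  proof (intro ev_bex ev_conj ev_conj_const ev_individually_rational finite_outcomes)
    fix P w assume w: "w \<in> outcomes"
    obtain pis R1 pis2 Pc ch where [simp]: "w = (pis, R1, pis2, Pc, ch)" by (cases w)
    have fin: "finite (leftover R1 pis2)" "finite Pc"
    proof -
      have "pis2 k \<subseteq> Pow {0..<n}" "R1 k \<subseteq> {0..<n}" if "k \<in> {1..20}" for k
        using w that by (simp_all add: outcomes_def indexed_def)
      then have "leftover R1 pis2 \<subseteq> {0..<n}" unfolding leftover_def by blast
      moreover have "Pc \<subseteq> Pow {0..<n}" using w by (simp add: outcomes_def)
      ultimately show "finite (leftover R1 pis2)" "finite Pc" by (auto intro: finite_subset)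
    qed
    have "ev UNIV (\<lambda>f. run (curry f) pis R1 pis2 Pc ch \<and>
      stage3 r n (curry f) ch Pc {} (leftover R1 pis2) (Some P))"
      by (intro ev_conj ev_stage3 fin ev_mono[OF ev_run]) simp
    then show "ev UNIV (\<lambda>f. case w of (pis, R1, pis2, Pc, ch) \<Rightarrow>
      run (curry f) pis R1 pis2 Pc ch \<and> stage3 r n (curry f) ch Pc {} (leftover R1 pis2) (Some P))"
      by simp
  qed (auto intro: finite_subset)
  then show ?thesis
  proof (rule ev_cong)
    fix f :: "nat \<times> nat \<Rightarrow> real"
    have "P \<in> Pow (Pow {0..<n})" if "partition_on {0..<n} P" for P
      using that by (auto simp: partition_on_def)
    then show "alg_success r n (curry f) \<longleftrightarrow> (\<exists>P\<in>Pow (Pow {0..<n}). partition_on {0..<n} P \<and>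
    (individually_rational (curry f) P \<and> (\<exists>w\<in>outcomes. (case w of (pis, R1, pis2, Pc, ch) \<Rightarrow>
      run (curry f) pis R1 pis2 Pc ch \<and> stage3 r n (curry f) ch Pc {} (leftover R1 pis2) (Some P)))))"
      unfolding alg_success_def alg_output_iff by blast
  qed
qed

section \<open>Placing the leftover agents\<close>

text \<open>Not being stuck leaves one family with fewer than \<open>t\<close> cliques. A coalition
  takes exactly one clique from every family and the parts have nearly equal size, so this family
  fixes \<open>card Pc * s\<close> up to small errors, and the other 19 cannot have many more
  cliques left. One \<open>20 * m\<close> counts the agents left by Stage 1, the other enters
  through this comparison.\<close>

lemma run_sizes:
  assumes run: "run u pis R1 pis2 Pc ch" and t: "0 < t" and m: "\<And>i. i \<in> {1..20} \<Longrightarrow> card (R1 i) < m"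
    and ns: "\<not> stuck r n u t pis"
  shows "real (card (leftover R1 pis2)) \<le> 40 * real m + 40 + 20 * real t * real s"
    "real n / 20 - 1 - real m - real t * real s \<le> real (card Pc) * real s"
proof -
  have s1: "stage1 u pis R1" and s2: "stage2 r n u pis {} {} pis2 Pc ch"
    using run by (auto simp: run_def)
  note p = stage1_props[OF s1] and mt = run_props(1)[OF run]
  have fam2: "family pis2" using mt by (simp add: matched_def)
  have card_Un: "real (card (\<Union>(ps k))) = card (ps k) * real s" if "family ps" "k \<in> {1..20}" for ps k
  proof -
    have "card (\<Union>(ps k)) = (\<Sum>C\<in>ps k. card C)"
      using that family_finite_member[OF that(1,2)]
      by (intro card_Union_disjoint) (auto simp: family_def disjoint_def pairwise_def disjnt_def)
    also have "\<dots> = card (ps k) * s" using family_member[OF that] by simp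
    finally show ?thesis by simp
  qed
  have N: "card (pis k) * real s + card (R1 k) \<le> real n / 20 + 1"
    "real n / 20 - 1 \<le> card (pis k) * real s + card (R1 k)" if k: "k \<in> {1..20}" for k
  proof -
    have sub: "\<Union>(pis k) \<subseteq> part r n k" using family_member[OF p(1) k] by blast
    have "card (R1 k) = card (part r n k) - card (\<Union>(pis k))"
      unfolding p(3)[OF k] using sub finite_part[OF k] by (intro card_Diff_subset finite_subset[OF sub])
    moreover have "card (\<Union>(pis k)) \<le> card (part r n k)" using sub finite_part[OF k] by (intro card_mono)
    ultimately have "card (pis k) * real s + card (R1 k) = real (card (part r n k))"
      using card_Un[OF p(1) k] by simp
    moreover have "card (part r n k) = n div 20 \<or> card (part r n k) = (n + 19) div 20"
      using card_part[OF k] by simp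
    moreover have "real n / 20 - 1 \<le> real (n div 20)" "real (n div 20) \<le> real n / 20 + 1"
      "real n / 20 - 1 \<le> real ((n + 19) div 20)" "real ((n + 19) div 20) \<le> real n / 20 + 1"
      by linarith+
    ultimately show "card (pis k) * real s + card (R1 k) \<le> real n / 20 + 1"
      "real n / 20 - 1 \<le> card (pis k) * real s + card (R1 k)" by auto
  qed
  have T: "card (pis k) * real s = card (pis2 k) * real s + card Pc * real s" if "k \<in> {1..20}" for k
  proof -
    have "card (pis k) = card (pis2 k) + card Pc" using mt that by (simp add: matched_def)
    then show ?thesis by (simp add: distrib_right)
  qed
  have m': "real (card (R1 k)) \<le> real m" if "k \<in> {1..20}" for k using m[OF that] by simp
  have "\<exists>k\<in>{1..20}. card (pis2 k) < t"
    using stage2_stuck[OF s2 _ t] ns by (meson not_less)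
  then obtain k where k: "k \<in> {1..20}" "card (pis2 k) < t" by blast
  have tk: "card (pis2 k) * real s \<le> real t * real s" using k(2) by (intro mult_right_mono) auto
  show Ts: "real n / 20 - 1 - real m - real t * real s \<le> real (card Pc) * real s"
    using N(2)[OF k(1)] T[OF k(1)] tk m'[OF k(1)] by linarith
  have rest: "card (pis2 j) * real s \<le> 2 + real m + real t * real s" if j: "j \<in> {1..20}" for j
    using N(1)[OF j] T[OF j] Ts by linarith
  have "card (leftover R1 pis2) \<le> card (\<Union>i\<in>{1..20}. R1 i) + card (\<Union>k\<in>{1..20}. \<Union>(pis2 k))"
    unfolding leftover_def by (rule card_Un_le)
  also have "\<dots> \<le> (\<Sum>i\<in>{1..20}. card (R1 i)) + (\<Sum>k\<in>{1..20}. card (\<Union>(pis2 k)))"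
    by (intro add_mono card_UN_le) auto
  finally have "real (card (leftover R1 pis2))
    \<le> (\<Sum>i\<in>{1..20::nat}. real (card (R1 i))) + (\<Sum>k\<in>{1..20::nat}. real (card (\<Union>(pis2 k))))"
    by (simp flip: of_nat_sum of_nat_add)
  also have "\<dots> \<le> (\<Sum>i\<in>{1..20::nat}. real m) + (\<Sum>k\<in>{1..20::nat}. 2 + real m + real t * real s)"
    using m' rest card_Un[OF fam2] by (intro add_mono sum_mono) simp_all
  finally show "real (card (leftover R1 pis2)) \<le> 40 * real m + 40 + 20 * real t * real s"
    by (simp add: algebra_simps)
qed

text \<open>An agent outside all cliques was never checked. For an agent of a leftover clique
  \<open>C\<close>, every coalition it was checked against contains a clique in conflict with
  \<open>C\<close>; coalitions are disjoint, so these cliques differ and the blocked coalitions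
  inject into the conflicts of \<open>C\<close>.\<close>

lemma run_unblocked:
  assumes run: "run u pis R1 pis2 Pc ch" and nc: "\<not> crowded pis h u" and x: "x \<in> leftover R1 pis2"
  shows "card Pc \<le> card {P\<in>Pc. no_check ch x P} + h"
proof -
  note rp = run_props[OF run]
  have fam: "family pis" using run stage1_props(1)[of u pis R1] by (simp add: run_def)
  have mt: "finite Pc" "disjoint Pc" "\<And>k. pis2 k \<subseteq> pis k"
    using rp(1) by (auto simp: matched_def)
  have confl: "\<And>P C y. P \<in> Pc \<Longrightarrow> C \<in> members pis2 \<Longrightarrow> y \<in> C \<Longrightarrow> \<not> no_check ch y P \<Longrightarrow>
      \<exists>D\<in>members pis. D \<subseteq> P \<and> conflict u D C"
    using rp(1) unfolding matched_def by blast
  let ?B = "{P\<in>Pc. \<not> no_check ch x P}"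
  have "card ?B \<le> h"
  proof (cases "x \<in> agents pis")
    case False
    then have "?B = {}" using rp(2) unfolding no_check_def by blast
    then have "card ?B = 0" by (simp only: card.empty)
    then show ?thesis by (simp only: le0)
  next
    case True
    then have "x \<in> agents pis2" using x rp(5) by blast
    then obtain C where C: "C \<in> members pis2" "x \<in> C" unfolding agents_def by blast
    have "\<forall>P\<in>?B. \<exists>D. D \<in> members pis \<and> D \<subseteq> P \<and> conflict u D C" using confl C by blast
    then obtain g where g: "\<And>P. P \<in> ?B \<Longrightarrow> g P \<in> members pis \<and> g P \<subseteq> P \<and> conflict u (g P) C"
      by metis
    have "inj_on g ?B"
    proof (rule inj_onI)
      fix P Q assume PQ: "P \<in> ?B" "Q \<in> ?B" "g P = g Q"
      obtain y where "y \<in> g P" using member_props[OF fam] g[OF PQ(1)] by blast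
      then have "y \<in> P \<inter> Q" using g[OF PQ(1)] g[OF PQ(2)] PQ(3) by blast
      then show "P = Q" using disjointD[OF mt(2)] PQ(1,2) by blast
    qed
    moreover have "g ` ?B \<subseteq> {D\<in>members pis. conflict u D C}" using g by blast
    ultimately have "card ?B \<le> card {D\<in>members pis. conflict u D C}"
      using finite_members[OF fam] by (intro card_inj_on_le) auto
    moreover have "C \<in> members pis" using C(1) mt(3) unfolding members_def by blast
    ultimately show ?thesis using nc unfolding crowded_def by (meson le_trans linear)
  qed
  moreover have "Pc = {P\<in>Pc. no_check ch x P} \<union> ?B" by blast
  then have "card Pc \<le> card {P\<in>Pc. no_check ch x P} + card ?B"
    using card_Un_le[of "{P\<in>Pc. no_check ch x P}" ?B] by simp
  ultimately show ?thesis by linarith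
qed

text \<open>The utilities of \<open>x\<close> towards \<open>P\<close> that Stage 1 cannot have
  read. For coalitions satisfying \<open>no_check\<close> Stage 2 has not read them either.\<close>

definition fresh :: "nat \<Rightarrow> nat set \<Rightarrow> (nat \<times> nat) set" where
  "fresh x P = {x} \<times> {y\<in>P. (x, y) \<notin> intra}"

lemma own_part:
  assumes "x < n"
  obtains i where "i \<in> {1..20}" "x \<in> part r n i" "\<And>P. P \<subseteq> {0..<n} \<Longrightarrow> {y\<in>P. (x, y) \<in> intra} = P \<inter> part r n i"
proof -
  obtain i where i: "i \<in> {1..20}" "x \<in> part r n i" using Un_part assms by (metis UN_E atLeast0LessThan lessThan_iff)
  show thesis
  proof (rule that[OF i])
    fix P
    show "{y\<in>P. (x, y) \<in> intra} = P \<inter> part r n i"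
      using i part_unique[OF _ i(1) _ i(2)] unfolding intra_def by blast
  qed
qed

text \<open>Equals \<open>(1/2) ^ (2 * s + 2) / 2\<close>, the bound of \<open>prob_sum_ge\<close>
  for a block of \<open>2 * s + 2\<close> coordinates.\<close>

definition place_prob :: real where
  "place_prob = (1/4) ^ (s + 1) / 2"

text \<open>\<open>P\<close> has \<open>20 * s\<close> members, of which \<open>19 * s\<close> lie
  outside the part of \<open>x\<close>. A block \<open>J\<close> of \<open>2 * s + 2\<close> of
  these pushes the sum to \<open>card J / 2 = s + 1\<close>, which is strictly above
  \<open>s\<close>.\<close>

lemma prob_fresh:
  assumes x: "x < n" "x \<notin> P" and P: "P \<subseteq> {0..<n}" "\<And>k. k \<in> {1..20} \<Longrightarrow> card (P \<inter> part r n k) = s"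
  shows "\<P>(f in G. (\<Sum>j\<in>fresh x P. f j) \<le> s) \<le> 1 - place_prob"
proof -
  obtain i where i: "i \<in> {1..20}" "{y\<in>P. (x, y) \<in> intra} = P \<inter> part r n i"
    using own_part[OF x(1)] P(1) by metis
  have fP: "finite P" using P(1) by (rule finite_subset) simp
  have "P = (\<Union>k\<in>{1..20}. P \<inter> part r n k)" using P(1) Un_part by blast
  then have "card P = card (\<Union>k\<in>{1..20}. P \<inter> part r n k)" by simp
  also have "\<dots> = (\<Sum>k\<in>{1..20}. card (P \<inter> part r n k))"
  proof (rule card_UN_disjoint)
    show "\<forall>k\<in>{1..20}. \<forall>l\<in>{1..20}. k \<noteq> l \<longrightarrow> (P \<inter> part r n k) \<inter> (P \<inter> part r n l) = {}"
      using disjoint_part by blast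
  qed (use fP in auto)
  also have "\<dots> = 20 * s" using P(2) by simp
  finally have cP: "card P = 20 * s" .
  have "{y\<in>P. (x, y) \<notin> intra} = P - {y\<in>P. (x, y) \<in> intra}" by blast
  then have "card {y\<in>P. (x, y) \<notin> intra} = 20 * s - s"
    using fP i(2) P(2)[OF i(1)] cP by (simp add: card_Diff_subset)
  then have cf: "card (fresh x P) = 19 * s" by (simp add: fresh_def card_cartesian_product)
  have ff: "finite (fresh x P)" using fP by (simp add: fresh_def)
  \<comment> \<open>True from \<open>s = 1\<close> on, since
    \<open>19 * s - 2 * s \<ge> 17\<close>.\<close>
  have le: "2 * s + 2 \<le> card (fresh x P)" using cf spar_pos by linarith
  obtain J where J: "J \<subseteq> fresh x P" "card J = 2 * s + 2"
    by (rule obtain_subset_with_card_n[OF le]) metis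
  have sub: "fresh x P \<subseteq> offdiag n"
  proof
    fix j assume "j \<in> fresh x P"
    then obtain y where "j = (x, y)" "y \<in> P" unfolding fresh_def by blast
    moreover have "y < n" "x \<noteq> y" using \<open>y \<in> P\<close> P(1) x(2) by auto
    ultimately show "j \<in> offdiag n" using x(1) by (simp add: offdiag_def)
  qed
  have un: "J \<union> (fresh x P - J) = fresh x P" using J(1) by blast
  have "(1/2) ^ card J / 2 \<le> \<P>(f in G. card J / 2 \<le> (\<Sum>j\<in>J \<union> (fresh x P - J). f j))"
    using J(1) sub by (intro prob_sum_ge) blast+
  also have "(1/2 :: real) ^ card J / 2 = place_prob"
  proof -
    have "(1/2 :: real) ^ (2 * (s + 1)) = ((1/2)\<^sup>2) ^ (s + 1)" by (rule power_mult)
    also have "(1/2 :: real)\<^sup>2 = 1/4" by (simp add: power2_eq_square)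
    finally show ?thesis unfolding J(2) place_prob_def by simp
  qed
  finally have ge: "place_prob \<le> \<P>(f in G. real s + 1 \<le> (\<Sum>j\<in>fresh x P. f j))"
  proof -
    have "real (2 * s + 2) / 2 = real s + 1" by simp
    then show "place_prob \<le> \<P>(f in G. card J / 2 \<le> (\<Sum>j\<in>J \<union> (fresh x P - J). f j)) \<Longrightarrow>
      place_prob \<le> \<P>(f in G. real s + 1 \<le> (\<Sum>j\<in>fresh x P. f j))"
      unfolding un J(2) by (simp only:)
  qed
  have ev: "ev UNIV (\<lambda>f. real s + 1 \<le> (\<Sum>j\<in>fresh x P. f j))"
    using ev_sum[of "{real s + 1..}" "fresh x P" UNIV] by simp
  have "\<P>(f in G. (\<Sum>j\<in>fresh x P. f j) \<le> s) \<le> \<P>(f in G. \<not> real s + 1 \<le> (\<Sum>j\<in>fresh x P. f j))"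
    by (rule prob_mono_ev[OF ev_not[OF ev]]) simp
  also have "\<dots> = 1 - \<P>(f in G. real s + 1 \<le> (\<Sum>j\<in>fresh x P. f j))"
    by (rule prob_neg[OF ev_sets[OF ev]])
  finally show ?thesis using ge by linarith
qed

text \<open>Asks for a sum above \<open>s\<close> over unread pairs rather than for positive
  utility, since the latter involves pairs read in Stage 1. The margin \<open>s\<close> covers the
  worst case of these pairs.\<close>

definition starved :: "(nat \<Rightarrow> nat set) \<Rightarrow> (nat \<Rightarrow> nat set set) \<Rightarrow> nat set set \<Rightarrow> (nat \<times> nat) set \<Rightarrow>
    (nat \<times> nat \<Rightarrow> real) \<Rightarrow> bool" where
  "starved R1 pis2 Pc ch f \<longleftrightarrow> (\<exists>x\<in>leftover R1 pis2.
     card {P\<in>{P\<in>Pc. no_check ch x P}. real s < (\<Sum>j\<in>fresh x P. f j)} < card (leftover R1 pis2))"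

text \<open>What is known about a good outcome of Stages 1 and 2 without mentioning utilities, so
  that \<open>starved\<close> can be bounded for each fixed outcome.\<close>

definition roomy :: "nat \<Rightarrow> nat \<Rightarrow> (nat \<Rightarrow> nat set) \<Rightarrow> (nat \<Rightarrow> nat set set) \<Rightarrow> nat set set \<Rightarrow>
    (nat \<times> nat) set \<Rightarrow> bool" where
  "roomy l0 c0 R1 pis2 Pc ch \<longleftrightarrow> leftover R1 pis2 \<inter> \<Union>Pc = {} \<and> leftover R1 pis2 \<union> \<Union>Pc = {0..<n} \<and>
     disjoint Pc \<and> (\<forall>P\<in>Pc. \<forall>k\<in>{1..20}. card (P \<inter> part r n k) = s) \<and>
     card (leftover R1 pis2) \<le> l0 \<and> (\<forall>x\<in>leftover R1 pis2. c0 \<le> card {P\<in>Pc. no_check ch x P})"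

lemma ev_starved:
  assumes "finite (leftover R1 pis2)" "finite Pc"
  shows "ev (- (intra \<union> ch \<union> ch\<inverse>)) (starved R1 pis2 Pc ch)"
proof -
  have "ev (- (intra \<union> ch \<union> ch\<inverse>)) (\<lambda>f. \<exists>x\<in>leftover R1 pis2.
     card {P\<in>{P\<in>Pc. no_check ch x P}. real s < (\<Sum>j\<in>fresh x P. f j)} < card (leftover R1 pis2))"
  proof (intro ev_bex ev_card[where R="\<lambda>m. m < card (leftover R1 pis2)"] assms)
    fix x P assume "P \<in> {P \<in> Pc. no_check ch x P}"
    then have "fresh x P \<subseteq> - (intra \<union> ch \<union> ch\<inverse>)" by (auto simp: fresh_def no_check_def)
    then show "ev (- (intra \<union> ch \<union> ch\<inverse>)) (\<lambda>f. real s < (\<Sum>j\<in>fresh x P. f j))"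
      using ev_sum[of "{real s<..}" "fresh x P"] by simp
  qed (use assms in simp)
  then show ?thesis by (rule ev_cong) (simp add: starved_def)
qed

definition place_bound :: "nat \<Rightarrow> nat \<Rightarrow> real" where
  "place_bound l0 c0 = n * (real n ^ l0 * (1 - place_prob) ^ (c0 - l0))"

lemma place_prob_01: "0 \<le> place_prob" "place_prob \<le> 1"
proof -
  have "(1/4 :: real) ^ (s + 1) \<le> 1" by (rule power_le_one) auto
  then show "0 \<le> place_prob" "place_prob \<le> 1" by (simp_all add: place_prob_def)
qed

text \<open>If fewer than \<open>card ?X\<close> unchecked coalitions accept, then all but at most
  \<open>l0\<close> of them reject, and by symmetry of the binomial there are at most
  \<open>n ^ l0\<close> ways to choose the rejecting ones.\<close>

lemma prob_starved:
  assumes "roomy l0 c0 R1 pis2 Pc ch"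
  shows "\<P>(f in G. starved R1 pis2 Pc ch f) \<le> place_bound l0 c0"
proof -
  let ?X = "leftover R1 pis2"
  have sub: "?X \<subseteq> {0..<n}" "\<Union>Pc \<subseteq> {0..<n}" and disj: "?X \<inter> \<Union>Pc = {}" and dPc: "disjoint Pc"
    and cut: "\<And>P k. P \<in> Pc \<Longrightarrow> k \<in> {1..20} \<Longrightarrow> card (P \<inter> part r n k) = s"
    and l0: "card ?X \<le> l0" and c0: "\<And>x. x \<in> ?X \<Longrightarrow> c0 \<le> card {P\<in>Pc. no_check ch x P}"
    using assms by (auto simp: roomy_def)
  have fX: "finite ?X" using sub(1) by (rule finite_subset) simp
  have fPc: "finite Pc" using sub(2) by (intro finite_subset[of Pc "Pow {0..<n}"]) auto
  have cPc: "card Pc \<le> n"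
  proof -
    have "\<forall>P\<in>Pc. \<exists>y. y \<in> P"
    proof
      fix P assume "P \<in> Pc"
      then have "card (P \<inter> part r n 1) = s" by (rule cut) simp
      then have "P \<inter> part r n 1 \<noteq> {}" using spar_pos by auto
      then show "\<exists>y. y \<in> P" by blast
    qed
    then obtain g where g: "\<And>P. P \<in> Pc \<Longrightarrow> g P \<in> P" by metis
    have "inj_on g Pc"
    proof (rule inj_onI)
      fix P Q assume PQ: "P \<in> Pc" "Q \<in> Pc" "g P = g Q"
      then have "g P \<in> P \<inter> Q" using g[OF PQ(1)] g[OF PQ(2)] by simp
      then show "P = Q" using disjointD[OF dPc PQ(1,2)] by blast
    qed
    moreover have "g ` Pc \<subseteq> {0..<n}" using g sub(2) by blast
    ultimately have "card Pc \<le> card {0..<n}" by (intro card_inj_on_le) auto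
    then show ?thesis by simp
  qed
  let ?L = "\<lambda>x P f. (\<Sum>j\<in>fresh x P. f j) \<le> real s"
  have evL: "ev (fresh x P) (?L x P)" for x P
    using ev_sum[of "{..real s}" "fresh x P" "fresh x P"] by simp
  have "\<P>(f in G. starved R1 pis2 Pc ch f) \<le> card ?X * (real n ^ l0 * (1 - place_prob) ^ (c0 - l0))"
    unfolding starved_def
  proof (rule prob_bex_le_card[OF fX])
    fix x assume x: "x \<in> ?X"
    let ?T = "{P\<in>Pc. no_check ch x P}"
    let ?h = "card ?T - l0"
    have fT: "finite ?T" using fPc by simp
    have evgt: "ev UNIV (\<lambda>f. real s < (\<Sum>j\<in>fresh x P. f j))" for P
      using ev_sum[of "{real s<..}" "fresh x P" UNIV] by simp
    show "ev UNIV (\<lambda>f. card {P\<in>?T. real s < (\<Sum>j\<in>fresh x P. f j)} < card ?X)"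
      using fT by (intro ev_card[where R="\<lambda>m. m < card ?X"] evgt)
    have "\<P>(f in G. card {P\<in>?T. real s < (\<Sum>j\<in>fresh x P. f j)} < card ?X)
      \<le> \<P>(f in G. ?h \<le> card {P\<in>?T. ?L x P f})"
    proof (rule prob_mono_ev)
      show "ev UNIV (\<lambda>f. ?h \<le> card {P\<in>?T. ?L x P f})"
        using fT by (intro ev_card[where R="\<lambda>m. ?h \<le> m"] ev_mono[OF evL]) auto
      fix f assume less: "card {P\<in>?T. real s < (\<Sum>j\<in>fresh x P. f j)} < card ?X"
      have "card ?T \<le> card ({P\<in>?T. real s < (\<Sum>j\<in>fresh x P. f j)} \<union> {P\<in>?T. ?L x P f})"
        using fPc by (intro card_mono) auto
      also have "\<dots> \<le> card {P\<in>?T. real s < (\<Sum>j\<in>fresh x P. f j)} + card {P\<in>?T. ?L x P f}"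
        by (rule card_Un_le)
      finally show "?h \<le> card {P\<in>?T. ?L x P f}" using less l0 by linarith
    qed
    also have "\<dots> \<le> (card ?T choose ?h) * (1 - place_prob) ^ ?h"
    proof (rule prob_card_ge_le[OF fT evL])
      show "disjoint_family_on (fresh x) ?T"
        unfolding disjoint_family_on_def
      proof (intro ballI impI)
        fix P Q assume PQ: "P \<in> ?T" "Q \<in> ?T" "P \<noteq> Q"
        then have "P \<inter> Q = {}" using disjointD[OF dPc] by blast
        then show "fresh x P \<inter> fresh x Q = {}" by (auto simp: fresh_def)
      qed
      fix P assume "P \<in> ?T"
      then have P: "P \<in> Pc" by simp
      have "x < n" "x \<notin> P" "P \<subseteq> {0..<n}" using x sub disj P by auto
      then show "\<P>(f in G. ?L x P f) \<le> 1 - place_prob"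
        by (rule prob_fresh) (rule cut[OF P])
    qed
    also have "\<dots> \<le> real n ^ l0 * (1 - place_prob) ^ (c0 - l0)"
    proof (rule mult_mono)
      have "card ?T \<le> n" using card_mono[OF fPc, of ?T] cPc by auto
      have "0 < n" using x sub by fastforce
      show "real (card ?T choose ?h) \<le> real n ^ l0"
      proof (cases "l0 \<le> card ?T")
        case True
        have "card ?T choose ?h = card ?T choose l0" using binomial_symmetric[OF True] by simp
        also have "\<dots> \<le> card ?T ^ l0" by (rule binomial_le_pow[OF True])
        also have "\<dots> \<le> n ^ l0" using \<open>card ?T \<le> n\<close> by (rule power_mono) simp
        finally show ?thesis by (metis of_nat_le_iff of_nat_power)
      next
        case False
        \<comment> \<open>Here truncated subtraction makes \<open>?h\<close> zero, so the binomial
          coefficient is 1.\<close>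
        then show ?thesis using \<open>0 < n\<close> by (simp add: Suc_le_eq)
      qed
      show "(1 - place_prob) ^ ?h \<le> (1 - place_prob) ^ (c0 - l0)"
        using c0[OF x] place_prob_01 by (intro power_decreasing diff_le_mono) auto
    qed (use place_prob_01 in auto)
    finally show "\<P>(f in G. card {P\<in>?T. real s < (\<Sum>j\<in>fresh x P. f j)} < card ?X)
      \<le> real n ^ l0 * (1 - place_prob) ^ (c0 - l0)" .
  qed
  also have "\<dots> \<le> place_bound l0 c0"
    unfolding place_bound_def
  proof (rule mult_right_mono)
    show "real (card ?X) \<le> real n" using card_mono[OF _ sub(1)] by simp
  qed (use place_prob_01 in auto)
  finally show ?thesis .
qed

text \<open>The deterministic core of Stage 3: an agent that is not starved finds enough coalitions
  of positive utility, and \<open>stage3_success\<close> applies.\<close>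

lemma run_success:
  assumes run: "run (curry f) pis R1 pis2 Pc ch" and out: "(pis, R1, pis2, Pc, ch) \<in> outcomes"
    and fed: "\<not> starved R1 pis2 Pc ch f" and s6: "6 \<le> s"
    and bounded: "\<forall>j\<in>offdiag n. f j \<in> {-1..1}"
  shows "alg_success r n (curry f)"
proof -
  let ?X = "leftover R1 pis2" and ?u = "curry f"
  note rp = run_props[OF run]
  have mt: "finite Pc" "disjoint Pc" "\<And>P k. P \<in> Pc \<Longrightarrow> k \<in> {1..20} \<Longrightarrow> card (P \<inter> part r n k) = s"
    "\<And>P a. P \<in> Pc \<Longrightarrow> a \<in> P \<Longrightarrow> (real s - 1) / 2 - real s / 4 \<le> uset ?u a P"
    using rp(1) by (auto simp: matched_def)
  have sub: "?X \<subseteq> {0..<n}" "\<Union>Pc \<subseteq> {0..<n}" using rp(4) by auto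
  have fin: "finite ?X" using sub(1) by (rule finite_subset) simp
  have finP: "finite P" if "P \<in> Pc" for P using sub(2) that by (intro finite_subset[of P "{0..<n}"]) auto
  have ge: "-1 \<le> f (a, b)" if "a \<noteq> b" "a < n" "b < n" for a b
    using bounded that by (auto simp: offdiag_def)
  have gain: "0 < uset ?u x P" if x: "x \<in> ?X" and P: "P \<in> Pc" and big: "real s < (\<Sum>j\<in>fresh x P. f j)" for x P
  proof -
    have xn: "x < n" "x \<notin> P" "P \<subseteq> {0..<n}" using x P sub rp(3) by auto
    obtain i where i: "i \<in> {1..20}" "{y\<in>P. (x, y) \<in> intra} = P \<inter> part r n i"
      using own_part[OF xn(1)] xn(3) by metis
    let ?own = "{y\<in>P. (x, y) \<in> intra}" and ?new = "{y\<in>P. (x, y) \<notin> intra}"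
    have "fresh x P = Pair x ` ?new" by (auto simp: fresh_def)
    then have fr: "(\<Sum>j\<in>fresh x P. f j) = (\<Sum>y\<in>?new. f (x, y))"
      by (simp add: sum.reindex inj_on_def)
    \<comment> \<open>The own part contributes exactly \<open>s\<close> members of \<open>P\<close>,
      each counted with the worst case -1.\<close>
    have "- real s = (\<Sum>y\<in>?own. -1)" using i mt(3)[OF P i(1)] by simp
    also have "\<dots> \<le> (\<Sum>y\<in>?own. f (x, y))"
      using xn by (intro sum_mono ge) auto
    finally have "0 < (\<Sum>y\<in>?own. f (x, y)) + (\<Sum>y\<in>?new. f (x, y))" using big fr by linarith
    also have "\<dots> = (\<Sum>y\<in>?own \<union> ?new. f (x, y))"
      using finP[OF P] by (intro sum.union_disjoint[symmetric]) auto
    also have "?own \<union> ?new = P" by blast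
    finally show ?thesis using xn(2) by (simp add: uset_notin)
  qed
  have many: "\<forall>x\<in>?X. card ?X \<le> card {P\<in>Pc. 0 < uset ?u x P \<and> no_check ch x P}"
  proof
    fix x assume x: "x \<in> ?X"
    have "card ?X \<le> card {P\<in>{P\<in>Pc. no_check ch x P}. real s < (\<Sum>j\<in>fresh x P. f j)}"
      using fed x unfolding starved_def by (meson not_less)
    also have "\<dots> \<le> card {P\<in>Pc. 0 < uset ?u x P \<and> no_check ch x P}"
      using mt(1) gain[OF x] by (intro card_mono) auto
    finally show "card ?X \<le> card {P\<in>Pc. 0 < uset ?u x P \<and> no_check ch x P}" .
  qed
  have IR: "1 \<le> uset ?u a P" if "P \<in> Pc" "a \<in> P" for P a
  proof -
    have "6 \<le> real s" using s6 by simp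
    \<comment> \<open>The right-hand side is \<open>s / 4 - 1 / 2\<close>, which equals 1 at
      \<open>s = 6\<close>.\<close>
    then have "1 \<le> (real s - 1) / 2 - real s / 4" by (simp add: field_simps)
    then show ?thesis using mt(4)[OF that] by linarith
  qed
  have "{} \<notin> Pc"
  proof
    assume "{} \<in> Pc"
    then have "card ({} \<inter> part r n 1) = s" by (rule mt(3)) simp
    then show False using spar_pos by simp
  qed
  moreover have "\<forall>P\<in>Pc. \<forall>a\<in>P. \<forall>x\<in>?X. -1 \<le> ?u a x"
  proof (intro ballI)
    fix P a x assume *: "P \<in> Pc" "a \<in> P" "x \<in> ?X"
    then have "a < n" "x < n" "a \<noteq> x" using sub rp(3) by auto
    then show "-1 \<le> ?u a x" using ge by simp
  qed
  ultimately have "\<exists>P. stage3 r n ?u ch Pc {} ?X (Some P) \<and> partition_on (\<Union>(Pc \<union> {}) \<union> ?X) P \<and>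
      individually_rational ?u P"
    using fin mt(1,2) many rp(3) finP IR
    by (intro stage3_success) (auto simp: individually_rational_def Int_commute)
  then obtain P where P: "stage3 r n ?u ch Pc {} ?X (Some P)" "partition_on (\<Union>Pc \<union> ?X) P"
    "individually_rational ?u P" by auto
  have "\<Union>Pc \<union> ?X = {0..<n}" using rp(4) by blast
  moreover have "alg_output r n ?u (Some P)" unfolding alg_output_iff using out run P(1) by blast
  ultimately show ?thesis using P unfolding alg_success_def by auto
qed

text \<open>Almost surely a run without success shows one of three failures: \<open>m\<close> or
  more agents of a part left by Stage 1 (\<open>?B1\<close>), stuck or crowded families
  (\<open>?B2\<close>), or a starved agent (\<open>?B3\<close>). The second is bounded with the
  outcome of Stage 1 revealed, the third with the outcomes of Stages 1 and 2 revealed.\<close>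

lemma prob_success:
  assumes s6: "6 \<le> s" and cb: "20 * conflict_bound \<le> 1/2" and m: "0 < m" and t: "0 < t"
    and l0: "40 * m + 40 + 20 * t * s \<le> l0"
    and c0: "real (c0 + h) * real s \<le> real n / 20 - 1 - real m - real t * real s"
  shows "1 - (20 * (n * short_bound m) + (n * stuck_bound t + n * (2 ^ (n div s) * conflict_bound ^ h)) +
      place_bound l0 c0) \<le> \<P>(f in G. alg_success r n (curry f))"
proof -
  let ?S = "\<lambda>f. alg_success r n (curry f)"
  let ?L = "\<lambda>i f. \<exists>pf Rf. greedy r n (curry f) i {} (part r n i) pf Rf \<and> m \<le> card Rf"
  let ?B1 = "\<lambda>f. \<exists>i\<in>{1..20}. ?L i f"
  let ?W2 = "{w\<in>outcomes1. family (fst w)}"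
  let ?B2 = "\<lambda>f. \<exists>w\<in>?W2. stage1 (curry f) (fst w) (snd w) \<and>
    (stuck r n (curry f) t (fst w) \<or> crowded (fst w) h (curry f))"
  let ?starved = "\<lambda>w. case w of (pis, R1, pis2, Pc, ch) \<Rightarrow> starved R1 pis2 Pc ch"
  let ?seen = "\<lambda>w. case w of (pis, R1, pis2, Pc, ch) \<Rightarrow> intra \<union> ch \<union> ch\<inverse>"
  let ?W3 = "{w\<in>outcomes. case w of (pis, R1, pis2, Pc, ch) \<Rightarrow> roomy l0 c0 R1 pis2 Pc ch}"
  let ?B3 = "\<lambda>f. \<exists>w\<in>?W3. run_of w (curry f) \<and> ?starved w f"
  have p0: "0 \<le> conflict_bound" by (simp add: conflict_bound_def)
  have evL: "ev UNIV (?L i)" if "i \<in> {1..20}" for i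
    by (rule ev_mono[OF ev_greedy_large[OF finite_part[OF that]]]) simp
  have ev1: "ev UNIV ?B1" using evL by (intro ev_bex) auto
  have fW2: "finite ?W2" using finite_outcomes1 by simp
  have ev_sc: "ev (- intra) (\<lambda>f. stuck r n (curry f) t (fst w) \<or> crowded (fst w) h (curry f))"
    if "w \<in> ?W2" for w
    using that by (intro ev_disj ev_mono[OF ev_stuck] ev_mono[OF ev_crowded]) auto
  have ev2: "ev UNIV ?B2"
    by (intro ev_bex[OF fW2] ev_conj ev_mono[OF ev_stage1] ev_mono[OF ev_sc]) auto
  have fW3: "finite ?W3" using finite_outcomes by simp
  have ev_run_of: "ev (?seen w) (\<lambda>f. run_of w (curry f))" for w
    using ev_run by (cases w) (simp add: run_of_def)
  have ev_st: "ev (- ?seen w) (?starved w)" if w: "w \<in> ?W3" for w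
  proof -
    obtain pis R1 pis2 Pc ch where [simp]: "w = (pis, R1, pis2, Pc, ch)" by (cases w)
    have "roomy l0 c0 R1 pis2 Pc ch" using w by simp
    then have "leftover R1 pis2 \<subseteq> {0..<n}" "\<Union>Pc \<subseteq> {0..<n}" by (auto simp: roomy_def)
    then have "finite (leftover R1 pis2)" "finite Pc"
      using finite_subset[of Pc "Pow {0..<n}"] by (auto intro: finite_subset)
    then show ?thesis using ev_starved by simp
  qed
  have ev3: "ev UNIV ?B3"
    by (intro ev_bex[OF fW3] ev_conj ev_mono[OF ev_run_of] ev_mono[OF ev_st]) auto

  have B1: "\<P>(f in G. ?B1 f) \<le> 20 * (n * short_bound m)"
  proof -
    have "\<P>(f in G. ?B1 f) \<le> card {1..20::nat} * (n * short_bound m)"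
    proof (rule prob_bex_le_card[OF _ evL])
      fix i :: nat assume i: "i \<in> {1..20}"
      have "\<P>(f in G. ?L i f) \<le> card (part r n i) * short_bound m"
        by (rule prob_greedy_large[OF m part_subset[OF i]])
      also have "\<dots> \<le> n * short_bound m"
        using card_mono[OF _ part_subset[OF i]] short_bound_nonneg by (intro mult_right_mono) auto
      finally show "\<P>(f in G. ?L i f) \<le> n * short_bound m" .
    qed auto
    then show ?thesis by simp
  qed
  have B2: "\<P>(f in G. ?B2 f) \<le> n * stuck_bound t + n * (2 ^ (n div s) * conflict_bound ^ h)"
  proof (rule prob_revealed_le[OF fW2 ev_stage1 ev_sc])
    show "0 \<le> n * stuck_bound t + n * (2 ^ (n div s) * conflict_bound ^ h)"
      using p0 by (simp add: stuck_bound_def)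
    show "w = w'" if "w \<in> ?W2" "w' \<in> ?W2" "stage1 (curry f) (fst w) (snd w)"
      "stage1 (curry f) (fst w') (snd w')" for f w w'
      using stage1_unique that by blast
    fix w assume "w \<in> ?W2"
    then have fam: "family (fst w)" by simp
    have "card (fst w 1) \<le> card (members (fst w))"
    proof (rule card_mono[OF finite_members[OF fam]])
      show "fst w 1 \<subseteq> members (fst w)" unfolding members_def by (rule UN_upper) simp
    qed
    also have "\<dots> \<le> card (members (fst w)) * s" using spar_pos by simp
    also have "\<dots> \<le> n" by (rule card_members_le[OF fam])
    finally have c: "real (card (fst w 1)) \<le> real n" by simp
    have "\<P>(f in G. stuck r n (curry f) t (fst w) \<or> crowded (fst w) h (curry f))
      \<le> \<P>(f in G. stuck r n (curry f) t (fst w)) + \<P>(f in G. crowded (fst w) h (curry f))"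
      by (rule prob_disj_le[OF ev_stuck[OF fam] ev_crowded[OF fam]])
    also have "\<dots> \<le> card (fst w 1) * stuck_bound t + n * (2 ^ (n div s) * conflict_bound ^ h)"
      by (intro add_mono prob_stuck[OF cb fam] prob_crowded[OF fam])
    also have "card (fst w 1) * stuck_bound t \<le> n * stuck_bound t"
      using c by (intro mult_right_mono) (simp_all add: stuck_bound_def)
    finally show "\<P>(f in G. stuck r n (curry f) t (fst w) \<or> crowded (fst w) h (curry f))
      \<le> n * stuck_bound t + n * (2 ^ (n div s) * conflict_bound ^ h)" by simp
  qed auto
  have B3: "\<P>(f in G. ?B3 f) \<le> place_bound l0 c0"
  proof (rule prob_revealed_le[OF fW3 ev_run_of ev_st])
    show "0 \<le> place_bound l0 c0" using place_prob_01 by (simp add: place_bound_def)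
    show "w = w'" if "w \<in> ?W3" "w' \<in> ?W3" "run_of w (curry f)" "run_of w' (curry f)" for f w w'
      using run_unique that by blast
    fix w assume "w \<in> ?W3"
    then show "\<P>(f in G. ?starved w f) \<le> place_bound l0 c0"
      by (cases w) (simp add: prob_starved)
  qed auto

  \<comment> \<open>Utilities lie in the interval from -1 to 1 only almost surely, so the case
    distinction cannot be made pointwise.\<close>
  have "AE f in G. ?S f \<or> ?B1 f \<or> ?B2 f \<or> ?B3 f"
    using AE_coord
  proof (rule AE_mp, intro AE_I2 impI)
    fix f :: "nat \<times> nat \<Rightarrow> real" assume bounded: "\<forall>j\<in>offdiag n. f j \<in> {-1..1}"
    let ?u = "curry f"
    show "?S f \<or> ?B1 f \<or> ?B2 f \<or> ?B3 f"
    proof (rule ccontr)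
      assume no: "\<not> (?S f \<or> ?B1 f \<or> ?B2 f \<or> ?B3 f)"
      obtain w where w: "w \<in> outcomes1" "stage1 ?u (fst w) (snd w)" using stage1_total by blast
      define pis R1 where "pis = fst w" and "R1 = snd w"
      have s1: "stage1 ?u pis R1" and o1: "(pis, R1) \<in> outcomes1"
        using w by (simp_all add: pis_def R1_def)
      have fam: "family pis" by (rule stage1_props(1)[OF s1])
      obtain pis2 Pc ch where run: "run ?u pis R1 pis2 Pc ch" using run_total[OF s1] by blast
      have out: "(pis, R1, pis2, Pc, ch) \<in> outcomes" by (rule run_outcome[OF o1 run])
      have small: "card (R1 i) < m" if i: "i \<in> {1..20}" for i
      proof (rule ccontr)
        assume "\<not> card (R1 i) < m"
        moreover have "greedy r n ?u i {} (part r n i) (pis i) (R1 i)"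
          using s1 i unfolding stage1_def by blast
        ultimately have "?L i f" by (meson not_less)
        then show False using no i by blast
      qed
      have "(pis, R1) \<in> ?W2" using o1 fam by simp
      then have ns: "\<not> stuck r n ?u t pis" and nc: "\<not> crowded pis h ?u"
        using no s1 by (metis (mono_tags, lifting) fst_conv snd_conv)+
      note sz = run_sizes[OF run t small ns] and rp = run_props[OF run]
      have "real (card (leftover R1 pis2)) \<le> real (40 * m + 40 + 20 * t * s)" using sz(1) by simp
      then have "card (leftover R1 pis2) \<le> l0" using l0 by linarith
      moreover have "c0 \<le> card {P\<in>Pc. no_check ch x P}" if x: "x \<in> leftover R1 pis2" for x
      proof -
        have "real (c0 + h) * real s \<le> real (card Pc) * real s" using c0 sz(2) by linarith
        then have "c0 + h \<le> card Pc" using spar_pos by simp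
        then show ?thesis using run_unblocked[OF run nc x] by linarith
      qed
      ultimately have "roomy l0 c0 R1 pis2 Pc ch"
        using rp by (auto simp: roomy_def matched_def)
      then have "(pis, R1, pis2, Pc, ch) \<in> ?W3" using out by simp
      moreover have "run_of (pis, R1, pis2, Pc, ch) ?u" using run by (simp add: run_of_def)
      ultimately have "\<not> starved R1 pis2 Pc ch f" using no by fastforce
      then have "?S f" using run_success[OF run out _ s6 bounded] by blast
      then show False using no by blast
    qed
  qed
  then have "\<P>(f in G. ?S f \<or> ?B1 f \<or> ?B2 f \<or> ?B3 f) = 1"
    by (rule iffD2[OF prob_Collect_eq_1[OF ev_sets[OF ev_disj[OF ev_success ev_disj[OF ev1 ev_disj[OF ev2 ev3]]]]]])
  then have "1 \<le> \<P>(f in G. ?S f \<or> ?B1 f \<or> ?B2 f \<or> ?B3 f)" by (simp only: order_refl)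
  moreover have "\<P>(f in G. ?S f \<or> ?B1 f \<or> ?B2 f \<or> ?B3 f)
      \<le> \<P>(f in G. ?S f) + \<P>(f in G. ?B1 f \<or> ?B2 f \<or> ?B3 f)"
    by (rule prob_disj_le[OF ev_success ev_disj[OF ev1 ev_disj[OF ev2 ev3]]])
  moreover have "\<P>(f in G. ?B1 f \<or> ?B2 f \<or> ?B3 f) \<le> \<P>(f in G. ?B1 f) + \<P>(f in G. ?B2 f \<or> ?B3 f)"
    by (rule prob_disj_le[OF ev1 ev_disj[OF ev2 ev3]])
  moreover have "\<P>(f in G. ?B2 f \<or> ?B3 f) \<le> \<P>(f in G. ?B2 f) + \<P>(f in G. ?B3 f)"
    by (rule prob_disj_le[OF ev2 ev3])
  ultimately show ?thesis using B1 B2 B3 by linarith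
qed

end

section \<open>Asymptotics\<close>

lemma power_one_minus_le_exp:
  fixes q :: real
  assumes "0 \<le> q" "q \<le> 1"
  shows "(1 - q) ^ k \<le> exp (- q * real k)"
proof -
  have "(1 - q) ^ k \<le> exp (- q) ^ k"
    using assms exp_ge_add_one_self[of "- q"] by (intro power_mono) auto
  also have "\<dots> = exp (- q * real k)" using exp_of_nat_mult[of k "- q"] by (simp add: mult.commute)
  finally show ?thesis .
qed

lemma power_eq_exp: "0 < x \<Longrightarrow> x ^ k = exp (real k * ln (x::real))"
  by (simp add: exp_of_nat_mult)

lemma spar_bounds:
  assumes "2 \<le> n"
  shows "ln (real n) / (2 * ln 16) \<le> real (spar n)" "real (spar n) \<le> ln (real n) / (2 * ln 16) + 1"
    "0 < spar n"
proof -
  have eq: "log 16 (real n) / 2 = ln (real n) / (2 * ln 16)" by (simp add: log_def)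
  have pos: "0 < ln (real n) / (2 * ln 16)" using assms by simp
  show "ln (real n) / (2 * ln 16) \<le> real (spar n)"
    unfolding spar_def eq by linarith
  show "real (spar n) \<le> ln (real n) / (2 * ln 16) + 1"
    unfolding spar_def eq using pos by linarith
  show "0 < spar n" unfolding spar_def eq using pos by simp
qed

text \<open>Dominates \<open>40 * m + 40 + 20 * t * s\<close> when \<open>m\<close> and
  \<open>t\<close> are \<open>x powr (3/5)\<close> and \<open>sqrt x\<close> rounded up and
  \<open>s\<close> is at most \<open>ln x\<close>.\<close>

definition left_bound :: "real \<Rightarrow> real" where
  "left_bound x = 40 * (x powr (3/5) + 1) + 40 + 20 * (sqrt x + 1) * ln x"

locale large_algorithm = algorithm +
  assumes n2: "2 \<le> n" and s_le: "ln (real n) / (2 * ln 16) + 1 \<le> ln (real n)"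
begin

abbreviation L :: real where "L \<equiv> ln (real n)"

lemma L_pos: "0 < L" using n2 by simp

lemma s_bounds: "L / (2 * ln 16) \<le> real s" "real s \<le> L / (2 * ln 16) + 1" "real s \<le> L"
  using spar_bounds(1,2)[OF n2] s_le by linarith+

text \<open>The ceiling in \<open>spar\<close> adds at most 1, so 16^(s-1) is at most sqrt n and
  4^(s-1) at most n^(1/4). Both rates used below come from here.\<close>

lemma s_pred: "(real s - 1) * ln 16 \<le> L / 2"
proof -
  have "(real s - 1) * ln 16 \<le> L / (2 * ln 16) * ln 16"
    using s_bounds(2) by (intro mult_right_mono) auto
  then show ?thesis by simp
qed

text \<open>Attaching to \<open>s - 1\<close> agents has probability at least
  \<open>1 / sqrt n\<close>. The resulting exponent is of order n^(1/10) and outweighs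
  \<open>L * L\<close>, the logarithm of the bound on the number of candidate sets.\<close>

lemma short_bound_le:
  assumes m: "real n powr (3/5) \<le> real m"
  shows "short_bound m \<le> exp (L * L) * exp (- (real n powr (3/5) - L) / sqrt (real n))"
proof -
  let ?q = "(1/16) ^ (s - 1) :: real"
  have s1: "real (s - 1) = real s - 1" using spar_pos by (simp add: of_nat_diff Suc_le_eq)
  have "real n ^ (s - 1) = exp (real (s - 1) * L)" using n2 by (intro power_eq_exp) simp
  also have "\<dots> \<le> exp (L * L)"
    using s_bounds(3) L_pos unfolding s1 by (simp add: mult_right_mono)
  finally have 1: "real n ^ (s - 1) \<le> exp (L * L)" .
  have "sqrt (real n) = exp (L / 2)"
    using n2 by (intro real_sqrt_unique) (auto simp: power2_eq_square simp flip: exp_add)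
  then have "1 / sqrt (real n) = exp (- (L / 2))" by (simp add: exp_minus inverse_eq_divide)
  also have "\<dots> \<le> exp (real (s - 1) * ln (1/16))"
    using s_pred unfolding s1 by (simp add: ln_div)
  also have "\<dots> = ?q" by (rule power_eq_exp[symmetric]) simp
  finally have q: "1 / sqrt (real n) \<le> ?q" .
  have "(real n powr (3/5) - L) / sqrt (real n) \<le> real (m - s) / sqrt (real n)"
    using m s_bounds(3) by (intro divide_right_mono) auto
  also have "\<dots> \<le> ?q * real (m - s)"
    using mult_right_mono[OF q, of "real (m - s)"] by simp
  finally have "- ?q * real (m - s) \<le> - (real n powr (3/5) - L) / sqrt (real n)"
    by (simp only: minus_divide_left[symmetric] mult_minus_left neg_le_iff_le)
  then have "exp (- ?q * real (m - s)) \<le> exp (- (real n powr (3/5) - L) / sqrt (real n))"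
    by (simp only: exp_le_cancel_iff)
  moreover have "(1 - ?q) ^ (m - s) \<le> exp (- ?q * real (m - s))"
    by (rule power_one_minus_le_exp) (auto simp: power_le_one)
  ultimately have 2: "(1 - ?q) ^ (m - s) \<le> exp (- (real n powr (3/5) - L) / sqrt (real n))"
    by (rule order_trans[rotated])
  show ?thesis
    unfolding short_bound_def using 1 2 by (intro mult_mono) (auto simp: power_le_one)
qed

lemma stuck_bound_le:
  assumes "sqrt (real n) \<le> real t"
  shows "stuck_bound t \<le> (real n + 1) ^ 20 * 2 powr (- sqrt (real n))"
proof -
  have "(1/2 :: real) ^ t = 2 powr (- real t)"
    by (simp add: powr_minus powr_realpow power_one_over inverse_eq_divide)
  also have "\<dots> \<le> 2 powr (- sqrt (real n))" using assms by simp
  finally show ?thesis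
    unfolding stuck_bound_def by (simp add: add.commute mult_left_mono)
qed

text \<open>As \<open>200 * h\<close> is at least \<open>2 * n / s\<close>, the power of
  \<open>conflict_bound\<close> cancels the number of subsets and still leaves
  \<open>2 powr (- n / s)\<close>.\<close>

lemma crowded_bound_le:
  assumes cb: "conflict_bound \<le> (1/2) ^ 200" and h: "real n / (100 * real s) \<le> real h"
  shows "2 ^ (n div s) * conflict_bound ^ h \<le> 2 powr (- real n / L)"
proof -
  have p0: "0 \<le> conflict_bound" by (simp add: conflict_bound_def)
  have "conflict_bound ^ h \<le> ((1/2) ^ 200) ^ h" using cb p0 by (rule power_mono)
  also have "\<dots> = (1/2 :: real) ^ (200 * h)" by (rule power_mult[symmetric])
  also have "\<dots> = 2 powr (- real (200 * h))"
    by (simp only: powr_minus powr_realpow power_one_over inverse_eq_divide zero_less_numeral)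
  also have "\<dots> \<le> 2 powr (- 2 * (real n / real s))"
  proof (rule powr_mono)
    have "real n / real s = 100 * (real n / (100 * real s))" by simp
    then show "- real (200 * h) \<le> - 2 * (real n / real s)" using h by simp
  qed simp
  finally have 1: "conflict_bound ^ h \<le> 2 powr (- 2 * (real n / real s))" .
  have "(2::real) ^ (n div s) = 2 powr real (n div s)" by (simp add: powr_realpow)
  also have "\<dots> \<le> 2 powr (real n / real s)" using of_nat_div_le_of_nat[of n s, where ?'a = real] by simp
  finally have 2: "(2::real) ^ (n div s) \<le> 2 powr (real n / real s)" .
  have "2 ^ (n div s) * conflict_bound ^ h \<le> 2 powr (real n / real s) * 2 powr (- 2 * (real n / real s))"
    using 1 2 p0 by (intro mult_mono) auto
  also have "\<dots> = 2 powr (- (real n / real s))" by (simp flip: powr_add)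
  also have "\<dots> \<le> 2 powr (- real n / L)"
    using s_bounds(3) spar_pos by (simp add: frac_le)
  finally show ?thesis .
qed

text \<open>The rate n^(-1/4) / 32 bounds \<open>place_prob\<close> from below: 4^(s-1) is at most
  n^(1/4), the two further powers of 4 contribute 16 and the final halving 2.\<close>

lemma place_bound_le:
  assumes l0: "real l0 \<le> left_bound (real n)" and c0: "real n / (50 * L) - 1 \<le> real c0"
  shows "place_bound l0 c0 \<le> real n * (exp (left_bound (real n) * L) *
    exp (- (real n powr (- (1/4)) / 32 * (real n / (50 * L) - 1 - left_bound (real n)))))"
proof -
  have "real n ^ l0 = exp (real l0 * L)" using n2 by (intro power_eq_exp) simp
  also have "\<dots> \<le> exp (left_bound (real n) * L)" using l0 L_pos by (simp add: mult_right_mono)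
  finally have 1: "real n ^ l0 \<le> exp (left_bound (real n) * L)" .
  have ln16: "ln (16::real) = 2 * ln 4"
    using ln_realpow[of "4::real" 2] by simp
  have "(real s + 1) * ln 4 \<le> L / 4 + 2 * ln 4"
    using s_pred unfolding ln16 by (simp add: algebra_simps)
  then have "exp (- (L / 4)) * exp (- (2 * ln 4)) \<le> exp (real (s + 1) * ln (1/4))"
    by (simp add: ln_div algebra_simps flip: exp_add)
  also have "\<dots> = (1/4) ^ (s + 1)" by (rule power_eq_exp[symmetric]) simp
  finally have "exp (- (L / 4)) * exp (- (2 * ln 4)) / 2 \<le> place_prob"
    unfolding place_prob_def by (rule divide_right_mono) simp
  moreover have "exp (- (2 * ln (4::real))) = 1 / 16"
    unfolding ln16[symmetric] by (simp add: exp_minus)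
  moreover have "exp (- (L / 4)) = real n powr (- (1/4))" using n2 by (simp add: powr_def)
  ultimately have q: "real n powr (- (1/4)) / 32 \<le> place_prob" by simp
  \<comment> \<open>Truncated subtraction in \<open>c0 - l0\<close> can only raise the value, so the
    estimate is sound also when \<open>c0 < l0\<close>.\<close>
  have "real n powr (- (1/4)) / 32 * (real n / (50 * L) - 1 - left_bound (real n))
    \<le> real n powr (- (1/4)) / 32 * real (c0 - l0)"
    using l0 c0 by (intro mult_left_mono) auto
  also have "\<dots> \<le> place_prob * real (c0 - l0)" using q by (intro mult_right_mono) auto
  finally have "exp (- place_prob * real (c0 - l0))
    \<le> exp (- (real n powr (- (1/4)) / 32 * (real n / (50 * L) - 1 - left_bound (real n))))" by simp
  moreover have "(1 - place_prob) ^ (c0 - l0) \<le> exp (- place_prob * real (c0 - l0))"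
    using place_prob_01 by (rule power_one_minus_le_exp)
  ultimately have 2: "(1 - place_prob) ^ (c0 - l0)
    \<le> exp (- (real n powr (- (1/4)) / 32 * (real n / (50 * L) - 1 - left_bound (real n))))"
    by (rule order_trans[rotated])
  show ?thesis
    unfolding place_bound_def using 1 2 place_prob_01 by (intro mult_left_mono mult_mono) auto
qed

lemma conflict_bound_le: "conflict_bound \<le> 2 * L * exp (- (L / (2 * ln 16)) / 12800)"
  unfolding conflict_bound_def using s_bounds L_pos by (intro mult_mono) auto

end

text \<open>The summands belong, in this order, to Stage 1, to stuck rounds, to crowded cliques and
  to starved agents.\<close>

definition error_bound :: "real \<Rightarrow> real" where
  "error_bound x = 20 * (x * (exp (ln x * ln x) * exp (- (x powr (3/5) - ln x) / sqrt x))) +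
     (x * ((x + 1) ^ 20 * 2 powr (- sqrt x)) + x * 2 powr (- x / ln x)) +
     x * (exp (left_bound x * ln x) *
       exp (- (x powr (- (1/4)) / 32 * (x / (50 * ln x) - 1 - left_bound x))))"

text \<open>The competing exponents are n^(1/10) against (ln n)^2 in the first summand and n^(3/4) /
  ln n against n^(3/5) * ln n in the last.\<close>

lemma error_bound_tendsto: "(error_bound \<longlongrightarrow> 0) at_top"
proof -
  have 1: "((\<lambda>x::real. 20 * (x * (exp (ln x * ln x) * exp (- (x powr (3/5) - ln x) / sqrt x)))) \<longlongrightarrow> 0) at_top"
    by real_asymp
  have 2: "((\<lambda>x::real. x * ((x + 1) ^ 20 * 2 powr (- sqrt x))) \<longlongrightarrow> 0) at_top"
    by real_asymp
  have 3: "((\<lambda>x::real. x * 2 powr (- x / ln x)) \<longlongrightarrow> 0) at_top"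
    by real_asymp
  have 4: "((\<lambda>x::real. x * (exp (left_bound x * ln x) *
       exp (- (x powr (- (1/4)) / 32 * (x / (50 * ln x) - 1 - left_bound x))))) \<longlongrightarrow> 0) at_top"
    unfolding left_bound_def by real_asymp
  show ?thesis
    unfolding error_bound_def using tendsto_add[OF tendsto_add[OF 1 tendsto_add[OF 2 3]] 4] by simp
qed

text \<open>The second condition yields \<open>s \<ge> 6\<close>, the third
  \<open>s \<le> ln n\<close> and the fourth bounds \<open>conflict_bound\<close>. The last
  guarantees enough coalitions: 3/100 = 1/50 + 1/100 accounts for \<open>c0\<close> and
  \<open>h\<close>, against the 1/20 of all agents in one part.\<close>

definition large :: "real \<Rightarrow> bool" where
  "large x \<longleftrightarrow> 2 \<le> x \<and> 6 \<le> ln x / (2 * ln 16) \<and> ln x / (2 * ln 16) + 1 \<le> ln x \<and>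
     2 * ln x * exp (- (ln x / (2 * ln 16)) / 12800) \<le> (1/2) ^ 200 \<and>
     3 * x / 100 + ln x \<le> x / 20 - 1 - (x powr (3/5) + 1) - (sqrt x + 1) * ln x"

lemma eventually_large: "eventually large at_top"
proof -
  have "((\<lambda>x::real. 2 * ln x * exp (- (ln x / (2 * ln 16)) / 12800)) \<longlongrightarrow> 0) at_top"
    by real_asymp
  then have "eventually (\<lambda>x::real. 2 * ln x * exp (- (ln x / (2 * ln 16)) / 12800) < (1/2) ^ 200) at_top"
    by (rule order_tendstoD) simp
  then have 1: "eventually (\<lambda>x::real. 2 * ln x * exp (- (ln x / (2 * ln 16)) / 12800) \<le> (1/2) ^ 200) at_top"
    by (rule eventually_mono) simp
  have 2: "eventually (\<lambda>x::real. 6 \<le> ln x / (2 * ln 16)) at_top" by real_asymp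
  have ln16: "ln (16::real) > 1"     using exp_le ln_less_cancel_iff[of "exp 1" "16::real"] by simp
  have "eventually (\<lambda>x::real. ln x / (2 * ln 16) + 1 \<le> ln x) at_top"
    using eventually_ge_at_top[of "exp (2::real)"]
  proof (rule eventually_mono)
    fix x :: real assume "exp 2 \<le> x"
    then have "2 \<le> ln x" by (simp add: ln_ge_iff order_less_le_trans[OF exp_gt_zero])
    moreover have "ln x / (2 * ln 16) \<le> ln x / 2"
      using ln16 \<open>2 \<le> ln x\<close> by (intro divide_left_mono) auto
    ultimately show "ln x / (2 * ln 16) + 1 \<le> ln x" by linarith
  qed
  moreover have "eventually (\<lambda>x::real. 3 * x / 100 + ln x \<le> x / 20 - 1 - (x powr (3/5) + 1) - (sqrt x + 1) * ln x) at_top"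
    by real_asymp
  ultimately show ?thesis
    using 1 2 eventually_ge_at_top[of "2::real"] unfolding large_def by (intro eventually_conj)
qed

lemma prob_success_ge:
  assumes valid: "valid_rules r" and large: "large (real n)"
  shows "1 - error_bound (real n)
    \<le> \<P>(f in game_measure n. alg_success r n (curry f))"
proof -
  have n2: "2 \<le> n" using large by (simp add: large_def)
  interpret large_algorithm n r
    using valid spar_bounds(3)[OF n2] n2 large by unfold_locales (simp_all add: large_def)
  \<comment> \<open>\<open>m\<close>, \<open>t\<close> and \<open>h\<close> are rounded up because
    the failure bounds decrease in them; \<open>c0\<close> is a number of coalitions that must be
    available and is rounded down.\<close>
  define m where "m = nat \<lceil>real n powr (3/5)\<rceil>"
  define t where "t = nat \<lceil>sqrt (real n)\<rceil>"
  define h where "h = nat \<lceil>real n / (100 * real s)\<rceil>"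
  define c0 where "c0 = nat \<lfloor>real n / (50 * real s)\<rfloor>"
  define l0 where "l0 = 40 * m + 40 + 20 * t * s"
  have sp: "0 < real s" using spar_pos by simp
  have m: "real n powr (3/5) \<le> real m" "real m \<le> real n powr (3/5) + 1"
    unfolding m_def using powr_ge_zero[of "real n" "3/5"] by linarith+
  have t: "sqrt (real n) \<le> real t" "real t \<le> sqrt (real n) + 1"
    unfolding t_def using real_sqrt_ge_zero[of "real n"] by linarith+
  have h: "real n / (100 * real s) \<le> real h" "real h \<le> real n / (100 * real s) + 1"
  proof -
    have "0 \<le> real n / (100 * real s)" by simp
    then show "real n / (100 * real s) \<le> real h" "real h \<le> real n / (100 * real s) + 1"
      unfolding h_def by linarith+
  qed
  have c0: "real n / (50 * real s) - 1 \<le> real c0" "real c0 \<le> real n / (50 * real s)"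
  proof -
    have "0 \<le> real n / (50 * real s)" by simp
    then show "real n / (50 * real s) - 1 \<le> real c0" "real c0 \<le> real n / (50 * real s)"
      unfolding c0_def by linarith+
  qed
  have ts: "real t * real s \<le> (sqrt (real n) + 1) * L"
    using t s_bounds(3) by (intro mult_mono) auto
  have s6: "6 \<le> s" using s_bounds(1) large unfolding large_def by linarith
  have cb: "conflict_bound \<le> (1/2) ^ 200"
    using conflict_bound_le large unfolding large_def by linarith
  have cb': "20 * conflict_bound \<le> 1/2"
  proof -
    have "(1/2 :: real) ^ 200 \<le> (1/2) ^ 6" by (rule power_decreasing) auto
    also have "\<dots> = 1 / 64" by (simp add: power_numeral_reduce)
    finally show ?thesis using cb by linarith
  qed
  have cap: "real (c0 + h) * real s \<le> real n / 20 - 1 - real m - real t * real s"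
  proof -
    have "real (c0 + h) * real s \<le> (real n / (50 * real s) + (real n / (100 * real s) + 1)) * real s"
      using c0(2) h(2) by (intro mult_right_mono) auto
    also have "\<dots> = 3 * real n / 100 + real s" using sp by (simp add: field_simps)
    also have "\<dots> \<le> 3 * real n / 100 + L" using s_bounds(3) by simp
    also have "\<dots> \<le> real n / 20 - 1 - (real n powr (3/5) + 1) - (sqrt (real n) + 1) * L"
      using large unfolding large_def by linarith
    finally show ?thesis using m(2) ts by linarith
  qed
  have l0: "real l0 \<le> left_bound (real n)"
    unfolding l0_def left_bound_def using m(2) ts by (simp add: algebra_simps)
  have c0': "real n / (50 * L) - 1 \<le> real c0"
  proof -
    have "real n / (50 * L) \<le> real n / (50 * real s)"
      using s_bounds(3) sp by (intro divide_left_mono) auto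
    then show ?thesis using c0(1) by linarith
  qed
  have "0 < real n powr (3/5)" "0 < sqrt (real n)" using n2 by simp_all
  then have "0 < m" "0 < t" using m(1) t(1) by linarith+
  from prob_success[OF s6 cb' this _ cap, of l0]
  have "1 - (20 * (n * short_bound m) + (n * stuck_bound t + n * (2 ^ (n div s) * conflict_bound ^ h)) +
      place_bound l0 c0) \<le> \<P>(f in G. alg_success r n (curry f))" by (simp add: l0_def)
  moreover have "20 * (n * short_bound m)
      \<le> 20 * (real n * (exp (L * L) * exp (- (real n powr (3/5) - L) / sqrt (real n))))"
    using short_bound_le[OF m(1)] by (intro mult_left_mono) auto
  moreover have "n * stuck_bound t \<le> real n * ((real n + 1) ^ 20 * 2 powr (- sqrt (real n)))"
    using stuck_bound_le[OF t(1)] by (intro mult_left_mono) auto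
  moreover have "n * (2 ^ (n div s) * conflict_bound ^ h) \<le> real n * 2 powr (- real n / L)"
    using crowded_bound_le[OF cb h(1)] by (intro mult_left_mono) auto
  moreover note place_bound_le[OF l0 c0']
  ultimately show ?thesis unfolding error_bound_def by linarith
qed

theorem theorem16:
  assumes "valid_rules r"
  shows "(\<lambda>n. measure (game_measure n)
            {f \<in> space (game_measure n). alg_success r n (\<lambda>a b. f (a, b))})
         \<longlonglongrightarrow> 1"
proof (rule tendsto_sandwich)
  have curry: "curry f = (\<lambda>a b. f (a, b))" for f :: "nat \<times> nat \<Rightarrow> real"
    by (simp add: fun_eq_iff)
  have "eventually (\<lambda>n. large (real n)) sequentially"
    using eventually_large filterlim_real_sequentially by (rule eventually_compose_filterlim)
  then show "\<forall>\<^sub>F n in sequentially. 1 - error_bound (real n) \<le> measure (game_measure n)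
            {f \<in> space (game_measure n). alg_success r n (\<lambda>a b. f (a, b))}"
    by (rule eventually_mono) (use prob_success_ge[OF assms] in \<open>simp only: curry\<close>)
  have "prob_space (game_measure n)" for n
    unfolding game_measure_def by (intro prob_space_PiM prob_space_unif)
  then show "\<forall>\<^sub>F n in sequentially. measure (game_measure n)
            {f \<in> space (game_measure n). alg_success r n (\<lambda>a b. f (a, b))} \<le> 1"
    by (intro always_eventually allI prob_space.prob_le_1)
  have "(\<lambda>n. error_bound (real n)) \<longlonglongrightarrow> 0"
    by (rule filterlim_compose[OF error_bound_tendsto filterlim_real_sequentially])
  then show "(\<lambda>n. 1 - error_bound (real n)) \<longlonglongrightarrow> 1"
    using tendsto_diff[OF tendsto_const[of "1::real"]] by fastforce
qed simp

end
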